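(* Let $\Gamma \subset \mathbb{R}^2$ be a lattice with point group $P(\Gamma)$, such that $\Gamma$ is not a rhombic lattice. Then there is a compact fundamental cell $F$ of $\Gamma$ with symmetry group $S(F)$ such that $P(\Gamma)$ is a subgroup of $S(F)$ of index $[S(F):P(\Gamma)]=2$.
   Context: A lattice in $\mathbb{R}^d$ is the $\mathbb{Z}$-span $\langle b_1,\dots,b_d\rangle_{\mathbb{Z}}$ of $d$ linearly independent vectors $b_1,\dots,b_d\in\mathbb{R}^d$ (a basis of the lattice). The point group $P(\Gamma)\subset O(d)$ of a lattice $\Gamma$ is the group of orthogonal maps of $\mathbb{R}^d$ mapping $\Gamma$ onto itself. For a set $X\subset\mathbb{R}^d$, its symmetry group $S(X)$ is the group of all Euclidean isometries $\varphi:\mathbb{R}^d\to\mathbb{R}^d$ (including reflections and translations) with $\varphi(X)=X$. A fundamental cell of a lattice $\Gamma$ is a compact set $F\subset\mathbb{R}^d$ (the closure of a geometric embedding of $\mathbb{R}^d/\Gamma$ into $\mathbb{R}^d$) such that $\{F+g : g\in\Gamma\}$ is a tiling of $\mathbb{R}^d$, i.e. the translates cover $\mathbb{R}^d$ and have pairwise disjoint interiors. A planar lattice $\Gamma$ is called rhombic if it has a basis of two vectors of equal length whose angle is none of $\pi/3$, $\pi/2$, $2\pi/3$. *)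

theory Defs
  imports "HOL-Analysis.Analysis" "HOL-Algebra.Coset"
begin

definition lattice_basis :: "('n::finite \<Rightarrow> real^'n) \<Rightarrow> (real^'n) set \<Rightarrow> bool" where
  "lattice_basis b \<Gamma> \<longleftrightarrow>
     inj b \<and> independent (range b) \<and>
     \<Gamma> = {(\<Sum>i\<in>UNIV. of_int (c i) *\<^sub>R b i) | c :: 'n \<Rightarrow> int. True}"

definition is_lattice :: "(real^'n::finite) set \<Rightarrow> bool" where
  "is_lattice \<Gamma> \<longleftrightarrow> (\<exists>b. lattice_basis b \<Gamma>)"

definition point_group :: "(real^'n::finite) set \<Rightarrow> (real^'n \<Rightarrow> real^'n) set" where
  "point_group \<Gamma> = {f. orthogonal_transformation f \<and> f ` \<Gamma> = \<Gamma>}"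

definition symmetry_group :: "(real^'n::finite) set \<Rightarrow> (real^'n \<Rightarrow> real^'n) monoid" where
  "symmetry_group X =
     \<lparr>carrier = {\<phi>. (\<forall>x y. dist (\<phi> x) (\<phi> y) = dist x y) \<and> \<phi> ` X = X},
      monoid.mult = (\<circ>), one = id\<rparr>"

text \<open>
  A geometric embedding of the quotient of the space by \<open>\<Gamma>\<close> is a set \<open>E\<close> containing exactly one
  representative of every coset of \<open>\<Gamma>\<close>.
\<close>

definition fundamental_cell :: "(real^'n::finite) set \<Rightarrow> (real^'n) set \<Rightarrow> bool" where
  "fundamental_cell \<Gamma> F \<longleftrightarrow>
     compact F \<and>
     (\<exists>E. (\<forall>x. \<exists>!y. y \<in> E \<and> y - x \<in> \<Gamma>) \<and> F = closure E) \<and>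
     (\<Union>g\<in>\<Gamma>. (\<lambda>x. x + g) ` F) = UNIV \<and>
     (\<forall>g\<in>\<Gamma>. \<forall>h\<in>\<Gamma>. g \<noteq> h \<longrightarrow>
        interior ((\<lambda>x. x + g) ` F) \<inter> interior ((\<lambda>x. x + h) ` F) = {})"

definition vec_angle :: "real^'n::finite \<Rightarrow> real^'n \<Rightarrow> real" where
  "vec_angle u v = arccos (inner u v / (norm u * norm v))"

definition rhombic :: "(real^2) set \<Rightarrow> bool" where
  "rhombic \<Gamma> \<longleftrightarrow>
     (\<exists>b :: 2 \<Rightarrow> real^2. lattice_basis b \<Gamma> \<and> norm (b 1) = norm (b 2) \<and>
        vec_angle (b 1) (b 2) \<notin> {pi / 3, pi / 2, 2 * pi / 3})"

lemma isometry_bij: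
  fixes \<phi> :: "real^'n::finite \<Rightarrow> real^'n"
  assumes "\<And>x y. dist (\<phi> x) (\<phi> y) = dist x y"
  shows "bij \<phi>"
proof -
  have "orthogonal_transformation (\<lambda>x. \<phi> x - \<phi> 0)"
    unfolding orthogonal_transformation_isometry using assms by (simp add: dist_norm)
  then have "bij (\<lambda>x. \<phi> x - \<phi> 0)"
    by (rule orthogonal_transformation_bij)
  then have "bij ((\<lambda>x. x + \<phi> 0) \<circ> (\<lambda>x. \<phi> x - \<phi> 0))"
    by (intro bij_comp) (auto intro!: bij_plus_right)
  then show ?thesis by (simp add: o_def)
qed

lemma group_symmetry_group: "group (symmetry_group X)"
proof (rule groupI)
  fix \<phi> assume "\<phi> \<in> carrier (symmetry_group X)"
  then have iso: "\<And>x y. dist (\<phi> x) (\<phi> y) = dist x y" and X: "\<phi> ` X = X"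
    by (auto simp: symmetry_group_def)
  have b: "bij \<phi>" using iso by (rule isometry_bij)
  then have "\<And>x y. dist (inv_into UNIV \<phi> x) (inv_into UNIV \<phi> y) = dist x y"
    by (metis iso bij_inv_eq_iff)
  moreover have "inv_into UNIV \<phi> ` X = X"
    using b X by (metis bij_is_inj image_inv_f_f)
  moreover have "inv_into UNIV \<phi> \<circ> \<phi> = id"
    using b by (simp add: bij_is_inj)
  ultimately show "\<exists>\<psi>\<in>carrier (symmetry_group X). \<psi> \<otimes>\<^bsub>symmetry_group X\<^esub> \<phi> = \<one>\<^bsub>symmetry_group X\<^esub>"
    by (auto simp: symmetry_group_def)
next
  fix \<phi> \<psi> assume "\<phi> \<in> carrier (symmetry_group X)" "\<psi> \<in> carrier (symmetry_group X)"
  then show "\<phi> \<otimes>\<^bsub>symmetry_group X\<^esub> \<psi> \<in> carrier (symmetry_group X)"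
    by (simp add: symmetry_group_def) (metis image_image)
qed (auto simp: symmetry_group_def)

lemma subgroup_point_group: "subgroup (point_group \<Gamma>) (symmetry_group \<Gamma>)"
proof (rule group.subgroupI [OF group_symmetry_group])
  show "point_group \<Gamma> \<subseteq> carrier (symmetry_group \<Gamma>)"
    by (auto simp: point_group_def symmetry_group_def orthogonal_transformation_isometry)
  have "id \<in> point_group \<Gamma>"
    by (auto simp: point_group_def orthogonal_transformation_isometry)
  then show "point_group \<Gamma> \<noteq> {}" by blast
next
  fix f assume f: "f \<in> point_group \<Gamma>"
  then have o: "orthogonal_transformation f" and im: "f ` \<Gamma> = \<Gamma>"
    by (auto simp: point_group_def)
  let ?g = "inv_into UNIV f"
  have b: "bij f" using o by (rule orthogonal_transformation_bij)
  have g: "?g \<in> point_group \<Gamma>"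
    using orthogonal_transformation_inv [OF o] im b
    by (simp add: point_group_def) (metis bij_is_inj image_inv_f_f)
  have iso: "h \<in> carrier (symmetry_group \<Gamma>)" if "h \<in> point_group \<Gamma>" for h
    using that by (auto simp: point_group_def symmetry_group_def orthogonal_transformation_isometry)
  have "?g \<otimes>\<^bsub>symmetry_group \<Gamma>\<^esub> f = \<one>\<^bsub>symmetry_group \<Gamma>\<^esub>"
    using b by (simp add: symmetry_group_def bij_is_inj)
  then have "inv\<^bsub>symmetry_group \<Gamma>\<^esub> f = ?g"
    by (rule group.inv_equality [OF group_symmetry_group _ iso [OF f] iso [OF g]])
  with g show "inv\<^bsub>symmetry_group \<Gamma>\<^esub> f \<in> point_group \<Gamma>" by simp
next
  fix f h assume "f \<in> point_group \<Gamma>" "h \<in> point_group \<Gamma>"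
  then show "f \<otimes>\<^bsub>symmetry_group \<Gamma>\<^esub> h \<in> point_group \<Gamma>"
    by (simp add: symmetry_group_def point_group_def orthogonal_transformation_compose)
      (metis image_image)
qed

end

theory Submission
  imports Defs
begin

text \<open>
  Let \<open>P\<close> be the point group and let \<open>D = P \<union> P\<sigma>\<close> be a group containing \<open>P\<close> with index two. It suffices
  to find a bounded open \<open>D\<close>-invariant set \<open>I\<close> whose translates under \<open>\<Gamma>\<close> are disjoint with dense union:
  adding two generic \<open>D\<close>-orbits of isolated points to the closure of \<open>I\<close> gives a cell whose
  symmetry group is exactly \<open>D\<close>.

  Reduction of bases shows that a lattice that is not rhombic has point group \<open>{id, - id}\<close> or is
  rectangular or hexagonal. For a rectangular lattice with commensurable, distinct side lengths \<open>\<sigma>\<close> is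
  the quarter turn and \<open>I\<close> is an explicit union of boxes. In all other cases \<open>\<sigma>\<close> can be chosen
  with \<open>\<Gamma> \<inter> \<sigma>\<Gamma> = {0}\<close>: a generic reflection, a rotation by \<open>\<pi>/4\<close> (square lattice), by \<open>\<pi>/6\<close>
  (hexagonal lattice) or by \<open>\<pi>/2\<close> (incommensurable rectangle). Then \<open>I\<close> arises by rounding a fractional
  solution. Start with a compactly supported \<open>D\<close>-invariant function \<open>m \<ge> 0\<close> that sums to one over all
  cosets of \<open>\<Gamma>\<close> and of \<open>\<sigma>\<Gamma>\<close>, namely averaged overlap areas of fundamental cells. On every coset of
  \<open>\<Gamma> + \<sigma>\<Gamma>\<close> such an \<open>m\<close> is a doubly stochastic matrix of finite range. Given a nonempty open set \<open>U\<close>,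
  either Hall's condition fails near some \<open>p \<in> U\<close> once the entry \<open>m(p)\<close> is forbidden, which forces
  \<open>m = 1\<close> near \<open>p\<close>; or all entries in a small open subset of \<open>U\<close> can be made zero by a modification
  that is finite on every coset. Running through a countable base of open sets, the interiors of the
  forced sets exhaust a set \<open>I\<close> with the required properties.
\<close>

section \<open>Removing one entry of a doubly stochastic matrix\<close>

text \<open>A coset of \<open>\<Gamma> + \<sigma>\<Gamma>\<close> is a matrix only because
  \<open>\<Gamma> \<inter> \<sigma>\<Gamma> = {0}\<close>: its points are then
  \<open>p + s + c\<close> for unique \<open>s\<close> and \<open>c\<close>, and those lying in a
  small open set sit in columns far apart. Commensurable rectangles violate this and get their own
  construction.

  Solving each matrix separately could produce a set without interior. The remedy is to keep only
  the entries whose value one is forced by a Hall violator. A violator is a finite certificate, so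
  it survives a small change of \<open>p\<close>; it also survives further deletions, since a
  solution that vanishes on more entries is still a solution for fewer. Hence no limit of the
  functions \<open>m\<close> is ever taken.

  The price is locality. A violator or a repair has to be found within a bounded part of an infinite
  matrix, uniformly over all cosets. This is why altered columns are kept in clusters of bounded
  diameter and why the admissible range exceeds the range in use.

  Nothing is known about further symmetries of \<open>I\<close> itself. Isolated points break them
  without affecting the tiling, because they add nothing to the interior of the cell.\<close>

lemma compact_box_functions:
  fixes C :: real
  assumes "finite E"
  shows "compact {f :: 'a \<Rightarrow> real. (\<forall>p\<in>E. 0 \<le> f p \<and> f p \<le> C) \<and> (\<forall>p. p \<notin> E \<longrightarrow> f p = 0)}"
proof -
  let ?S = "\<lambda>p. if p \<in> E then {0..C} else {0}"
  have eq: "{f :: 'a \<Rightarrow> real. (\<forall>p\<in>E. 0 \<le> f p \<and> f p \<le> C) \<and> (\<forall>p. p \<notin> E \<longrightarrow> f p = 0)} = PiE UNIV ?S"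
    by (auto simp: PiE_def Pi_def split: if_splits)
  have "compactin (product_topology (\<lambda>i. euclidean) UNIV) (PiE UNIV ?S)"
    unfolding compactin_PiE by auto
  then show ?thesis
    unfolding eq by (simp add: euclidean_product_topology)
qed

text \<open>The transportation polytope with the margins of \<open>w\<close> and support in
  \<open>G\<close>. Values outside \<open>A \<times> B\<close> are left free.\<close>

definition feasible_on :: "'a set \<Rightarrow> 'b set \<Rightarrow> ('a \<times> 'b) set \<Rightarrow> ('a \<Rightarrow> 'b \<Rightarrow> real) \<Rightarrow> ('a \<Rightarrow> 'b \<Rightarrow> real) \<Rightarrow> bool" where
  "feasible_on A B G w w' \<longleftrightarrow>
     (\<forall>r\<in>A. \<forall>c\<in>B. 0 \<le> w' r c \<and> (w' r c \<noteq> 0 \<longrightarrow> (r, c) \<in> G)) \<and>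
     (\<forall>r\<in>A. (\<Sum>c\<in>B. w' r c) = (\<Sum>c\<in>B. w r c)) \<and>
     (\<forall>c\<in>B. (\<Sum>r\<in>A. w' r c) = (\<Sum>r\<in>A. w r c))"

text \<open>Extended by zero off \<open>A \<times> B \<inter> G\<close>, the feasible arrays form a
  closed subset of a compact box; the total mass bounds every entry. An attained minimum is
  essential, because the alternating walks of \<open>min_cut\<close> start at the minimiser.\<close>

lemma feasible_minimiser:
  fixes w :: "'a \<Rightarrow> 'b \<Rightarrow> real"
  assumes "finite A" "finite B" and w: "feasible_on A B G w w" and "a \<in> A" "b \<in> B"
  obtains u where "feasible_on A B G w u"
    "\<And>v. feasible_on A B G w v \<Longrightarrow> u a b \<le> v a b"
proof -
  define C where "C = (\<Sum>r\<in>A. \<Sum>c\<in>B. w r c)"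
  define E where "E = A \<times> B \<inter> G"
  define K where "K = {f :: 'a \<times> 'b \<Rightarrow> real. (\<forall>p\<in>E. 0 \<le> f p \<and> f p \<le> C) \<and> (\<forall>p. p \<notin> E \<longrightarrow> f p = 0)}"
  define F where "F = {f. \<forall>r\<in>A. (\<Sum>c\<in>B. f (r, c)) = (\<Sum>c\<in>B. w r c)} \<inter>
     {f. \<forall>c\<in>B. (\<Sum>r\<in>A. f (r, c)) = (\<Sum>r\<in>A. w r c)}"
  have finE: "finite E" using assms unfolding E_def by auto
  have bound: "v r c \<le> C" if v: "feasible_on A B G w v" and "r \<in> A" "c \<in> B" for v r c
  proof -
    have "v r c \<le> (\<Sum>c\<in>B. v r c)"
      using v that assms by (intro member_le_sum) (auto simp: feasible_on_def)
    also have "\<dots> = (\<Sum>c\<in>B. w r c)" using v that by (auto simp: feasible_on_def)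
    also have "\<dots> \<le> C" unfolding C_def
      using w that assms by (intro member_le_sum) (auto simp: feasible_on_def intro: sum_nonneg)
    finally show ?thesis .
  qed
  have inK: "(\<lambda>p. if p \<in> E then v (fst p) (snd p) else 0) \<in> K \<inter> F"
    (is "?f \<in> _") if v: "feasible_on A B G w v" for v
  proof
    show "?f \<in> K"
      unfolding K_def E_def using v bound[OF v] by (auto simp: feasible_on_def)
    have f: "?f (r, c) = v r c" if "r \<in> A" "c \<in> B" for r c
      using v that by (auto simp: E_def feasible_on_def)
    show "?f \<in> F"
      unfolding F_def using v f by (auto simp: feasible_on_def cong: sum.cong)
  qed
  have clF: "closed F"
    unfolding F_def Ball_def
    by (intro closed_Int closed_Collect_all closed_Collect_imp open_Collect_const closed_Collect_eq
        continuous_on_sum continuous_on_product_coordinates continuous_on_const)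
  have "compact (K \<inter> F)"
    using compact_box_functions[OF finE] clF unfolding K_def by (intro compact_Int_closed)
  moreover have "K \<inter> F \<noteq> {}" using inK[OF w] by blast
  moreover have "continuous_on (K \<inter> F) (\<lambda>f. f (a, b))"
    by (rule continuous_on_subset[OF continuous_on_product_coordinates]) auto
  ultimately obtain f where f: "f \<in> K \<inter> F" and fmin: "\<And>g. g \<in> K \<inter> F \<Longrightarrow> f (a, b) \<le> g (a, b)"
    using continuous_attains_inf by metis
  show thesis
  proof
    show "feasible_on A B G w (\<lambda>r c. f (r, c))"
      using f unfolding feasible_on_def K_def F_def E_def by fastforce
    show "f (a, b) \<le> v a b" if v: "feasible_on A B G w v" for v
    proof -
      have "f (a, b) \<le> (if (a, b) \<in> E then v a b else 0)"
        using fmin[OF inK[OF v]] by (simp split: if_splits)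
      also have "\<dots> \<le> v a b"
        using v assms by (auto simp: feasible_on_def)
      finally show ?thesis .
    qed
  qed
qed

text \<open>
  A state \<open>v\<close> as below carries a surplus \<open>\<epsilon>\<close> that has been removed from the pair \<open>(a, b)\<close> and is
  now missing in row \<open>r\<close>, respectively superfluous in column \<open>c\<close>. Convex combinations with the
  optimal state \<open>u\<close> make room for the next step of an alternating walk, so walks need not be simple.
\<close>

lemma min_cut:
  fixes w :: "'a \<Rightarrow> 'b \<Rightarrow> real"
  assumes fin: "finite A" "finite B" and w: "feasible_on A B G w w" and ab: "a \<in> A" "b \<in> B"
    and pos: "\<And>v. feasible_on A B G w v \<Longrightarrow> v a b \<noteq> 0"
  obtains S T where "S \<subseteq> A" "T \<subseteq> B" "a \<in> S" "b \<notin> T"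
    "\<And>r c. r \<in> S \<Longrightarrow> c \<in> B \<Longrightarrow> (r, c) \<in> G \<Longrightarrow> (r, c) \<noteq> (a, b) \<Longrightarrow> c \<in> T"
    "(\<Sum>c\<in>T. \<Sum>r\<in>A - S. w r c) < w a b"
proof -
  obtain u where u: "feasible_on A B G w u" and umin: "\<And>v. feasible_on A B G w v \<Longrightarrow> u a b \<le> v a b"
    using feasible_minimiser[OF fin w ab] by metis
  have uab: "u a b > 0"
    using u pos[OF u] ab by (force simp: feasible_on_def)
  \<comment> \<open>The strict inequality at \<open>(a, b)\<close> is the point: an admissible state
    with the original margins would undercut the minimiser \<open>u\<close>. This is what keeps
    \<open>b\<close> out of \<open>T\<close>.\<close>
  define adm where "adm v \<longleftrightarrow> (\<forall>r\<in>A. \<forall>c\<in>B. 0 \<le> v r c \<and> (v r c \<noteq> 0 \<longrightarrow> (r, c) \<in> G)) \<and> v a b < u a b" for v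
  define dr where "dr r0 \<longleftrightarrow> (\<exists>v e. adm v \<and> 0 < e \<and>
      (\<forall>r\<in>A. (\<Sum>c\<in>B. v r c) = (\<Sum>c\<in>B. u r c) - (if r = r0 then e else 0)) \<and>
      (\<forall>c\<in>B. (\<Sum>r\<in>A. v r c) = (\<Sum>r\<in>A. u r c) - (if c = b then e else 0)))" for r0
  define dc where "dc c0 \<longleftrightarrow> (\<exists>v e. adm v \<and> 0 < e \<and>
      (\<forall>r\<in>A. (\<Sum>c\<in>B. v r c) = (\<Sum>c\<in>B. u r c)) \<and>
      (\<forall>c\<in>B. (\<Sum>r\<in>A. v r c) = (\<Sum>r\<in>A. u r c) - (if c = b then e else 0) + (if c = c0 then e else 0)))" for c0
  define upd :: "('a \<Rightarrow> 'b \<Rightarrow> real) \<Rightarrow> 'a \<Rightarrow> 'b \<Rightarrow> real \<Rightarrow> 'a \<Rightarrow> 'b \<Rightarrow> real"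
    where "upd v r0 c0 x = (\<lambda>r c. v r c + (if r = r0 \<and> c = c0 then x else 0))" for v r0 c0 x
  have updr: "(\<Sum>c\<in>B. upd v r0 c0 x r c) = (\<Sum>c\<in>B. v r c) + (if r = r0 then x else 0)" if "c0 \<in> B" for v r0 c0 x r
    using that fin by (cases "r = r0") (auto simp: upd_def sum.distrib)
  have updc: "(\<Sum>r\<in>A. upd v r0 c0 x r c) = (\<Sum>r\<in>A. v r c) + (if c = c0 then x else 0)" if "r0 \<in> A" for v r0 c0 x c
    using that fin by (cases "c = c0") (auto simp: upd_def sum.distrib)
  have unn: "0 \<le> u r c" "u r c \<noteq> 0 \<Longrightarrow> (r, c) \<in> G" if "r \<in> A" "c \<in> B" for r c
    using u that by (auto simp: feasible_on_def)
  \<comment> \<open>Deleting the whole entry \<open>u a b\<close> leaves row \<open>a\<close> and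
    column \<open>b\<close> short by the same amount \<open>e = u a b\<close>.\<close>
  have start: "dr a"
    unfolding dr_def
  proof (intro exI conjI)
    show "adm (upd u a b (- u a b))" "0 < u a b"
      unfolding adm_def using unn ab uab by (auto simp: upd_def)
  qed (auto simp: updr updc ab)
  have step1: "dc c0" if "dr r0" "r0 \<in> A" "c0 \<in> B" "(r0, c0) \<in> G" "(r0, c0) \<noteq> (a, b)" for r0 c0
  proof -
    obtain v e where v: "adm v" "0 < e"
      "\<And>r. r \<in> A \<Longrightarrow> (\<Sum>c\<in>B. v r c) = (\<Sum>c\<in>B. u r c) - (if r = r0 then e else 0)"
      "\<And>c. c \<in> B \<Longrightarrow> (\<Sum>r\<in>A. v r c) = (\<Sum>r\<in>A. u r c) - (if c = b then e else 0)"
      using \<open>dr r0\<close> unfolding dr_def by blast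
    show ?thesis unfolding dc_def
    proof (intro exI conjI)
      show "adm (upd v r0 c0 e)" "0 < e"
        using v that ab by (auto simp: adm_def upd_def)
    qed (use v that in \<open>auto simp: updr updc\<close>)
  qed
  have step2: "dr r0" if "dc c0" "r0 \<in> A" "c0 \<in> B" "u r0 c0 \<noteq> 0" for r0 c0
  proof -
    obtain v e where v: "adm v" "0 < e"
      "\<And>r. r \<in> A \<Longrightarrow> (\<Sum>c\<in>B. v r c) = (\<Sum>c\<in>B. u r c)"
      "\<And>c. c \<in> B \<Longrightarrow> (\<Sum>r\<in>A. v r c) = (\<Sum>r\<in>A. u r c) - (if c = b then e else 0) + (if c = c0 then e else 0)"
      using \<open>dc c0\<close> unfolding dc_def by blast
    have u0: "u r0 c0 > 0" using unn(1)[of r0 c0] that by linarith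
    \<comment> \<open>The weight is chosen so that at \<open>(r0, c0)\<close> the share of
      \<open>u\<close> alone equals \<open>s * e\<close>, which is the amount taken away there
      next.\<close>
    define s where "s = u r0 c0 / (u r0 c0 + e)"
    have s: "0 < s" "s < 1" "s * e = (1 - s) * u r0 c0"
      using u0 \<open>0 < e\<close> by (auto simp: s_def field_simps)
    define v' where "v' = (\<lambda>r c. (1 - s) * u r c + s * v r c)"
    have v'r: "(\<Sum>c\<in>B. v' r c) = (1 - s) * (\<Sum>c\<in>B. u r c) + s * (\<Sum>c\<in>B. v r c)" for r
      by (simp add: v'_def sum.distrib sum_distrib_left)
    have v'c: "(\<Sum>r\<in>A. v' r c) = (1 - s) * (\<Sum>r\<in>A. u r c) + s * (\<Sum>r\<in>A. v r c)" for c
      by (simp add: v'_def sum.distrib sum_distrib_left)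
    have vnn: "0 \<le> v r c" "v r c \<noteq> 0 \<Longrightarrow> (r, c) \<in> G" if "r \<in> A" "c \<in> B" for r c
      using \<open>adm v\<close> that by (auto simp: adm_def)
    have v'nn: "0 \<le> v' r c" "v' r c \<noteq> 0 \<Longrightarrow> (r, c) \<in> G" if "r \<in> A" "c \<in> B" for r c
      using s vnn[OF that] unn[OF that] by (cases "u r c = 0"; cases "v r c = 0"; auto simp: v'_def)+
    have v'0: "v' r0 c0 \<ge> s * e"
      using s vnn(1)[of r0 c0] that by (simp add: v'_def)
    have "v' a b < u a b"
      using \<open>adm v\<close> s by (simp add: v'_def adm_def algebra_simps)
    moreover have "0 \<le> upd v' r0 c0 (- (s * e)) r c" if "r \<in> A" "c \<in> B" for r c
      using v'nn[OF that] v'0 by (auto simp: upd_def)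
    moreover have "(r, c) \<in> G" if "r \<in> A" "c \<in> B" "upd v' r0 c0 (- (s * e)) r c \<noteq> 0" for r c
      using v'nn[OF that(1,2)] that(3) unn(2)[OF \<open>r0 \<in> A\<close> \<open>c0 \<in> B\<close> \<open>u r0 c0 \<noteq> 0\<close>]
      by (auto simp: upd_def split: if_splits)
    moreover have "upd v' r0 c0 (- (s * e)) a b \<le> v' a b"
      using mult_pos_pos[OF s(1) \<open>0 < e\<close>] by (auto simp: upd_def)
    ultimately have adm': "adm (upd v' r0 c0 (- (s * e)))"
      unfolding adm_def by fastforce
    show ?thesis unfolding dr_def
    proof (intro exI conjI)
      show "adm (upd v' r0 c0 (- (s * e)))" "0 < s * e"
        using adm' mult_pos_pos[OF s(1) \<open>0 < e\<close>] by auto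
      show "\<forall>r\<in>A. (\<Sum>c\<in>B. upd v' r0 c0 (- (s * e)) r c) = (\<Sum>c\<in>B. u r c) - (if r = r0 then s * e else 0)"
        using v(3) \<open>c0 \<in> B\<close> by (simp add: updr v'r) (simp add: algebra_simps)
      show "\<forall>c\<in>B. (\<Sum>r\<in>A. upd v' r0 c0 (- (s * e)) r c) = (\<Sum>r\<in>A. u r c) - (if c = b then s * e else 0)"
        using v(4) \<open>r0 \<in> A\<close> by (simp add: updc v'c) (simp add: algebra_simps)
    qed
  qed
  define S where "S = {r \<in> A. dr r}"
  define T where "T = {c \<in> B. dc c}"
  have bT: "b \<notin> T"
  proof
    assume "b \<in> T"
    then obtain v e where v: "adm v"
      "\<And>r. r \<in> A \<Longrightarrow> (\<Sum>c\<in>B. v r c) = (\<Sum>c\<in>B. u r c)"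
      "\<And>c. c \<in> B \<Longrightarrow> (\<Sum>r\<in>A. v r c) = (\<Sum>r\<in>A. u r c)"
      by (force simp: T_def dc_def)
    then have "feasible_on A B G w v"
      using u by (auto simp: feasible_on_def adm_def)
    then show False using umin v(1) by (force simp: adm_def)
  qed
  have closed: "c \<in> T" if "r \<in> S" "c \<in> B" "(r, c) \<in> G" "(r, c) \<noteq> (a, b)" for r c
    using step1 that by (auto simp: S_def T_def)
  \<comment> \<open>Reachability runs backwards along positive entries of \<open>u\<close>, so
    \<open>u\<close> has no mass in the columns \<open>T\<close> outside the rows \<open>S\<close>.
    Comparing margins, \<open>w\<close> has mass \<open>w a b - u a b\<close> in that block.\<close>
  have uz: "u r c = 0" if "c \<in> T" "r \<in> A - S" for r c
    using step2[of c r] that by (auto simp: S_def T_def)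
  have SA: "S \<subseteq> A" and TB: "T \<subseteq> B" by (auto simp: S_def T_def)
  have finST: "finite S" "finite T" using SA TB fin finite_subset by auto
  have aS: "a \<in> S" using start ab by (simp add: S_def)
  \<comment> \<open>In any state supported on \<open>G\<close>, the entry \<open>(a, b)\<close> is
    the only way for mass of the rows \<open>S\<close> to leave the columns
    \<open>T\<close>.\<close>
  have rows: "(\<Sum>r\<in>S. \<Sum>c\<in>B. v r c) = (\<Sum>r\<in>S. \<Sum>c\<in>T. v r c) + v a b"
    if v: "\<And>r c. r \<in> A \<Longrightarrow> c \<in> B \<Longrightarrow> v r c \<noteq> 0 \<Longrightarrow> (r, c) \<in> G" for v :: "'a \<Rightarrow> 'b \<Rightarrow> real"
  proof -
    have "(\<Sum>c\<in>B. v r c) = (\<Sum>c\<in>T. v r c) + (if r = a then v a b else 0)" if "r \<in> S" for r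
    proof -
      have "(\<Sum>c\<in>B. v r c) = (\<Sum>c\<in>T. v r c) + (\<Sum>c\<in>B - T. v r c)"
        using TB fin by (metis add.commute sum.subset_diff)
      also have "(\<Sum>c\<in>B - T. v r c) = (\<Sum>c\<in>B - T. if c = b then (if r = a then v a b else 0) else 0)"
        using v closed[OF that] SA that by (intro sum.cong) fastforce+
      also have "\<dots> = (if r = a then v a b else 0)"
        using fin ab bT by auto
      finally show ?thesis .
    qed
    then show ?thesis
      using aS finST by (simp add: sum.distrib)
  qed
  have cols: "(\<Sum>c\<in>T. \<Sum>r\<in>A. v r c) = (\<Sum>r\<in>S. \<Sum>c\<in>T. v r c) + (\<Sum>c\<in>T. \<Sum>r\<in>A - S. v r c)" for v :: "'a \<Rightarrow> 'b \<Rightarrow> real"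
  proof -
    have "(\<Sum>c\<in>T. \<Sum>r\<in>A. v r c) = (\<Sum>c\<in>T. (\<Sum>r\<in>S. v r c) + (\<Sum>r\<in>A - S. v r c))"
      using SA fin by (intro sum.cong) (auto simp: sum.subset_diff)
    also have "\<dots> = (\<Sum>c\<in>T. \<Sum>r\<in>S. v r c) + (\<Sum>c\<in>T. \<Sum>r\<in>A - S. v r c)"
      by (simp add: sum.distrib)
    also have "(\<Sum>c\<in>T. \<Sum>r\<in>S. v r c) = (\<Sum>r\<in>S. \<Sum>c\<in>T. v r c)"
      by (rule sum.swap)
    finally show ?thesis .
  qed
  have "(\<Sum>r\<in>S. \<Sum>c\<in>B. w r c) = (\<Sum>r\<in>S. \<Sum>c\<in>B. u r c)"
    by (rule sum.cong) (use u SA in \<open>auto simp: feasible_on_def\<close>)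
  then have "(\<Sum>r\<in>S. \<Sum>c\<in>T. w r c) + w a b = (\<Sum>r\<in>S. \<Sum>c\<in>T. u r c) + u a b"
    using rows[of w] rows[of u] u w by (simp add: feasible_on_def)
  moreover have "(\<Sum>c\<in>T. \<Sum>r\<in>A. w r c) = (\<Sum>c\<in>T. \<Sum>r\<in>A. u r c)"
    by (rule sum.cong) (use u TB in \<open>auto simp: feasible_on_def\<close>)
  moreover have "(\<Sum>c\<in>T. \<Sum>r\<in>A - S. u r c) = 0"
    using uz by (intro sum.neutral) auto
  ultimately have "(\<Sum>c\<in>T. \<Sum>r\<in>A - S. w r c) = w a b - u a b"
    using cols[of w] cols[of u] by simp
  then show thesis
    using that[of S T] SA TB aS bT closed uab by auto
qed

section \<open>The outer boundary of a cluster of points\<close>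

text \<open>\<open>H\<close> is the cluster thickened by \<open>h\<close> with its holes filled, and
  \<open>Fr\<close> is the frontier of the unbounded complementary component. The thickened cluster
  is connected because steps have length at most \<open>2 * h\<close>, and a complementary component
  of a connected set has connected frontier. A point of \<open>Q\<close> outside \<open>C\<close> is
  more than \<open>2 * h\<close> away from \<open>C\<close>, while \<open>Fr\<close> stays within
  \<open>h\<close> of \<open>C\<close>.\<close>

lemma outer_boundary:
  fixes C Q :: "'a::euclidean_space set"
  assumes dim: "2 \<le> DIM('a)" and h: "0 < h"
    and C: "finite C" "b \<in> C" "C \<subseteq> cball b \<rho>"
    and chain: "\<And>c. c \<in> C \<Longrightarrow> (\<lambda>x y. x \<in> C \<and> y \<in> C \<and> dist x y \<le> 2 * h)\<^sup>*\<^sup>* b c"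
    and isolated: "\<And>q c. q \<in> Q \<Longrightarrow> c \<in> C \<Longrightarrow> dist q c \<le> 2 * h \<Longrightarrow> q \<in> C"
  obtains H Fr where "connected Fr" "\<And>c. c \<in> C \<Longrightarrow> cball c h \<subseteq> H" "H \<subseteq> cball b (\<rho> + h)"
    "\<And>x y. x \<in> H \<Longrightarrow> y \<notin> H \<Longrightarrow> \<exists>z\<in>Fr. dist x z + dist z y = dist x y"
    "Fr \<subseteq> H"
    "\<And>z c. z \<in> Fr \<Longrightarrow> c \<in> C \<union> Q \<Longrightarrow> h \<le> dist z c"
proof -
  define K where "K = (\<Union>c\<in>C. cball c h)"
  have "closed K" unfolding K_def using C by (intro closed_UN) auto
  have sub: "K \<subseteq> cball b (\<rho> + h)"
  proof
    fix x assume "x \<in> K"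
    then obtain c where "c \<in> C" "dist c x \<le> h" by (auto simp: K_def)
    moreover have "dist b c \<le> \<rho>" using C \<open>c \<in> C\<close> by auto
    ultimately show "x \<in> cball b (\<rho> + h)" using dist_triangle[of b x c] by simp
  qed
  have conn: "\<exists>T. connected T \<and> T \<subseteq> K \<and> b \<in> T \<and> cball c h \<subseteq> T" if "c \<in> C" for c
    using chain[OF that]
  proof (induction rule: rtranclp_induct)
    case base
    show ?case using C h by (intro exI[of _ "cball b h"]) (auto simp: K_def)
  next
    case (step y z)
    then obtain T where T: "connected T" "T \<subseteq> K" "b \<in> T" "cball y h \<subseteq> T" by blast
    have mid: "midpoint y z \<in> cball y h \<inter> cball z h"
      using step by (simp add: dist_midpoint)
    have "connected (T \<union> cball z h)"
      using T(1) T(4) mid by (intro connected_Un connected_cball) blast+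
    then show ?case using T step by (intro exI[of _ "T \<union> cball z h"]) (auto simp: K_def)
  qed
  have "connected K"
  proof -
    obtain T where T: "\<And>c. c \<in> C \<Longrightarrow> connected (T c) \<and> T c \<subseteq> K \<and> b \<in> T c \<and> cball c h \<subseteq> T c"
      using conn by metis
    have "K = \<Union> (T ` C)" using T by (auto simp: K_def)
    moreover have "connected (\<Union> (T ` C))"
      using T \<open>b \<in> C\<close> by (intro connected_Union) blast+
    ultimately show ?thesis by simp
  qed
  obtain y0 where y0: "y0 \<notin> cball b (\<rho> + h)"
    using bounded_cball not_bounded_UNIV by (metis UNIV_eq_I)
  define O1 where "O1 = connected_component_set (- K) y0"
  have y0K: "y0 \<in> - K" using y0 sub by blast
  have comp: "O1 \<in> components (- K)"
    using y0K unfolding O1_def by (simp add: components_def)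
  \<comment> \<open>In dimension at least two the complement of a ball is connected, so
    \<open>O1\<close> contains all of it and \<open>H\<close> is bounded.\<close>
  have out: "- cball b (\<rho> + h) \<subseteq> O1"
    unfolding O1_def using y0 sub dim
    by (intro connected_component_maximal connected_complement_bounded_convex) auto
  have O1K: "O1 \<inter> K = {}" using in_components_subset[OF comp] by blast
  have FrK: "frontier O1 \<subseteq> K"
    using frontier_of_components_closed_complement[OF \<open>closed K\<close> comp] .
  show thesis
  proof
    show "connected (frontier O1)"
      by (rule connected_frontier_component_complement[OF \<open>connected K\<close> comp])
    show "cball c h \<subseteq> - O1" if "c \<in> C" for c
      using O1K that by (auto simp: K_def)
    show "- O1 \<subseteq> cball b (\<rho> + h)" using out by auto
    show "frontier O1 \<subseteq> - O1" using FrK O1K by blast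
    show "\<exists>z\<in>frontier O1. dist x z + dist z y = dist x y" if "x \<in> - O1" "y \<notin> - O1" for x y
    proof -
      have "closed_segment x y \<inter> frontier O1 \<noteq> {}"
        using that by (intro connected_Int_frontier) auto
      then obtain z where "z \<in> frontier O1" "z \<in> closed_segment x y" by blast
      then show ?thesis by (metis between between_mem_segment)
    qed
    show "h \<le> dist z c" if z: "z \<in> frontier O1" and c: "c \<in> C \<union> Q" for z c
    proof (cases "c \<in> C")
      case True
      show ?thesis
      proof (rule ccontr)
        assume "\<not> h \<le> dist z c"
        then have "z \<in> ball c h" by (simp add: dist_commute)
        moreover have "z \<in> closure O1" using z by (simp add: frontier_def)
        ultimately have "ball c h \<inter> O1 \<noteq> {}"
          by (metis open_ball open_Int_closure_eq_empty disjoint_iff)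
        then show False using O1K True by (force simp: K_def)
      qed
    next
      case False
      then have "c \<in> Q" using c by simp
      obtain c' where c': "c' \<in> C" "dist c' z \<le> h" using z FrK by (auto simp: K_def)
      then have "dist c c' > 2 * h" using isolated[OF \<open>c \<in> Q\<close>] False by force
      then show ?thesis using c' dist_triangle[of c c' z] by (simp add: dist_commute)
    qed
  qed
qed

text \<open>
  \<open>w\<close> is a doubly stochastic matrix with rows \<open>X\<close> and columns \<open>Y\<close>, supported on the admissible entries
  \<open>G\<close>. Outside the dirty columns \<open>Q\<close> all entries of range \<open>3t\<close> are admissible while \<open>w\<close> only uses
  those of range \<open>R0 < t\<close>; this slack makes a minimal cut that touches the outer boundary of the
  cluster \<open>C\<close> of dirty columns contain everything near that boundary, by connectedness. Hence the cut
  lies inside or its complement does, and in both cases it violates Hall's condition.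
\<close>

locale island =
  fixes X Y :: "'a::euclidean_space set" and w :: "'a \<Rightarrow> 'a \<Rightarrow> real" and G :: "('a \<times> 'a) set"
    and Q C :: "'a set" and a b :: 'a and t R0 \<kappa> \<rho> :: real
  assumes dim: "2 \<le> DIM('a)"
    and lfX: "\<And>r x. finite (X \<inter> cball x r)" and lfY: "\<And>r x. finite (Y \<inter> cball x r)"
    and \<kappa>: "0 < \<kappa>" and R0: "0 \<le> R0" and t: "t = R0 + \<kappa>"
    and dense: "\<And>z. \<exists>c\<in>Y. dist c z \<le> \<kappa>"
    and nonneg: "\<And>r c. 0 \<le> w r c"
    and supp: "\<And>r c. r \<in> X \<Longrightarrow> c \<in> Y \<Longrightarrow> w r c \<noteq> 0 \<Longrightarrow> (r, c) \<in> G"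
    and range: "\<And>r c. (r, c) \<in> G \<Longrightarrow> dist r c \<le> 3 * t"
    and row: "\<And>r T. r \<in> X \<Longrightarrow> finite T \<Longrightarrow> T \<subseteq> Y \<Longrightarrow> (\<And>c. c \<in> Y \<Longrightarrow> w r c \<noteq> 0 \<Longrightarrow> c \<in> T) \<Longrightarrow> (\<Sum>c\<in>T. w r c) = 1"
    and col: "\<And>c T. c \<in> Y \<Longrightarrow> finite T \<Longrightarrow> T \<subseteq> X \<Longrightarrow> (\<And>r. r \<in> X \<Longrightarrow> w r c \<noteq> 0 \<Longrightarrow> r \<in> T) \<Longrightarrow> (\<Sum>r\<in>T. w r c) = 1"
    and clean_G: "\<And>r c. r \<in> X \<Longrightarrow> c \<in> Y - Q \<Longrightarrow> dist r c \<le> 3 * t \<Longrightarrow> (r, c) \<in> G"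
    and clean_w: "\<And>r c. r \<in> X \<Longrightarrow> c \<in> Y - Q \<Longrightarrow> w r c \<noteq> 0 \<Longrightarrow> dist r c \<le> R0"
    and a: "a \<in> X" and b: "b \<in> Y" and ab: "dist a b \<le> 3 * t"
    and C: "finite C" "b \<in> C" "C \<subseteq> cball b \<rho>"
    and chain: "\<And>c. c \<in> C \<Longrightarrow> (\<lambda>x y. x \<in> C \<and> y \<in> C \<and> dist x y \<le> 12 * t)\<^sup>*\<^sup>* b c"
    and isolated: "\<And>q c. q \<in> Q \<Longrightarrow> c \<in> C \<Longrightarrow> dist q c \<le> 12 * t \<Longrightarrow> q \<in> C"
begin

definition nbr_cols :: "'a set \<Rightarrow> 'a set" where
  "nbr_cols S = {c \<in> Y. \<exists>r\<in>S. (r, c) \<in> G \<and> (r, c) \<noteq> (a, b)}"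

definition nbr_rows :: "'a set \<Rightarrow> 'a set" where
  "nbr_rows T = {r \<in> X. \<exists>c\<in>T. (r, c) \<in> G \<and> (r, c) \<noteq> (a, b)}"

theorem removable_or_violator:
  obtains (removable) A B w' where "finite A" "finite B" "A \<subseteq> X \<inter> cball b (\<rho> + 8 * t)" "B \<subseteq> Y \<inter> cball b (\<rho> + 8 * t)"
      "a \<in> A" "b \<in> B" "feasible_on A B G w w'" "w' a b = 0"
  | (rows) S where "finite S" "S \<subseteq> X" "card (nbr_cols S) < card S"
  | (cols) T where "finite T" "T \<subseteq> Y" "card (nbr_rows T) < card T"
proof -
  have t0: "t > 0" "\<kappa> \<le> t" "R0 < t" using \<kappa> R0 t by auto
  obtain H Fr where conn: "connected Fr" and CH: "\<And>c. c \<in> C \<Longrightarrow> cball c (6*t) \<subseteq> H"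
    and Hb: "H \<subseteq> cball b (\<rho> + 6*t)"
    and cross: "\<And>x y. x \<in> H \<Longrightarrow> y \<notin> H \<Longrightarrow> \<exists>z\<in>Fr. dist x z + dist z y = dist x y"
    and FrH: "Fr \<subseteq> H"
    and far: "\<And>z c. z \<in> Fr \<Longrightarrow> c \<in> C \<union> Q \<Longrightarrow> 6*t \<le> dist z c"
  proof -
    \<comment> \<open>The radius \<open>6 * t\<close> leaves a reserve: every column whose cleanness
      is used below lies within \<open>4 * t\<close> of \<open>Fr\<close>.\<close>
    have h: "0 < 6 * t" "2 * (6 * t) = 12 * t" using t0 by auto
    show thesis
      by (rule outer_boundary[OF dim h(1) C(1) C(2) C(3), of Q, unfolded h(2)]) (fact chain, fact isolated, rule that)
  qed
  \<comment> \<open>The rims have different widths for a reason. A clean column within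
    \<open>\<kappa>\<close> of \<open>Fr\<close> takes its mass from rows within
    \<open>R0 + \<kappa> = t\<close>; a row within \<open>t\<close> of \<open>Fr\<close> spreads its
    mass over columns within \<open>t + R0 \<le> 2 * t\<close>.\<close>
  define A where "A = {r \<in> X. r \<in> H \<or> (\<exists>z\<in>Fr. dist r z \<le> t)}"
  define B where "B = {c \<in> Y. c \<in> H \<or> (\<exists>z\<in>Fr. dist c z \<le> 2*t)}"
  have near_ball: "x \<in> cball b (\<rho> + 8 * t)" if "x \<in> H \<or> (\<exists>z\<in>Fr. dist x z \<le> 2*t)" for x
    using that
  proof
    assume "x \<in> H" then show ?thesis using Hb t0 by force
  next
    assume "\<exists>z\<in>Fr. dist x z \<le> 2*t"
    then obtain z where z: "z \<in> Fr" "dist x z \<le> 2*t" by blast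
    then have "dist b z \<le> \<rho> + 6*t" using FrH Hb by auto
    then show ?thesis using z dist_triangle[of b x z] by (simp add: dist_commute)
  qed
  have Asub: "A \<subseteq> X \<inter> cball b (\<rho> + 8 * t)" and Bsub: "B \<subseteq> Y \<inter> cball b (\<rho> + 8 * t)"
  proof -
    have "x \<in> cball b (\<rho> + 8 * t)" if "x \<in> A" for x
      using that t0 by (intro near_ball) (force simp: A_def)
    moreover have "A \<subseteq> X" by (auto simp: A_def)
    ultimately show "A \<subseteq> X \<inter> cball b (\<rho> + 8 * t)" by blast
    show "B \<subseteq> Y \<inter> cball b (\<rho> + 8 * t)" using near_ball unfolding B_def by blast
  qed
  have finA: "finite A" and finB: "finite B"
    using Asub Bsub lfX lfY finite_subset by metis+
  have bB: "b \<in> B"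
    using CH[OF C(2)] t0 b by (auto simp: B_def)
  have aH: "a \<in> H"
    using CH[OF C(2)] t0 ab by (auto simp: dist_commute)
  have aA: "a \<in> A" using aH a by (auto simp: A_def)
  have bfar: "6*t \<le> dist b z" if "z \<in> Fr" for z using far[OF that, of b] C by (simp add: dist_commute)
  have Qfar: "6*t \<le> dist q z" if "z \<in> Fr" "q \<in> Q" for z q using far[OF that(1), of q] that by (simp add: dist_commute)
  have wfeas: "feasible_on A B G w w"
    unfolding feasible_on_def using nonneg supp by (auto simp: A_def B_def)
  show thesis
  proof (cases "\<exists>w'. feasible_on A B G w w' \<and> w' a b = 0")
    case True
    then show ?thesis using removable finA finB Asub Bsub aA bB by blast
  next
    case False
    then obtain S T where ST: "S \<subseteq> A" "T \<subseteq> B" "a \<in> S" "b \<notin> T"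
      and cl: "\<And>r c. r \<in> S \<Longrightarrow> c \<in> B \<Longrightarrow> (r, c) \<in> G \<Longrightarrow> (r, c) \<noteq> (a, b) \<Longrightarrow> c \<in> T"
      and def: "(\<Sum>c\<in>T. \<Sum>r\<in>A - S. w r c) < w a b"
      using min_cut[OF finA finB wfeas aA bB] by metis
    have finST: "finite S" "finite T" using ST finA finB finite_subset by auto
    have "w a b \<le> (\<Sum>c\<in>Y \<inter> cball a (3*t). w a c)"
      using b ab lfY nonneg by (intro member_le_sum) auto
    also have "\<dots> = 1"
      using a lfY range supp by (intro row) auto
    finally have wab: "w a b \<le> 1" .
    have defrc: "(\<Sum>r\<in>R. \<Sum>c\<in>T'. w r c) \<le> (\<Sum>c\<in>T. \<Sum>r\<in>A - S. w r c)" if "R \<subseteq> A - S" "T' \<subseteq> T" for R T'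
    proof -
      have "(\<Sum>r\<in>R. \<Sum>c\<in>T'. w r c) \<le> (\<Sum>r\<in>A - S. \<Sum>c\<in>T. w r c)"
        using that finA finST nonneg
        by (intro order_trans[OF sum_mono[of R "\<lambda>r. \<Sum>c\<in>T'. w r c" "\<lambda>r. \<Sum>c\<in>T. w r c"]] sum_mono2)
          (auto intro: sum_nonneg)
      then show ?thesis by (subst sum.swap)
    qed
    \<comment> \<open>All mass of column \<open>c\<close> comes from rows within \<open>t\<close> of
      \<open>z\<close>. If none of them were in \<open>S\<close>, this column alone would put mass
      one into the block \<open>T\<close>, \<open>A - S\<close>, whose mass is less than
      \<open>w a b \<le> 1\<close>.\<close>
    have zone: "\<exists>r\<in>S. dist r z \<le> t" if c: "c \<in> T" "dist c z \<le> \<kappa>" and z: "z \<in> Fr" for c z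
    proof (rule ccontr)
      assume no: "\<not> (\<exists>r\<in>S. dist r z \<le> t)"
      have cY: "c \<in> Y" using c ST by (auto simp: B_def)
      have cQ: "c \<notin> Q" using Qfar[OF z, of c] c t0 by force
      have sub: "r \<in> A - S" if "r \<in> X" "w r c \<noteq> 0" for r
      proof -
        have "dist r c \<le> R0" using clean_w that cY cQ by blast
        then have "dist r z \<le> t" using c dist_triangle[of r z c] t by linarith
        then show ?thesis using no z that by (auto simp: A_def)
      qed
      have "(\<Sum>r\<in>A - S. w r c) = 1"
        using sub cY finA by (intro col) (auto simp: A_def)
      moreover have "(\<Sum>r\<in>A - S. w r c) \<le> (\<Sum>c\<in>T. \<Sum>r\<in>A - S. w r c)"
        using defrc[of "A - S" "{c}"] c by simp
      ultimately show False using def wab by linarith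
    qed
    \<comment> \<open>Closeness to a row of \<open>S\<close> spreads over steps of length
      \<open>\<kappa>\<close> along \<open>Fr\<close>: a column near the next point is at distance
      at most \<open>t + 2 * \<kappa> \<le> 3 * t\<close> from that row, so it is admissible and
      belongs to \<open>T\<close>, and \<open>zone\<close> leads back to a row of \<open>S\<close>.
      Thus \<open>N\<close> is open and closed in the connected set \<open>Fr\<close>.\<close>
    have "(\<forall>z\<in>Fr. \<exists>r\<in>S. dist r z \<le> t) \<or> (\<forall>z\<in>Fr. \<not> (\<exists>r\<in>S. dist r z \<le> t))"
    proof -
      define N where "N = {z\<in>Fr. \<exists>r\<in>S. dist r z \<le> t}"
      have spread: "\<exists>r\<in>S. dist r z' \<le> t" if z: "z \<in> N" "z' \<in> Fr" "dist z z' \<le> \<kappa>" for z z'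
      proof -
        obtain r where r: "r \<in> S" "dist r z \<le> t" using z by (auto simp: N_def)
        obtain c where c: "c \<in> Y" "dist c z' \<le> \<kappa>" using dense by blast
        have cQ: "c \<notin> Q" using Qfar[OF z(2), of c] c t0 by force
        have cb: "c \<noteq> b" using bfar[OF z(2)] c t0 by force
        have cB: "c \<in> B" using c z t0 by (force simp: B_def)
        have "dist r c \<le> 3*t"
          using r c z dist_triangle[of r c z] dist_triangle[of z c z'] t0 by (simp add: dist_commute)
        then have "(r, c) \<in> G" using clean_G c cQ r ST by (auto simp: A_def)
        then have "c \<in> T" using cl[OF r(1) cB] cb by blast
        then show ?thesis using zone c z by blast
      qed
      have N: "N \<subseteq> Fr" by (auto simp: N_def)
      have spN: "z' \<in> N" if "z \<in> N" "z' \<in> Fr" "dist z z' < \<kappa>" for z z'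
        using spread[of z z'] that by (simp add: N_def)
      have o1: "openin (top_of_set Fr) N"
        unfolding openin_euclidean_subtopology_iff
      proof (intro conjI ballI exI[of _ \<kappa>] impI)
        show "x' \<in> N" if "x \<in> N" "x' \<in> Fr" "dist x' x < \<kappa>" for x x'
          using spN[of x x'] that by (simp add: dist_commute)
      qed (use N \<kappa> in auto)
      have o2: "openin (top_of_set Fr) (Fr - N)"
        unfolding openin_euclidean_subtopology_iff
      proof (intro conjI ballI exI[of _ \<kappa>] impI)
        show "x' \<in> Fr - N" if "x \<in> Fr - N" "x' \<in> Fr" "dist x' x < \<kappa>" for x x'
          using spN[of x' x] that by auto
      qed (use \<kappa> in auto)
      have "N = {} \<or> Fr - N = {}"
        using conn o1 o2 unfolding connected_openin by blast
      then show ?thesis by (auto simp: N_def)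
    qed
    then show ?thesis
    proof
      assume none: "\<forall>z\<in>Fr. \<not> (\<exists>r\<in>S. dist r z \<le> t)"
      define S' where "S' = S \<inter> H"
      define T' where "T' = T \<inter> H"
      have fin': "finite S'" "finite T'" using finST by (auto simp: S'_def T'_def)
      have nb: "c \<in> T'" if r: "r \<in> S'" and c: "c \<in> Y" "(r, c) \<in> G" "(r, c) \<noteq> (a, b)" for r c
      proof -
        have "c \<in> H"
        proof (rule ccontr)
          assume "c \<notin> H"
          then obtain z where z: "z \<in> Fr" "dist r z + dist z c = dist r c"
            using cross r by (auto simp: S'_def)
          have rc: "dist r c \<le> 3*t" using range c by blast
          show False
          proof (cases "dist z c \<le> \<kappa>")
            case True
            then have "c \<in> B" using c z t0 by (force simp: B_def dist_commute)
            then have "c \<in> T" using cl r c by (auto simp: S'_def)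
            then show False using zone[of c z] True z none by (auto simp: dist_commute)
          next
            case False
            \<comment> \<open>The column \<open>c\<close> may be dirty or lie outside
              \<open>B\<close>. It is replaced by a clean column near the crossing point, which is
              no farther from \<open>r\<close> than \<open>c\<close> is.\<close>
            obtain c2 where c2: "c2 \<in> Y" "dist c2 z \<le> \<kappa>" using dense by blast
            have cQ: "c2 \<notin> Q" using Qfar[OF z(1), of c2] c2 t0 by force
            have cb: "c2 \<noteq> b" using bfar[OF z(1)] c2 t0 by force
            have cB: "c2 \<in> B" using c2 z t0 by (force simp: B_def)
            have "dist r c2 \<le> 3*t"
              using False rc z c2 dist_triangle[of r c2 z] by (simp add: dist_commute)
            then have "(r, c2) \<in> G" using clean_G c2 cQ r ST by (auto simp: A_def S'_def)
            then have "c2 \<in> T" using cl[OF _ cB] cb r by (auto simp: S'_def)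
            then show False using zone[of c2 z] c2 z none by auto
          qed
        qed
        moreover have "c \<in> B" using \<open>c \<in> H\<close> c by (auto simp: B_def)
        ultimately show ?thesis using cl r c by (auto simp: S'_def T'_def)
      qed
      have rowS: "(\<Sum>c\<in>T'. w r c) + (if r = a then w a b else 0) = 1" if r: "r \<in> S'" for r
      proof -
        have rX: "r \<in> X" using r ST by (auto simp: S'_def A_def)
        have "(\<Sum>c\<in>insert b T'. w r c) = 1"
          using rX fin' b ST nb[OF r] supp[OF rX]
          by (intro row) (auto simp: T'_def B_def)
        moreover have "b \<notin> T'" using ST by (auto simp: T'_def)
        moreover have "w r b = 0" if "r \<noteq> a"
          using nb[OF r b] supp[OF rX b] \<open>b \<notin> T'\<close> that by auto
        ultimately show ?thesis using fin' by (cases "r = a") auto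
      qed
      have colT: "(\<Sum>r\<in>S'. w r c) + (\<Sum>r\<in>A - S. w r c) = 1" if c: "c \<in> T'" for c
      proof -
        have cY: "c \<in> Y" using c ST by (auto simp: T'_def B_def)
        have cH: "c \<in> H" using c by (auto simp: T'_def)
        have *: "r \<in> S' \<union> (A - S)" if r: "r \<in> X" "w r c \<noteq> 0" for r
        proof (cases "r \<in> H")
          case True then show ?thesis using r by (auto simp: S'_def A_def)
        next
          case False
          then obtain z where z: "z \<in> Fr" "dist c z + dist z r = dist c r"
            using cross cH by blast
          have rc: "dist r c \<le> 3*t" using range supp r cY by blast
          have "c \<notin> Q"
          proof
            assume "c \<in> Q"
            then have "6*t \<le> dist c z" using Qfar z by blast
            then show False using rc z t0 zero_le_dist[of z r] by (simp add: dist_commute)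
          qed
          then have "dist r c \<le> R0" using clean_w r cY by blast
          then have "dist r z \<le> t"
            using z t0 zero_le_dist[of c z] dist_commute[of r c] dist_commute[of r z] by linarith
          then show ?thesis using r z none by (auto simp: A_def)
        qed
        have "(\<Sum>r\<in>S' \<union> (A - S). w r c) = 1"
          using * fin' finA ST cY by (intro col) (auto simp: S'_def A_def)
        then show ?thesis using fin' finA by (subst (asm) sum.union_disjoint) (auto simp: S'_def)
      qed
      \<comment> \<open>The rows \<open>S'\<close> have total mass \<open>S' \<times> T'\<close>
        plus \<open>w a b\<close>. The columns \<open>T'\<close> have the same block plus a part of
        the block in \<open>A - S\<close>, which is smaller than \<open>w a b\<close>.\<close>
      have "real (card S') = (\<Sum>r\<in>S'. (\<Sum>c\<in>T'. w r c) + (if r = a then w a b else 0))"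
        using rowS by simp
      also have "\<dots> = (\<Sum>r\<in>S'. \<Sum>c\<in>T'. w r c) + w a b"
        using fin' ST aH by (simp add: sum.distrib S'_def)
      finally have cS: "real (card S') = (\<Sum>r\<in>S'. \<Sum>c\<in>T'. w r c) + w a b" .
      have "real (card T') = (\<Sum>c\<in>T'. (\<Sum>r\<in>S'. w r c) + (\<Sum>r\<in>A - S. w r c))"
        using colT by simp
      also have "\<dots> = (\<Sum>r\<in>S'. \<Sum>c\<in>T'. w r c) + (\<Sum>r\<in>A - S. \<Sum>c\<in>T'. w r c)"
        by (simp add: sum.distrib sum.swap[of _ T'])
      also have "\<dots> < (\<Sum>r\<in>S'. \<Sum>c\<in>T'. w r c) + w a b"
        using defrc[of "A - S" T'] def by (auto simp: T'_def)
      finally have "card T' < card S'" using cS by linarith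
      moreover have "card (nbr_cols S') \<le> card T'"
        using nb fin' by (intro card_mono) (auto simp: nbr_cols_def)
      ultimately show ?thesis
        using rows[of S'] fin' ST by (force simp: S'_def A_def)
    next
      assume all: "\<forall>z\<in>Fr. \<exists>r\<in>S. dist r z \<le> t"
      \<comment> \<open>Now every column near \<open>Fr\<close> is in \<open>T\<close>, so it is the
        complement \<open>B - T\<close> that is enclosed by \<open>Fr\<close>; the violation is
        found on the column side.\<close>
      define T' where "T' = B - T"
      define R where "R = nbr_rows T'"
      have fin': "finite T'" using finB by (auto simp: T'_def)
      have inT: "c \<in> T" if c: "c \<in> Y" "dist c z \<le> 2*t" and z: "z \<in> Fr" for c z
      proof -
        obtain r where r: "r \<in> S" "dist r z \<le> t" using all z by blast
        have cQ: "c \<notin> Q" using Qfar[OF z, of c] c t0 by force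
        have cb: "c \<noteq> b" using bfar[OF z] c t0 by force
        have cB: "c \<in> B" using c z t0 by (force simp: B_def)
        have "dist r c \<le> 3*t" using r c dist_triangle[of r c z] by (simp add: dist_commute)
        then have "(r, c) \<in> G" using clean_G c cQ r ST by (auto simp: A_def)
        then show ?thesis using cl[OF r(1) cB] cb by blast
      qed
      have T'H: "c \<in> H" "c \<in> Y" "c \<in> B" "c \<notin> T" if "c \<in> T'" for c
        using that inT by (auto simp: T'_def B_def)
      have T'far: "2*t < dist c z" if "c \<in> T'" "z \<in> Fr" for c z
        using inT[of c z] T'H[OF that(1)] that by force
      have R_A: "r \<in> A - S" if r: "r \<in> R" for r
      proof -
        obtain c where c: "c \<in> T'" "(r, c) \<in> G" "(r, c) \<noteq> (a, b)" and rX: "r \<in> X"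
          using r by (auto simp: R_def nbr_rows_def)
        have "r \<in> A"
        proof (cases "r \<in> H")
          case False
          then obtain z where z: "z \<in> Fr" "dist c z + dist z r = dist c r"
            using cross T'H c by blast
          then have "dist r z \<le> t" using T'far[OF c(1) z(1)] range[OF c(2)] by (simp add: dist_commute)
          then show ?thesis using z rX by (auto simp: A_def)
        qed (use rX in \<open>auto simp: A_def\<close>)
        moreover have "r \<notin> S" using cl[of r c] c T'H by blast
        ultimately show ?thesis by blast
      qed
      \<comment> \<open>A row near \<open>Fr\<close> has all its mass on columns within
        \<open>2 * t\<close> of \<open>Fr\<close>, hence on \<open>T\<close>. As \<open>r\<close> is
        not in \<open>S\<close>, this would again put mass one into the block of mass less than
        \<open>w a b\<close>.\<close>
      have Rfar: "t < dist r z" if r: "r \<in> R" and z: "z \<in> Fr" for r z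
      proof (rule ccontr)
        assume "\<not> t < dist r z"
        then have rz: "dist r z \<le> t" by simp
        have rX: "r \<in> X" using R_A[OF r] by (auto simp: A_def)
        have "c \<in> T" if c: "c \<in> Y" "w r c \<noteq> 0" for c
        proof -
          have "dist r c \<le> 3*t" using c rX range supp by blast
          then have "c \<notin> Q" using Qfar[OF z, of c] rz t0 dist_triangle[of c z r] by (force simp: dist_commute)
          then have "dist r c \<le> R0" using clean_w rX c by blast
          then have "dist c z \<le> 2*t" using rz t0 dist_triangle[of c z r] by (simp add: dist_commute)
          then show ?thesis using inT c z by blast
        qed
        then have "(\<Sum>c\<in>T. w r c) = 1"
          using rX finST ST by (intro row) (auto simp: B_def)
        moreover have "(\<Sum>c\<in>T. w r c) \<le> (\<Sum>c\<in>T. \<Sum>r\<in>A - S. w r c)"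
          using defrc[of "{r}" T] R_A[OF r] by simp
        ultimately show False using def wab by linarith
      qed
      have finR: "finite R" using R_A finA by (meson finite_Diff finite_subset subsetI)
      have rowR: "(\<Sum>c\<in>T'. w r c) + (\<Sum>c\<in>T. w r c) = 1" if r: "r \<in> R" for r
      proof -
        have rX: "r \<in> X" using R_A[OF r] by (auto simp: A_def)
        have rH: "r \<in> H" using R_A[OF r] Rfar[OF r] by (force simp: A_def)
        have "c \<in> T' \<union> T" if c: "c \<in> Y" "w r c \<noteq> 0" for c
        proof -
          have "c \<in> H"
          proof (rule ccontr)
            assume "c \<notin> H"
            then obtain z where z: "z \<in> Fr" "dist r z + dist z c = dist r c"
              using cross rH by blast
            have "dist r c \<le> 3*t" using c rX range supp by blast
            then have "c \<notin> Q"
              using Qfar[OF z(1), of c] z t0 zero_le_dist[of r z] dist_commute[of z c] by fastforce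
            then have "dist r c \<le> R0" using clean_w rX c by blast
            then show False using Rfar[OF r z(1)] z t0 zero_le_dist[of z c] by linarith
          qed
          then show ?thesis using c by (auto simp: T'_def B_def)
        qed
        then have "(\<Sum>c\<in>T' \<union> T. w r c) = 1"
          using rX fin' finST ST by (intro row) (auto simp: B_def T'_def)
        then show ?thesis using fin' finST by (subst (asm) sum.union_disjoint) (auto simp: T'_def)
      qed
      have aR: "a \<notin> R" using R_A ST by blast
      have colT': "(\<Sum>r\<in>R. w r c) + (if c = b then w a b else 0) = 1" if c: "c \<in> T'" for c
      proof -
        have inR: "r \<in> R" if "r \<in> X" "w r c \<noteq> 0" "(r, c) \<noteq> (a, b)" for r
          using that supp T'H[OF c] c by (auto simp: R_def nbr_rows_def)
        have "(\<Sum>r\<in>insert a R. w r c) = 1"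
          using T'H[OF c] finR inR a by (intro col) (auto simp: R_def nbr_rows_def)
        moreover have "w a c = 0" if "c \<noteq> b" using inR[OF a] aR that by auto
        ultimately show ?thesis using finR aR by (cases "c = b") auto
      qed
      have "real (card T') = (\<Sum>c\<in>T'. (\<Sum>r\<in>R. w r c) + (if c = b then w a b else 0))"
        using colT' by simp
      also have "\<dots> = (\<Sum>r\<in>R. \<Sum>c\<in>T'. w r c) + w a b"
        using fin' ST bB by (simp add: sum.distrib T'_def sum.swap[of _ "B - T"])
      finally have cT: "real (card T') = (\<Sum>r\<in>R. \<Sum>c\<in>T'. w r c) + w a b" .
      have "real (card R) = (\<Sum>r\<in>R. (\<Sum>c\<in>T'. w r c) + (\<Sum>c\<in>T. w r c))"
        using rowR by simp
      also have "\<dots> = (\<Sum>r\<in>R. \<Sum>c\<in>T'. w r c) + (\<Sum>r\<in>R. \<Sum>c\<in>T. w r c)"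
        by (simp add: sum.distrib)
      also have "\<dots> < (\<Sum>r\<in>R. \<Sum>c\<in>T'. w r c) + w a b"
        using defrc[of R T] def R_A by force
      finally have "card R < card T'" using cT by linarith
      then show ?thesis
        using cols[of T'] fin' T'H by (auto simp: R_def)
    qed
  qed
qed

end

section \<open>Rounding a periodic partition of unity\<close>

text \<open>Tested on finite index sets that contain the support, so that no infinite sum occurs; by
  \<open>periodic_sum_oneI\<close> a single such set for each \<open>p\<close> suffices.\<close>

definition periodic_sum_one :: "'a::ab_group_add set \<Rightarrow> ('a \<Rightarrow> real) \<Rightarrow> bool" where
  "periodic_sum_one L m \<longleftrightarrow> (\<forall>p T. finite T \<longrightarrow> T \<subseteq> L \<longrightarrow> (\<forall>\<gamma>\<in>L. m (p + \<gamma>) \<noteq> 0 \<longrightarrow> \<gamma> \<in> T) \<longrightarrow>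
     (\<Sum>\<gamma>\<in>T. m (p + \<gamma>)) = 1)"

lemma periodic_sum_oneD:
  assumes "periodic_sum_one L m" "finite T" "T \<subseteq> L" "\<And>\<gamma>. \<gamma> \<in> L \<Longrightarrow> m (p + \<gamma>) \<noteq> 0 \<Longrightarrow> \<gamma> \<in> T"
  shows "(\<Sum>\<gamma>\<in>T. m (p + \<gamma>)) = 1"
  using assms unfolding periodic_sum_one_def by blast

lemma periodic_sum_oneI:
  assumes "\<And>p. \<exists>T. finite T \<and> T \<subseteq> L \<and> (\<forall>\<gamma>\<in>L. m (p + \<gamma>) \<noteq> 0 \<longrightarrow> \<gamma> \<in> T) \<and> (\<Sum>\<gamma>\<in>T. m (p + \<gamma>)) = 1"
  shows "periodic_sum_one L m"
  unfolding periodic_sum_one_def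
proof (intro allI impI)
  fix p T assume T: "finite T" "T \<subseteq> L" "\<forall>\<gamma>\<in>L. m (p + \<gamma>) \<noteq> 0 \<longrightarrow> \<gamma> \<in> T"
  obtain T1 where T1: "finite T1" "T1 \<subseteq> L" "\<forall>\<gamma>\<in>L. m (p + \<gamma>) \<noteq> 0 \<longrightarrow> \<gamma> \<in> T1" "(\<Sum>\<gamma>\<in>T1. m (p + \<gamma>)) = 1"
    using assms by blast
  have "(\<Sum>\<gamma>\<in>T. m (p + \<gamma>)) = (\<Sum>\<gamma>\<in>T1. m (p + \<gamma>))"
    by (rule sum.mono_neutral_cong) (use T T1 in auto)
  then show "(\<Sum>\<gamma>\<in>T. m (p + \<gamma>)) = 1" using T1 by simp
qed

lemma dist_minus_left: "dist (- x) y = norm (x + y)" for x y :: "'a::real_normed_vector"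
proof -
  have "- x - y = - (x + y)" by simp
  then show ?thesis by (simp only: dist_norm norm_minus_cancel)
qed

lemma periodic_sum_one_le:
  fixes m :: "'a::real_normed_vector \<Rightarrow> real"
  assumes "periodic_sum_one L m" "\<And>p. 0 \<le> m p" "\<And>p. m p \<noteq> 0 \<Longrightarrow> norm p \<le> R"
    and lf: "\<And>x r. finite (L \<inter> cball x r)" and T: "finite T" "T \<subseteq> L"
  shows "(\<Sum>\<gamma>\<in>T. m (p + \<gamma>)) \<le> 1"
proof -
  let ?T = "T \<union> (L \<inter> cball (- p) R)"
  have supp: "\<gamma> \<in> cball (- p) R" if "m (p + \<gamma>) \<noteq> 0" for \<gamma>
    using assms(3)[OF that] by (simp add: dist_minus_left)
  have "(\<Sum>\<gamma>\<in>T. m (p + \<gamma>)) \<le> (\<Sum>\<gamma>\<in>?T. m (p + \<gamma>))"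
    using T lf assms(2) by (intro sum_mono2) auto
  also have "\<dots> = 1"
    by (rule periodic_sum_oneD[OF assms(1)]) (use lf T supp in auto)
  finally show ?thesis .
qed

text \<open>Row \<open>s\<close> and column \<open>c\<close> of the matrix attached to \<open>p\<close> meet in the entry \<open>m (p + s + c)\<close>.\<close>

definition hall_violator :: "'a::real_normed_vector set \<Rightarrow> 'a set \<Rightarrow> 'a set \<Rightarrow> 'a \<Rightarrow> bool" where
  "hall_violator L L' Del p \<longleftrightarrow> (\<exists>S. finite S \<and> S \<subseteq> L' \<and>
     card {c \<in> L. \<exists>s\<in>S. p + s + c \<notin> Del \<and> (s, c) \<noteq> (0, 0)} < card S)"

lemma finite_nbrs:
  fixes L :: "'a::real_normed_vector set"
  assumes lf: "\<And>x r. finite (L \<inter> cball x r)" and Del: "{p. R < norm p} \<subseteq> Del" and S: "finite S"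
  shows "finite {c \<in> L. \<exists>s\<in>S. p + s + c \<notin> Del \<and> P s c}"
proof (rule finite_subset)
  show "{c \<in> L. \<exists>s\<in>S. p + s + c \<notin> Del \<and> P s c} \<subseteq> (\<Union>s\<in>S. L \<inter> cball (- (p + s)) R)"
  proof
    fix c assume "c \<in> {c \<in> L. \<exists>s\<in>S. p + s + c \<notin> Del \<and> P s c}"
    then obtain s where s: "c \<in> L" "s \<in> S" "p + s + c \<notin> Del" by blast
    then have "norm (p + s + c) \<le> R" using Del by force
    then have "dist (- (p + s)) c \<le> R"
      by (simp only: dist_minus_left)
    then show "c \<in> (\<Union>s\<in>S. L \<inter> cball (- (p + s)) R)" using s by auto
  qed
  show "finite (\<Union>s\<in>S. L \<inter> cball (- (p + s)) R)"
    by (rule finite_UN_I) (use lf S in blast)+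
qed

text \<open>Double counting. The rows \<open>S\<close> carry mass \<open>card S\<close>, but the
  columns they reach otherwise than through the entry \<open>(0, 0)\<close> carry at most their
  number, which is smaller. An integer gap is at least one, and only \<open>m p\<close> can fill
  it.\<close>

lemma hall_violator_forces:
  fixes m :: "'a::real_normed_vector \<Rightarrow> real"
  assumes m: "periodic_sum_one L m" "periodic_sum_one L' m" "\<And>p. 0 \<le> m p" "\<And>p. p \<in> Del \<Longrightarrow> m p = 0"
    and lf: "\<And>x r. finite (L \<inter> cball x r)" "\<And>x r. finite (L' \<inter> cball x r)"
    and Del: "{p. R < norm p} \<subseteq> Del" and v: "hall_violator L L' Del p" and 0: "0 \<in> L"
  shows "m p = 1"
proof -
  obtain S where S: "finite S" "S \<subseteq> L'"
    "card {c \<in> L. \<exists>s\<in>S. p + s + c \<notin> Del \<and> (s, c) \<noteq> (0, 0)} < card S"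
    using v unfolding hall_violator_def by blast
  define N where "N = {c \<in> L. \<exists>s\<in>S. p + s + c \<notin> Del \<and> (s, c) \<noteq> (0, 0)}"
  have finN: "finite N" unfolding N_def by (rule finite_nbrs[OF lf(1) Del S(1)])
  have supp: "norm q \<le> R" if "m q \<noteq> 0" for q using m(4) Del that by force
  have row: "1 \<le> (\<Sum>c\<in>N. m (p + s + c)) + (if s = 0 then m p else 0)" if s: "s \<in> S" for s
  proof (cases "s = 0")
    case True
    have "(\<Sum>c\<in>insert 0 N. m (p + s + c)) = 1"
      by (rule periodic_sum_oneD[OF m(1)]) (use finN 0 m(4) s in \<open>auto simp: N_def\<close>)
    moreover have "(\<Sum>c\<in>insert 0 N. m (p + s + c)) \<le> m (p + s + 0) + (\<Sum>c\<in>N. m (p + s + c))"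
      using finN m(3) by (cases "0 \<in> N") (auto simp: insert_absorb)
    ultimately show ?thesis using True by simp
  next
    case False
    have "(\<Sum>c\<in>N. m (p + s + c)) = 1"
      by (rule periodic_sum_oneD[OF m(1)]) (use finN m(4) s False in \<open>auto simp: N_def\<close>)
    then show ?thesis using False by simp
  qed
  have "real (card S) \<le> (\<Sum>s\<in>S. (\<Sum>c\<in>N. m (p + s + c)) + (if s = 0 then m p else 0))"
    using sum_mono[of S "\<lambda>_. 1", OF row] by simp
  also have "\<dots> = (\<Sum>c\<in>N. \<Sum>s\<in>S. m (p + c + s)) + (\<Sum>s\<in>S. if s = 0 then m p else 0)"
    by (simp add: sum.distrib sum.swap[of _ S] add_ac)
  also have "\<dots> \<le> (\<Sum>c\<in>N. 1) + m p"
  proof (intro add_mono sum_mono)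
    show "(\<Sum>s\<in>S. m (p + c + s)) \<le> 1" for c
      by (rule periodic_sum_one_le[OF m(2) m(3) supp lf(2) S(1,2)])
    show "(\<Sum>s\<in>S. if s = 0 then m p else 0) \<le> m p"
      using S(1) m(3) by simp
  qed
  finally have "real (card S) \<le> real (card N) + m p" by simp
  then have "1 \<le> m p" using S(3) unfolding N_def by linarith
  moreover have "m p \<le> 1"
    using periodic_sum_one_le[OF m(1) m(3) supp lf(1), of "{0}" p] 0 by simp
  ultimately show ?thesis by simp
qed

text \<open>A violator asserts that finitely many entries lie in \<open>Del\<close>. As
  \<open>Del\<close> is open, they remain there when \<open>p\<close> moves a little, so the set of
  columns reached from \<open>S\<close> can only shrink.\<close>

lemma hall_violator_open:
  fixes L :: "'a::real_normed_vector set"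
  assumes lf: "\<And>x r. finite (L \<inter> cball x r)"
    and Del: "{p. R < norm p} \<subseteq> Del" "open Del" and v: "hall_violator L L' Del p"
  shows "\<exists>\<epsilon>>0. \<forall>p'\<in>ball p \<epsilon>. hall_violator L L' Del p'"
proof -
  obtain S where S: "finite S" "S \<subseteq> L'"
    "card {c \<in> L. \<exists>s\<in>S. p + s + c \<notin> Del \<and> (s, c) \<noteq> (0, 0)} < card S"
    using v unfolding hall_violator_def by blast
  \<comment> \<open>The extra \<open>1\<close> allows \<open>p'\<close> to be at distance up to
    \<open>1\<close> from \<open>p\<close>: every column that could be reached from
    \<open>p'\<close> is already in this finite set.\<close>
  define F where "F = (\<Union>s\<in>S. L \<inter> cball (- (p + s)) (R + 1))"
  have finF: "finite F" unfolding F_def by (rule finite_UN_I) (use lf S in blast)+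
  have "\<forall>\<^sub>F p' in nhds p. \<forall>x\<in>{(s, c) \<in> S \<times> F. p + s + c \<in> Del}. p' + fst x + snd x \<in> Del"
  proof (rule eventually_ball_finite)
    show "finite {(s, c) \<in> S \<times> F. p + s + c \<in> Del}"
      by (rule finite_subset[of _ "S \<times> F"]) (use S finF in auto)
    show "\<forall>x\<in>{(s, c) \<in> S \<times> F. p + s + c \<in> Del}. \<forall>\<^sub>F p' in nhds p. p' + fst x + snd x \<in> Del"
    proof
      fix x assume x: "x \<in> {(s, c) \<in> S \<times> F. p + s + c \<in> Del}"
      have "((\<lambda>p'. p' + fst x + snd x) \<longlongrightarrow> p + fst x + snd x) (nhds p)"
        by (intro tendsto_intros filterlim_ident)
      then show "\<forall>\<^sub>F p' in nhds p. p' + fst x + snd x \<in> Del"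
        by (rule topological_tendstoD) (use Del x in auto)
    qed
  qed
  then obtain e where e: "e > 0" "\<And>p' s c. dist p' p < e \<Longrightarrow> s \<in> S \<Longrightarrow> c \<in> F \<Longrightarrow> p + s + c \<in> Del \<Longrightarrow> p' + s + c \<in> Del"
    unfolding eventually_nhds_metric by force
  have "hall_violator L L' Del p'" if p': "p' \<in> ball p (min e 1)" for p'
  proof -
    have sub: "{c \<in> L. \<exists>s\<in>S. p' + s + c \<notin> Del \<and> (s, c) \<noteq> (0, 0)} \<subseteq>
          {c \<in> L. \<exists>s\<in>S. p + s + c \<notin> Del \<and> (s, c) \<noteq> (0, 0)}"
    proof
      fix c assume "c \<in> {c \<in> L. \<exists>s\<in>S. p' + s + c \<notin> Del \<and> (s, c) \<noteq> (0, 0)}"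
      then obtain s where s: "c \<in> L" "s \<in> S" "p' + s + c \<notin> Del" "(s, c) \<noteq> (0, 0)" by blast
      then have "norm (p' + s + c) \<le> R" using Del by force
      moreover have "norm (p + s + c) \<le> norm (p' + s + c) + norm (p - p')"
        using norm_triangle_ineq[of "p' + s + c" "p - p'"] by (simp add: algebra_simps)
      moreover have "norm (p - p') \<le> 1" using p' by (simp add: dist_norm)
      ultimately have "norm (p + s + c) \<le> R + 1" by linarith
      then have "dist (- (p + s)) c \<le> R + 1"
        by (simp only: dist_minus_left)
      then have "c \<in> F" using s by (auto simp: F_def)
      then have "p + s + c \<notin> Del" using e(2)[of p' s c] p' s by (auto simp: dist_commute)
      then show "c \<in> {c \<in> L. \<exists>s\<in>S. p + s + c \<notin> Del \<and> (s, c) \<noteq> (0, 0)}" using s by blast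
    qed
    have "card {c \<in> L. \<exists>s\<in>S. p' + s + c \<notin> Del \<and> (s, c) \<noteq> (0, 0)} < card S"
      using card_mono[OF finite_nbrs[OF lf Del(1) S(1)] sub] S(3) by linarith
    then show ?thesis using S unfolding hall_violator_def by blast
  qed
  then show ?thesis using e(1) by (intro exI[of _ "min e 1"]) auto
qed

section \<open>Diameters of clusters of linked points\<close>

definition link :: "real \<Rightarrow> 'a::metric_space set \<Rightarrow> 'a \<Rightarrow> 'a \<Rightarrow> bool" where
  "link h Y u v \<longleftrightarrow> u \<in> Y \<and> v \<in> Y \<and> dist u v \<le> h"

text \<open>Two successive visits of a walk to \<open>N\<close> are at most \<open>L + 2 * h\<close>
  apart and hence take place at one and the same point. Both ends of the walk are within
  \<open>L + h\<close> of that point.\<close>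

lemma link_add_separated:
  assumes L: "\<And>u v. (link h Y)\<^sup>*\<^sup>* u v \<Longrightarrow> dist u v \<le> L" and h: "0 \<le> h"
    and N: "\<And>x y. x \<in> N \<Longrightarrow> y \<in> N \<Longrightarrow> dist x y \<le> L + 2 * h \<Longrightarrow> x = y"
    and uv: "(link h (Y \<union> N))\<^sup>*\<^sup>* u v"
  shows "dist u v \<le> 2 * L + 2 * h"
proof -
  have L0: "0 \<le> L" using L[of u u] by simp
  have "(link h Y)\<^sup>*\<^sup>* u v \<or>
      (\<exists>n\<in>N. dist u n \<le> L + h \<and> (v = n \<or> (\<exists>y. dist n y \<le> h \<and> (link h Y)\<^sup>*\<^sup>* y v)))"
    using uv
  proof (induction rule: rtranclp_induct)
    case base
    then show ?case by simp
  next
    case (step y z)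
    have yz: "y \<in> Y \<union> N" "z \<in> Y \<union> N" "dist y z \<le> h" using step(2) by (auto simp: link_def)
    show ?case
    proof (cases "z \<in> N")
      case zN: True
      from step.IH show ?thesis
      proof (elim disjE bexE conjE exE)
        assume "(link h Y)\<^sup>*\<^sup>* u y"
        then have "dist u z \<le> L + h" using L[of u y] yz dist_triangle[of u z y] by linarith
        then show ?thesis using zN by blast
      next
        fix n assume n: "n \<in> N" "dist u n \<le> L + h" "y = n"
        then have "n = z" using N[of n z] zN yz L0 h by auto
        then show ?thesis using n by blast
      next
        fix n x assume n: "n \<in> N" "dist u n \<le> L + h" "dist n x \<le> h" "(link h Y)\<^sup>*\<^sup>* x y"
        have "dist n z \<le> L + 2 * h"
          using L[OF n(4)] n(3) yz dist_triangle[of n z x] dist_triangle[of x z y] by linarith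
        then have "n = z" using N[of n z] zN n by auto
        then show ?thesis using n by blast
      qed
    next
      case False
      then have zY: "z \<in> Y" using yz by blast
      show ?thesis
      proof (cases "y \<in> Y")
        case True
        then have "link h Y y z" using zY yz by (simp add: link_def)
        then have ext: "(link h Y)\<^sup>*\<^sup>* x z" if "(link h Y)\<^sup>*\<^sup>* x y" for x
          using that by (rule rtranclp.rtrancl_into_rtrancl[rotated])
        from step.IH show ?thesis
        proof (elim disjE bexE conjE exE)
          assume "(link h Y)\<^sup>*\<^sup>* u y"
          then show ?thesis using ext by blast
        next
          fix n assume "n \<in> N" "dist u n \<le> L + h" "y = n"
          then show ?thesis using yz by blast
        next
          fix n x assume "n \<in> N" "dist u n \<le> L + h" "dist n x \<le> h" "(link h Y)\<^sup>*\<^sup>* x y"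
          then show ?thesis using ext by blast
        qed
      next
        case False
        then have yN: "y \<in> N" using yz by blast
        from step.IH show ?thesis
        proof (elim disjE bexE conjE exE)
          assume "(link h Y)\<^sup>*\<^sup>* u y"
          then have "dist u y \<le> L + h" using L[of u y] h by linarith
          then show ?thesis using yN yz by blast
        next
          fix n assume n: "n \<in> N" "dist u n \<le> L + h" "y = n"
          then show ?thesis using yz by blast
        next
          fix n x assume n: "n \<in> N" "dist u n \<le> L + h" "dist n x \<le> h" "(link h Y)\<^sup>*\<^sup>* x y"
          have "dist n y \<le> L + 2 * h"
            using L[OF n(4)] n(3) dist_triangle[of n y x] h by linarith
          then have "n = y" using N[of n y] yN n by auto
          then show ?thesis using n yz by blast
        qed
      qed
    qed
  qed
  then show ?thesis
  proof (elim disjE bexE conjE exE)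
    assume "(link h Y)\<^sup>*\<^sup>* u v"
    then show ?thesis using L[of u v] L0 h by linarith
  next
    fix n assume "dist u n \<le> L + h" "v = n"
    then show ?thesis using L0 h by auto
  next
    fix n x assume n: "dist u n \<le> L + h" "dist n x \<le> h" "(link h Y)\<^sup>*\<^sup>* x v"
    then show ?thesis
      using L[OF n(3)] dist_triangle[of u v n] dist_triangle[of n v x] by linarith
  qed
qed

text \<open>The order of the quantifiers matters: \<open>L'\<close> and \<open>S\<close> come before
  \<open>Y\<close> and \<open>N\<close>. The separation \<open>S\<close> decides how small an open
  set has to be, and the bound \<open>L'\<close> must hold for all cosets at once.\<close>

lemma link_add_finitely_many_separated:
  assumes "finite J" and h: "0 \<le> h"
  shows "\<exists>L' S. \<forall>Y N. (\<forall>u v. (link h Y)\<^sup>*\<^sup>* u v \<longrightarrow> dist u v \<le> L) \<longrightarrow>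
      (\<forall>j\<in>J. \<forall>x\<in>N j. \<forall>y\<in>N j. dist x y \<le> S \<longrightarrow> x = y) \<longrightarrow>
      (\<forall>u v. (link h (Y \<union> (\<Union>j\<in>J. N j)))\<^sup>*\<^sup>* u (v::'a::metric_space) \<longrightarrow> dist u v \<le> L')"
  using assms(1)
proof (induction J rule: finite_induct)
  case empty
  show ?case by (rule exI[of _ L]) simp
next
  case (insert j J)
  then obtain L' S where LS: "\<And>Y (N :: _ \<Rightarrow> 'a set). (\<forall>u v. (link h Y)\<^sup>*\<^sup>* u v \<longrightarrow> dist u v \<le> L) \<Longrightarrow>
      (\<forall>j\<in>J. \<forall>x\<in>N j. \<forall>y\<in>N j. dist x y \<le> S \<longrightarrow> x = y) \<Longrightarrow>
      (\<forall>u v. (link h (Y \<union> (\<Union>j\<in>J. N j)))\<^sup>*\<^sup>* u v \<longrightarrow> dist u v \<le> L')"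
    by blast
  show ?case
  proof (rule exI[of _ "2 * L' + 2 * h"], rule exI[of _ "max S (L' + 2 * h)"], intro allI impI)
    fix Y :: "'a set" and N u v
    assume Y: "\<forall>u v. (link h Y)\<^sup>*\<^sup>* u v \<longrightarrow> dist u v \<le> L"
      and N: "\<forall>j\<in>insert j J. \<forall>x\<in>N j. \<forall>y\<in>N j. dist x y \<le> max S (L' + 2 * h) \<longrightarrow> x = y"
      and uv: "(link h (Y \<union> (\<Union>j\<in>insert j J. N j)))\<^sup>*\<^sup>* u v"
    have eq: "Y \<union> (\<Union>j\<in>insert j J. N j) = (Y \<union> (\<Union>j\<in>J. N j)) \<union> N j" by blast
    show "dist u v \<le> 2 * L' + 2 * h"
    proof (rule link_add_separated)
      show "(link h ((Y \<union> (\<Union>j\<in>J. N j)) \<union> N j))\<^sup>*\<^sup>* u v" using uv unfolding eq .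
      show "dist u v \<le> L'" if "(link h (Y \<union> (\<Union>j\<in>J. N j)))\<^sup>*\<^sup>* u v" for u v
        using LS[OF Y] N that by (metis insertCI max.coboundedI1)
    qed (use N h in auto)
  qed
qed

lemma negligible_linear_fibre:
  fixes h :: "'a::euclidean_space \<Rightarrow> 'a"
  assumes lin: "linear h" and nz: "h v \<noteq> 0"
  shows "negligible {x. h x = y}"
proof -
  obtain i where i: "i \<in> Basis" "h v \<bullet> i \<noteq> 0" using nz euclidean_all_zero_iff by blast
  define c where "c = adjoint h i"
  have c: "x \<bullet> c = h x \<bullet> i" for x unfolding c_def by (rule adjoint_works[OF lin])
  have "c \<noteq> 0" using c[of v] i by auto
  then have "negligible {x. c \<bullet> x = y \<bullet> i}" by (intro negligible_hyperplane) simp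
  moreover have "{x. h x = y} \<subseteq> {x. c \<bullet> x = y \<bullet> i}" using c by (auto simp: inner_commute)
  ultimately show ?thesis by (rule negligible_subset)
qed

lemma negligible_affine_fixed_points:
  fixes g :: "'a::euclidean_space \<Rightarrow> 'a"
  assumes "linear g" "g \<noteq> id"
  shows "negligible {x. g x + \<delta> = x}"
proof -
  obtain v where v: "g v - v \<noteq> 0" using assms(2) by force
  have "linear (\<lambda>x. g x - x)" using assms(1) by (intro linear_compose_sub linear_id[unfolded id_def])
  then have "negligible {x. g x - x = - \<delta>}" by (rule negligible_linear_fibre) (rule v)
  moreover have "{x. g x + \<delta> = x} = {x. g x - x = - \<delta>}"
    by (auto simp: algebra_simps eq_neg_iff_add_eq_0)
  ultimately show ?thesis by simp
qed

text \<open>Used with an element of \<open>D\<close> that exchanges the two lattices, this turns the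
  statement about row sums into the one about column sums.\<close>

lemma periodic_sum_one_image:
  assumes "linear d" "bij d" "\<And>p. m (d p) = m p" "periodic_sum_one L m"
  shows "periodic_sum_one (d ` L) m"
  unfolding periodic_sum_one_def
proof (intro allI impI)
  fix p T assume T: "finite T" "T \<subseteq> d ` L" "\<forall>\<gamma>\<in>d ` L. m (p + \<gamma>) \<noteq> 0 \<longrightarrow> \<gamma> \<in> T"
  define T0 where "T0 = {\<gamma> \<in> L. d \<gamma> \<in> T}"
  have inj: "inj d" using assms(2) by (rule bij_is_inj)
  obtain p0 where p0: "p = d p0" using assms(2) by (meson bij_pointE)
  have im: "d ` T0 = T" using T(2) by (auto simp: T0_def)
  have fin: "finite T0" using im T(1) inj by (metis finite_imageD inj_on_subset subset_UNIV)
  have dadd: "m (d p0 + d \<gamma>) = m (p0 + \<gamma>)" for \<gamma>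
    using assms(3)[of "p0 + \<gamma>"] by (simp add: linear_add[OF assms(1)])
  have "(\<Sum>\<gamma>\<in>T. m (p + \<gamma>)) = (\<Sum>\<gamma>\<in>T0. m (d p0 + d \<gamma>))"
    unfolding im[symmetric] p0 by (rule sum.reindex_cong[of d]) (auto intro: inj_on_subset[OF inj])
  also have "\<dots> = (\<Sum>\<gamma>\<in>T0. m (p0 + \<gamma>))" by (simp add: dadd)
  also have "\<dots> = 1"
  proof (rule periodic_sum_oneD[OF assms(4) fin])
    show "T0 \<subseteq> L" by (auto simp: T0_def)
    show "\<gamma> \<in> T0" if "\<gamma> \<in> L" "m (p0 + \<gamma>) \<noteq> 0" for \<gamma>
      using T(3) that dadd[of \<gamma>] p0 by (auto simp: T0_def)
  qed
  finally show "(\<Sum>\<gamma>\<in>T. m (p + \<gamma>)) = 1" .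
qed

section \<open>Deleting entries for two lattices exchanged by a finite group\<close>

text \<open>Sums over \<open>\<Gamma>\<close> are row sums and sums over \<open>\<Gamma>'\<close>
  column sums. \<open>R0\<close> bounds the range of the initial solution \<open>m0\<close> and
  \<open>\<kappa>\<close> is a covering radius of \<open>\<Gamma>\<close>; entries of norm up to
  \<open>3 * t\<close> will be admissible.\<close>

locale lattice_pair =
  fixes \<Gamma> \<Gamma>' :: "'a::euclidean_space set" and D :: "('a \<Rightarrow> 'a) set" and m0 :: "'a \<Rightarrow> real"
    and R0 \<kappa> t :: real
  assumes dim: "2 \<le> DIM('a)"
    and \<Gamma>_0: "0 \<in> \<Gamma>" and \<Gamma>_diff: "\<And>x y. x \<in> \<Gamma> \<Longrightarrow> y \<in> \<Gamma> \<Longrightarrow> x - y \<in> \<Gamma>"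
    and \<Gamma>'_0: "0 \<in> \<Gamma>'" and \<Gamma>'_diff: "\<And>x y. x \<in> \<Gamma>' \<Longrightarrow> y \<in> \<Gamma>' \<Longrightarrow> x - y \<in> \<Gamma>'"
    and lf: "\<And>x r. finite (\<Gamma> \<inter> cball x r)" and lf': "\<And>x r. finite (\<Gamma>' \<inter> cball x r)"
    and indep: "\<Gamma> \<inter> \<Gamma>' = {0}"
    and finD: "finite D" and idD: "id \<in> D" and compD: "\<And>d e. d \<in> D \<Longrightarrow> e \<in> D \<Longrightarrow> d \<circ> e \<in> D"
    and invD: "\<And>d. d \<in> D \<Longrightarrow> \<exists>e\<in>D. e \<circ> d = id \<and> d \<circ> e = id"
    and orthD: "\<And>d. d \<in> D \<Longrightarrow> orthogonal_transformation d"
    and actD: "\<And>d. d \<in> D \<Longrightarrow> d ` \<Gamma> = \<Gamma> \<and> d ` \<Gamma>' = \<Gamma>' \<or> d ` \<Gamma> = \<Gamma>' \<and> d ` \<Gamma>' = \<Gamma>"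
    and swap: "\<exists>d\<in>D. d ` \<Gamma> = \<Gamma>'"
    and \<kappa>: "0 < \<kappa>" and R0: "0 \<le> R0" and t: "t = R0 + \<kappa>"
    and dense: "\<And>z. \<exists>c\<in>\<Gamma>. dist c z \<le> \<kappa>"
    and m0_nonneg: "\<And>p. 0 \<le> m0 p" and m0_supp: "\<And>p. m0 p \<noteq> 0 \<Longrightarrow> norm p \<le> R0"
    and m0_D: "\<And>d p. d \<in> D \<Longrightarrow> m0 (d p) = m0 p"
    and m0_sum: "periodic_sum_one \<Gamma> m0"
begin

text \<open>\<open>Del\<close> holds the entries deleted for good. The sums over
  \<open>\<Gamma>'\<close> are covered as well, by symmetry under an element of \<open>D\<close>
  that exchanges the lattices.\<close>

definition state :: "('a \<Rightarrow> real) \<Rightarrow> 'a set \<Rightarrow> bool" where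
  "state m Del \<longleftrightarrow> (\<forall>p. 0 \<le> m p) \<and> (\<forall>p\<in>Del. m p = 0) \<and> (\<forall>d\<in>D. \<forall>p. m (d p) = m p) \<and> periodic_sum_one \<Gamma> m"

definition bad_cols :: "'a set \<Rightarrow> 'a \<Rightarrow> 'a set" where
  "bad_cols Z x = {c \<in> \<Gamma>. \<exists>s\<in>\<Gamma>'. x + s + c \<in> Z}"

text \<open>Clusters of modified columns have bounded diameter, uniformly over all cosets.\<close>

definition sparse :: "'a set \<Rightarrow> bool" where
  "sparse Z \<longleftrightarrow> (\<exists>L. \<forall>x u v. (link (12 * t) (bad_cols Z x))\<^sup>*\<^sup>* u v \<longrightarrow> dist u v \<le> L)"

text \<open>\<open>Z\<close> keeps track of the entries touched so far. Off \<open>Z\<close> there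
  is the slack that \<open>island\<close> demands: everything of norm up to \<open>3 * t\<close> is
  admissible, but only norms up to \<open>R0\<close> are in use. The condition \<open>sparse\<close>
  bounds the clusters of dirty columns.\<close>

definition good :: "('a \<Rightarrow> real) \<Rightarrow> 'a set \<Rightarrow> 'a set \<Rightarrow> bool" where
  "good m Del Z \<longleftrightarrow> state m Del \<and> open Del \<and> {p. 3 * t < norm p} \<subseteq> Del \<and>
     (\<forall>d\<in>D. \<forall>p. d p \<in> Del \<longleftrightarrow> p \<in> Del) \<and>
     (\<forall>p. p \<notin> Z \<longrightarrow> m p = m0 p \<and> (norm p \<le> 3 * t \<longrightarrow> p \<notin> Del)) \<and> sparse Z"

lemma t_pos: "0 < t" using \<kappa> R0 t by simp

lemma linearD: "d \<in> D \<Longrightarrow> linear d" and bijD: "d \<in> D \<Longrightarrow> bij d" and normD: "d \<in> D \<Longrightarrow> norm (d x) = norm x"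
  using orthD orthogonal_transformation_linear orthogonal_transformation_bij orthogonal_transformation_norm by blast+

lemma state_sum':
  assumes "state m Del"
  shows "periodic_sum_one \<Gamma>' m"
proof -
  obtain d where d: "d \<in> D" "d ` \<Gamma> = \<Gamma>'" using swap by blast
  then show ?thesis
    using periodic_sum_one_image[of d m \<Gamma>] linearD bijD assms by (auto simp: state_def)
qed

text \<open>This is \<open>island\<close> for the matrix of one coset. What matters is that
  \<open>\<rho>\<close> does not depend on \<open>p\<close>: finitely many relative positions
  \<open>(s, c)\<close> then serve all \<open>p\<close> simultaneously.\<close>

lemma local_removal:
  assumes g: "good m Del Z"
  obtains \<rho> where "0 \<le> \<rho>" "\<And>p. norm p \<le> 3 * t \<Longrightarrow> \<not> hall_violator \<Gamma> \<Gamma>' Del p \<Longrightarrow> \<not> hall_violator \<Gamma>' \<Gamma> Del p \<Longrightarrow>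
    \<exists>\<delta>. (\<forall>s c. \<delta> s c \<noteq> 0 \<longrightarrow> s \<in> \<Gamma>' \<inter> cball 0 \<rho> \<and> c \<in> \<Gamma> \<inter> cball 0 \<rho> \<and> p + s + c \<notin> Del) \<and>
       (\<forall>s\<in>\<Gamma>'. \<forall>c\<in>\<Gamma>. 0 \<le> m (p + s + c) + \<delta> s c) \<and> \<delta> 0 0 = - m p \<and>
       (\<forall>s. (\<Sum>c\<in>\<Gamma> \<inter> cball 0 \<rho>. \<delta> s c) = 0) \<and> (\<forall>c. (\<Sum>s\<in>\<Gamma>' \<inter> cball 0 \<rho>. \<delta> s c) = 0)"
proof -
  have st: "state m Del" and Del: "{p. 3 * t < norm p} \<subseteq> Del"
    and clean: "\<And>p. p \<notin> Z \<Longrightarrow> m p = m0 p" "\<And>p. p \<notin> Z \<Longrightarrow> norm p \<le> 3 * t \<Longrightarrow> p \<notin> Del"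
    using g by (auto simp: good_def)
  have mnn: "\<And>p. 0 \<le> m p" and mDel: "\<And>p. p \<in> Del \<Longrightarrow> m p = 0" and msum: "periodic_sum_one \<Gamma> m"
    using st by (auto simp: state_def)
  have msum': "periodic_sum_one \<Gamma>' m" using state_sum'[OF st] .
  obtain L where L: "\<And>x u v. (link (12 * t) (bad_cols Z x))\<^sup>*\<^sup>* u v \<Longrightarrow> dist u v \<le> L"
    using g unfolding good_def sparse_def by blast
  have L0: "0 \<le> L" using L[of 0 0 0] by simp
  \<comment> \<open>\<open>2 * L + 24 * t\<close> is the bound of \<open>link_add_separated\<close>
    for steps \<open>12 * t\<close> and the one additional column \<open>0\<close>. Of the further
    \<open>11 * t\<close>, the margin of \<open>island\<close> takes \<open>8 * t\<close> and the
    norm of \<open>p\<close> takes \<open>3 * t\<close>.\<close>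
  define \<rho>1 where "\<rho>1 = 2 * L + 24 * t"
  define \<rho> where "\<rho> = \<rho>1 + 11 * t"
  show thesis
  proof (rule that[of \<rho>])
    show "0 \<le> \<rho>" using L0 t_pos by (simp add: \<rho>_def \<rho>1_def)
    fix p :: 'a assume p: "norm p \<le> 3 * t" and nv: "\<not> hall_violator \<Gamma> \<Gamma>' Del p" "\<not> hall_violator \<Gamma>' \<Gamma> Del p"
    \<comment> \<open>Row \<open>s\<close> is placed at the point \<open>- p - s\<close>. Its
      difference to column \<open>c\<close> is then the position \<open>p + s + c\<close> of the
      entry, so the distance between row and column is the norm of the entry.\<close>
    define X where "X = (\<lambda>s. - p - s) ` \<Gamma>'"
    define w where "w r c = m (c - r)" for r c
    define G where "G = {(r, c). c - r \<notin> Del}"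
    define Q where "Q = bad_cols Z p"
    define C where "C = {v. (link (12 * t) (Q \<union> {0}))\<^sup>*\<^sup>* 0 v}"
    have rc: "c - (- p - s) = p + s + c" and e1: "- p - (- p - s) = s" and e2: "p + (- p - s) + c = c - s"
      for s c by (simp_all add: algebra_simps)
    have CQ: "C \<subseteq> Q \<union> {0}"
    proof
      fix v assume "v \<in> C"
      then have "(link (12 * t) (Q \<union> {0}))\<^sup>*\<^sup>* 0 v" by (simp add: C_def)
      then show "v \<in> Q \<union> {0}" by (cases rule: rtranclp.cases) (auto simp: link_def)
    qed
    have Cball: "C \<subseteq> cball 0 \<rho>1"
    proof
      fix v assume "v \<in> C"
      then have "dist 0 v \<le> 2 * L + 2 * (12 * t)"
        using t_pos L[of p] by (intro link_add_separated[where Y = Q and N = "{0}"]) (auto simp: C_def Q_def)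
      then show "v \<in> cball 0 \<rho>1" by (simp add: \<rho>1_def)
    qed
    have CG: "C \<subseteq> \<Gamma>" using CQ \<Gamma>_0 by (auto simp: Q_def bad_cols_def)
    have cl: "c - r \<notin> Z" if "r \<in> X" "c \<in> \<Gamma> - Q" for r c
      using that by (auto simp: X_def Q_def bad_cols_def rc)
    interpret island X \<Gamma> w G Q C "- p" 0 t R0 \<kappa> \<rho>1
    proof
      show "finite (X \<inter> cball x r)" for x r
      proof (rule finite_subset)
        show "X \<inter> cball x r \<subseteq> (\<lambda>s. - p - s) ` (\<Gamma>' \<inter> cball (- p - x) r)"
        proof
          fix y assume "y \<in> X \<inter> cball x r"
          then obtain s where s: "s \<in> \<Gamma>'" "y = - p - s" "dist x (- p - s) \<le> r" by (auto simp: X_def)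
          have "dist (- p - x) s = dist x (- p - s)" by (metis dist_norm diff_diff_eq dist_commute add.commute)
          then show "y \<in> (\<lambda>s. - p - s) ` (\<Gamma>' \<inter> cball (- p - x) r)" using s by auto
        qed
      qed (use lf' in auto)
      show "(\<Sum>c\<in>T. w r c) = 1" if r: "r \<in> X" and T: "finite T" "T \<subseteq> \<Gamma>"
        and supp: "\<And>c. c \<in> \<Gamma> \<Longrightarrow> w r c \<noteq> 0 \<Longrightarrow> c \<in> T" for r T
      proof -
        obtain s where s: "s \<in> \<Gamma>'" "r = - p - s" using r by (auto simp: X_def)
        have wr: "w r c = m (p + s + c)" for c by (simp only: w_def s rc)
        show ?thesis unfolding wr
          by (rule periodic_sum_oneD[OF msum T]) (use supp wr in auto)
      qed
      show "(\<Sum>r\<in>T. w r c) = 1" if c: "c \<in> \<Gamma>" and T: "finite T" "T \<subseteq> X"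
        and supp: "\<And>r. r \<in> X \<Longrightarrow> w r c \<noteq> 0 \<Longrightarrow> r \<in> T" for c T
      proof -
        define T0 where "T0 = (\<lambda>r. - p - r) ` T"
        have "(\<Sum>r\<in>T. w r c) = (\<Sum>s\<in>T0. m (p + c + s))"
          unfolding T0_def w_def by (subst sum.reindex) (auto simp: inj_on_def algebra_simps)
        also have "\<dots> = 1"
        proof (rule periodic_sum_oneD[OF msum'])
          show "finite T0" using T by (simp add: T0_def)
          show "T0 \<subseteq> \<Gamma>'" using T by (auto simp: T0_def X_def)
          show "s \<in> T0" if "s \<in> \<Gamma>'" "m (p + c + s) \<noteq> 0" for s
          proof -
            have "w (- p - s) c \<noteq> 0" using that by (simp add: w_def algebra_simps)
            then have "- p - s \<in> T" using supp that by (auto simp: X_def)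
            then have "- p - (- p - s) \<in> T0" unfolding T0_def by (rule imageI)
            then show ?thesis by simp
          qed
        qed
        finally show ?thesis .
      qed
      show "dist r c \<le> 3 * t" if "(r, c) \<in> G" for r c
      proof -
        have "norm (c - r) \<le> 3 * t" using that Del by (force simp: G_def)
        then show ?thesis by (simp add: dist_norm norm_minus_commute)
      qed
      show "(r, c) \<in> G" if "r \<in> X" "c \<in> \<Gamma> - Q" "dist r c \<le> 3 * t" for r c
        using cl[OF that(1,2)] clean(2)[of "c - r"] that by (simp add: G_def dist_norm norm_minus_commute)
      show "dist r c \<le> R0" if "r \<in> X" "c \<in> \<Gamma> - Q" "w r c \<noteq> 0" for r c
        using cl[OF that(1,2)] clean(1)[of "c - r"] m0_supp[of "c - r"] that
        by (simp add: w_def dist_norm norm_minus_commute)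
      show "- p \<in> X" using \<Gamma>'_0 by (force simp: X_def)
      show "finite C" using CG Cball lf[of 0 \<rho>1] finite_subset[of C "\<Gamma> \<inter> cball 0 \<rho>1"] by blast
      show "0 \<in> C" by (simp add: C_def)
      show "(\<lambda>x y. x \<in> C \<and> y \<in> C \<and> dist x y \<le> 12 * t)\<^sup>*\<^sup>* 0 c" if "c \<in> C" for c
      proof -
        have "(link (12 * t) (Q \<union> {0}))\<^sup>*\<^sup>* 0 c" using that by (simp add: C_def)
        then show ?thesis
        proof (induction rule: rtranclp_induct)
          case (step y z)
          have "y \<in> C" "z \<in> C" "dist y z \<le> 12 * t"
            using step(1,2) by (auto simp: C_def link_def intro: rtranclp.rtrancl_into_rtrancl)
          then show ?case using step(3) by (simp add: rtranclp.rtrancl_into_rtrancl)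
        qed simp
      qed
      show "q \<in> C" if "q \<in> Q" "c \<in> C" "dist q c \<le> 12 * t" for q c
      proof -
        have "link (12 * t) (Q \<union> {0}) c q" using that CQ by (auto simp: link_def dist_commute)
        then show ?thesis using that(2) by (auto simp: C_def intro: rtranclp.rtrancl_into_rtrancl)
      qed
    qed (use dim lf \<kappa> R0 t dense mnn mDel p \<Gamma>_0 Cball in \<open>auto simp: w_def G_def\<close>)
    have row_eq: "nbr_cols S = {c \<in> \<Gamma>. \<exists>s\<in>(\<lambda>r. - p - r) ` S. p + s + c \<notin> Del \<and> (s, c) \<noteq> (0, 0)}" for S
      unfolding nbr_cols_def by (auto simp: G_def algebra_simps)
    have nr: "r \<in> nbr_rows T \<longleftrightarrow> r \<in> X \<and> (\<exists>c\<in>T. c - r \<notin> Del \<and> (r, c) \<noteq> (- p, 0))" for r T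
      unfolding nbr_rows_def by (auto simp: G_def)
    have Xr: "- p - r \<in> X \<longleftrightarrow> r \<in> \<Gamma>'" for r by (auto simp: X_def)
    have col_eq: "(\<lambda>r. - p - r) ` nbr_rows T = {s \<in> \<Gamma>'. \<exists>c\<in>T. p + c + s \<notin> Del \<and> (c, s) \<noteq> (0, 0)}" for T
    proof -
      have *: "- p - s \<in> nbr_rows T \<longleftrightarrow> s \<in> \<Gamma>' \<and> (\<exists>c\<in>T. p + c + s \<notin> Del \<and> (c, s) \<noteq> (0, 0))" for s
        unfolding nr Xr rc by (auto simp: add_ac)
      have "(\<lambda>r. - p - r) ` nbr_rows T = {s. - p - s \<in> nbr_rows T}"
      proof (intro equalityI subsetI)
        fix s assume "s \<in> {s. - p - s \<in> nbr_rows T}"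
        then have "- p - (- p - s) \<in> (\<lambda>r. - p - r) ` nbr_rows T" by blast
        then show "s \<in> (\<lambda>r. - p - r) ` nbr_rows T" by (simp only: e1)
      qed (auto simp: e1)
      then show ?thesis using * by auto
    qed
    show "\<exists>\<delta>. (\<forall>s c. \<delta> s c \<noteq> 0 \<longrightarrow> s \<in> \<Gamma>' \<inter> cball 0 \<rho> \<and> c \<in> \<Gamma> \<inter> cball 0 \<rho> \<and> p + s + c \<notin> Del) \<and>
       (\<forall>s\<in>\<Gamma>'. \<forall>c\<in>\<Gamma>. 0 \<le> m (p + s + c) + \<delta> s c) \<and> \<delta> 0 0 = - m p \<and>
       (\<forall>s. (\<Sum>c\<in>\<Gamma> \<inter> cball 0 \<rho>. \<delta> s c) = 0) \<and> (\<forall>c. (\<Sum>s\<in>\<Gamma>' \<inter> cball 0 \<rho>. \<delta> s c) = 0)"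
    proof (rule removable_or_violator)
      fix S assume S: "finite S" "S \<subseteq> X" "card (nbr_cols S) < card S"
      have "card ((\<lambda>r. - p - r) ` S) = card S" by (rule card_image) (auto simp: inj_on_def)
      then have "hall_violator \<Gamma> \<Gamma>' Del p"
        using S unfolding hall_violator_def row_eq
        by (intro exI[of _ "(\<lambda>r. - p - r) ` S"]) (auto simp: X_def)
      then show ?thesis using nv by blast
    next
      fix T assume T: "finite T" "T \<subseteq> \<Gamma>" "card (nbr_rows T) < card T"
      have "card ((\<lambda>r. - p - r) ` nbr_rows T) = card (nbr_rows T)" by (rule card_image) (auto simp: inj_on_def)
      then have "hall_violator \<Gamma>' \<Gamma> Del p"
        using T unfolding hall_violator_def col_eq by (intro exI[of _ T]) auto
      then show ?thesis using nv by blast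
    next
      fix A B w' assume A: "finite A" "A \<subseteq> X \<inter> cball 0 (\<rho>1 + 8 * t)" and B: "finite B" "B \<subseteq> \<Gamma> \<inter> cball 0 (\<rho>1 + 8 * t)"
        and ab: "- p \<in> A" "0 \<in> B" and f: "feasible_on A B G w w'" "w' (- p) 0 = 0"
      define \<delta> where "\<delta> s c = (if - p - s \<in> A \<and> c \<in> B then w' (- p - s) c - m (p + s + c) else 0)" for s c
      have inA: "s \<in> \<Gamma>' \<inter> cball 0 \<rho>" if "- p - s \<in> A" for s
      proof
        have "- p - s \<in> X" using that A by blast
        then show "s \<in> \<Gamma>'" by (auto simp: X_def)
        have "norm (- p - s) \<le> \<rho>1 + 8 * t" using that A by auto
        then have "norm s \<le> \<rho>" using p norm_triangle_ineq4[of "- p" "- p - s"] by (simp add: \<rho>_def)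
        then show "s \<in> cball 0 \<rho>" by simp
      qed
      have inB: "c \<in> \<Gamma> \<inter> cball 0 \<rho>" if "c \<in> B" for c
        using that B t_pos by (force simp: \<rho>_def)
      have f1: "0 \<le> w' r c" "w' r c \<noteq> 0 \<Longrightarrow> c - r \<notin> Del" if "r \<in> A" "c \<in> B" for r c
        using f that by (auto simp: feasible_on_def G_def)
      have f2: "(\<Sum>c\<in>B. w' r c) = (\<Sum>c\<in>B. w r c)" if "r \<in> A" for r using f that by (auto simp: feasible_on_def)
      have f3: "(\<Sum>r\<in>A. w' r c) = (\<Sum>r\<in>A. w r c)" if "c \<in> B" for c using f that by (auto simp: feasible_on_def)
      show ?thesis
      proof (intro exI[of _ \<delta>] conjI allI ballI impI)
        fix s c assume "\<delta> s c \<noteq> 0"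
        then have *: "- p - s \<in> A" "c \<in> B" "w' (- p - s) c \<noteq> 0 \<or> m (p + s + c) \<noteq> 0"
          by (auto simp: \<delta>_def split: if_splits)
        then show "s \<in> \<Gamma>' \<inter> cball 0 \<rho>" "c \<in> \<Gamma> \<inter> cball 0 \<rho>" using inA inB by auto
        show "p + s + c \<notin> Del" using *(3) f1(2)[OF *(1,2)] mDel rc by auto
      next
        fix s c show "0 \<le> m (p + s + c) + \<delta> s c" using f1(1) mnn by (auto simp: \<delta>_def)
      next
        show "\<delta> 0 0 = - m p" using ab f by (simp add: \<delta>_def)
      next
        fix s
        have "(\<Sum>c\<in>\<Gamma> \<inter> cball 0 \<rho>. \<delta> s c) = (\<Sum>c\<in>B. \<delta> s c)"
          using inB lf by (intro sum.mono_neutral_right) (auto simp: \<delta>_def)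
        also have "\<dots> = 0"
          using f2[of "- p - s"] by (cases "- p - s \<in> A") (simp_all add: \<delta>_def sum_subtractf w_def rc)
        finally show "(\<Sum>c\<in>\<Gamma> \<inter> cball 0 \<rho>. \<delta> s c) = 0" .
      next
        fix c
        have "(\<Sum>s\<in>\<Gamma>' \<inter> cball 0 \<rho>. \<delta> s c) = (\<Sum>s\<in>(\<lambda>r. - p - r) ` A. \<delta> s c)"
        proof (rule sum.mono_neutral_right)
          show "(\<lambda>r. - p - r) ` A \<subseteq> \<Gamma>' \<inter> cball 0 \<rho>" using inA by fastforce
          show "\<forall>i\<in>\<Gamma>' \<inter> cball 0 \<rho> - (\<lambda>r. - p - r) ` A. \<delta> i c = 0"
          proof
            fix i assume i: "i \<in> \<Gamma>' \<inter> cball 0 \<rho> - (\<lambda>r. - p - r) ` A"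
            have "- p - i \<notin> A"
            proof
              assume "- p - i \<in> A"
              then have "- p - (- p - i) \<in> (\<lambda>r. - p - r) ` A" by (rule imageI)
              then show False using i by simp
            qed
            then show "\<delta> i c = 0" by (simp add: \<delta>_def)
          qed
        qed (rule lf')
        also have "\<dots> = (\<Sum>r\<in>A. \<delta> (- p - r) c)"
          by (subst sum.reindex) (auto simp: inj_on_def)
        also have "\<dots> = 0"
          using f3[of c] by (cases "c \<in> B") (simp_all add: \<delta>_def sum_subtractf w_def e1 e2)
        finally show "(\<Sum>s\<in>\<Gamma>' \<inter> cball 0 \<rho>. \<delta> s c) = 0" .
      qed
    qed
  qed
qed

end

text \<open>For fixed \<open>c\<close> the substitution \<open>e = d \<gamma> - c\<close> moves the
  sum to a range \<open>E\<close> common to all \<open>c\<close>; there the inner sum over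
  \<open>c\<close> vanishes for each \<open>e\<close>. The assumption \<open>shift\<close>
  identifies the added indices with lattice points, where \<open>supp\<close> makes the terms zero.
  In this way changes that are balanced in every matrix stay balanced when those at many points
  \<open>p\<close> are superposed.\<close>

lemma shifted_sum_zero:
  fixes f :: "'a::ab_group_add \<Rightarrow> 'a \<Rightarrow> real"
  assumes fin: "finite T" "finite \<Phi>" and d: "inj d" and T: "T \<subseteq> L"
    and zero: "\<And>y. (\<Sum>c\<in>\<Phi>. f y c) = 0"
    and supp: "\<And>\<gamma> c. \<gamma> \<in> L \<Longrightarrow> c \<in> \<Phi> \<Longrightarrow> f (z + d \<gamma> - c) c \<noteq> 0 \<Longrightarrow> \<gamma> \<in> T"
    and shift: "\<And>\<gamma> c c'. \<gamma> \<in> L \<Longrightarrow> c \<in> \<Phi> \<Longrightarrow> c' \<in> \<Phi> \<Longrightarrow> \<exists>\<gamma>'\<in>L. d \<gamma>' = d \<gamma> - c + c'"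
  shows "(\<Sum>\<gamma>\<in>T. \<Sum>c\<in>\<Phi>. f (z + d \<gamma> - c) c) = 0"
proof -
  define E where "E = (\<lambda>(\<gamma>, c). d \<gamma> - c) ` (T \<times> \<Phi>)"
  have finE: "finite E" using fin by (simp add: E_def)
  have eq: "(\<Sum>\<gamma>\<in>T. f (z + d \<gamma> - c) c) = (\<Sum>e\<in>E. f (z + e) c)" if c: "c \<in> \<Phi>" for c
  proof -
    have "(\<Sum>e\<in>E. f (z + e) c) = (\<Sum>e\<in>(\<lambda>\<gamma>. d \<gamma> - c) ` T. f (z + e) c)"
    proof (rule sum.mono_neutral_right)
      show "(\<lambda>\<gamma>. d \<gamma> - c) ` T \<subseteq> E" using c by (auto simp: E_def)
      show "\<forall>e\<in>E - (\<lambda>\<gamma>. d \<gamma> - c) ` T. f (z + e) c = 0"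
      proof
        fix e assume e: "e \<in> E - (\<lambda>\<gamma>. d \<gamma> - c) ` T"
        then obtain \<gamma>1 c1 where 1: "\<gamma>1 \<in> T" "c1 \<in> \<Phi>" "e = d \<gamma>1 - c1" by (auto simp: E_def)
        obtain \<gamma>' where g: "\<gamma>' \<in> L" "d \<gamma>' = d \<gamma>1 - c1 + c" using shift[of \<gamma>1 c1 c] 1 c T by blast
        then have eg: "e = d \<gamma>' - c" using 1 by simp
        then have "\<gamma>' \<notin> T" using e by blast
        then have "f (z + d \<gamma>' - c) c = 0" using supp[OF g(1) c] by blast
        then show "f (z + e) c = 0" by (simp add: eg add_diff_eq)
      qed
    qed (rule finE)
    also have "\<dots> = (\<Sum>\<gamma>\<in>T. f (z + (d \<gamma> - c)) c)"
      using d by (subst sum.reindex) (auto simp: inj_on_def)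
    finally show ?thesis by (simp add: algebra_simps)
  qed
  have "(\<Sum>\<gamma>\<in>T. \<Sum>c\<in>\<Phi>. f (z + d \<gamma> - c) c) = (\<Sum>c\<in>\<Phi>. \<Sum>\<gamma>\<in>T. f (z + d \<gamma> - c) c)"
    by (rule sum.swap)
  also have "\<dots> = (\<Sum>c\<in>\<Phi>. \<Sum>e\<in>E. f (z + e) c)" by (rule sum.cong) (use eq in auto)
  also have "\<dots> = (\<Sum>e\<in>E. \<Sum>c\<in>\<Phi>. f (z + e) c)" by (rule sum.swap)
  also have "\<dots> = 0" using zero by simp
  finally show ?thesis .
qed

lemma finite_positive_lower_bound:
  fixes f :: "'a \<Rightarrow> real"
  assumes "finite A" "\<And>x. x \<in> A \<Longrightarrow> 0 < f x"
  obtains e where "0 < e" "\<And>x. x \<in> A \<Longrightarrow> e \<le> f x"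
proof
  show "0 < Min (insert 1 (f ` A))" using assms by (subst Min_gr_iff) auto
  show "Min (insert 1 (f ` A)) \<le> f x" if "x \<in> A" for x using assms that by (intro Min_le) auto
qed

context lattice_pair
begin

text \<open>Only finitely many pairs matter, and since the lattices meet in \<open>0\<close> alone,
  their non-zero sums stay away from \<open>0\<close>. Two entries of one matrix in a set of
  diameter below \<open>\<epsilon>\<close> therefore lie in the same column or in columns more than
  \<open>S\<close> apart.\<close>

lemma separation:
  obtains \<epsilon> where "0 < \<epsilon>" "\<And>\<gamma> s. \<gamma> \<in> \<Gamma> \<Longrightarrow> s \<in> \<Gamma>' \<Longrightarrow> norm \<gamma> \<le> S \<Longrightarrow> norm (\<gamma> + s) < \<epsilon> \<Longrightarrow> \<gamma> = 0"
proof -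
  define A where "A = {(\<gamma>, s) \<in> (\<Gamma> \<inter> cball 0 S) \<times> (\<Gamma>' \<inter> cball 0 (S + 1)). \<gamma> + s \<noteq> 0}"
  have "finite A" by (rule finite_subset[of _ "(\<Gamma> \<inter> cball 0 S) \<times> (\<Gamma>' \<inter> cball 0 (S + 1))"]) (use lf lf' in \<open>auto simp: A_def\<close>)
  moreover have "0 < norm (fst x + snd x)" if "x \<in> A" for x using that by (auto simp: A_def)
  ultimately obtain e where e: "0 < e" "\<And>x. x \<in> A \<Longrightarrow> e \<le> norm (fst x + snd x)"
    using finite_positive_lower_bound[of A "\<lambda>x. norm (fst x + snd x)"] by metis
  show thesis
  proof (rule that[of "min e 1"])
    fix \<gamma> s assume *: "\<gamma> \<in> \<Gamma>" "s \<in> \<Gamma>'" "norm \<gamma> \<le> S" "norm (\<gamma> + s) < min e 1"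
    have "norm s \<le> norm (\<gamma> + s) + norm \<gamma>" using norm_triangle_ineq4[of "\<gamma> + s" \<gamma>] by simp
    then have "norm s \<le> S + 1" using * by linarith
    then have "\<gamma> + s = 0" using e(2)[of "(\<gamma>, s)"] * by (force simp: A_def)
    then have "\<gamma> = 0 - s" by (simp add: add_eq_0_iff2)
    then have "\<gamma> \<in> \<Gamma>'" using \<Gamma>'_diff[OF \<Gamma>'_0, of s] * by simp
    then show "\<gamma> = 0" using indep * by blast
  qed (use e in auto)
qed

text \<open>The delicate case is the third one, where no point of \<open>U\<close> carries a
  violator. Then every \<open>p\<close> in \<open>U\<close> has a repair of its own, and those for a
  whole ball are carried out at once. The ball must be so small that no entry is changed by two
  repairs and that the touched columns of each matrix are far apart.\<close>

lemma stage:
  assumes g: "good m Del Z" and U: "open U" "U \<noteq> {}"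
  obtains m' Del' Z' V where "good m' Del' Z'" "Del \<subseteq> Del'" "open V" "V \<noteq> {}" "V \<subseteq> U"
    "V \<subseteq> Del' \<or> (\<forall>p\<in>V. \<forall>m''. state m'' Del' \<longrightarrow> m'' p = 1)"
proof -
  have st: "state m Del" and opDel: "open Del" and Del: "{p. 3 * t < norm p} \<subseteq> Del"
    and DelD: "\<And>d p. d \<in> D \<Longrightarrow> d p \<in> Del \<longleftrightarrow> p \<in> Del"
    and clean: "\<And>p. p \<notin> Z \<Longrightarrow> m p = m0 p" "\<And>p. p \<notin> Z \<Longrightarrow> norm p \<le> 3 * t \<Longrightarrow> p \<notin> Del"
    and spZ: "sparse Z"
    using g by (auto simp: good_def)
  have mnn: "\<And>p. 0 \<le> m p" and mDel: "\<And>p. p \<in> Del \<Longrightarrow> m p = 0" and msum: "periodic_sum_one \<Gamma> m"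
    and mD: "\<And>d p. d \<in> D \<Longrightarrow> m (d p) = m p"
    using st by (auto simp: state_def)
  consider (far) "U \<inter> {p. 3 * t < norm p} \<noteq> {}"
    | (viol) p L L' where "p \<in> U" "hall_violator L L' Del p" "L = \<Gamma> \<and> L' = \<Gamma>' \<or> L = \<Gamma>' \<and> L' = \<Gamma>"
    | (remove) "\<And>p. p \<in> U \<Longrightarrow> norm p \<le> 3 * t \<and> \<not> hall_violator \<Gamma> \<Gamma>' Del p \<and> \<not> hall_violator \<Gamma>' \<Gamma> Del p"
    by (cases "U \<inter> {p. 3 * t < norm p} = {}"; cases "\<exists>p\<in>U. hall_violator \<Gamma> \<Gamma>' Del p \<or> hall_violator \<Gamma>' \<Gamma> Del p")
      (auto simp: disjoint_iff not_less)
  then show thesis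
  proof cases
    case far
    have "open {p :: 'a. 3 * t < norm p}" by (intro open_Collect_less continuous_intros)
    then show ?thesis
      using that[OF g, of "U \<inter> {p. 3 * t < norm p}"] far U Del by blast
  next
    case viol
    have lfL: "finite (L \<inter> cball x r)" "finite (L' \<inter> cball x r)" "0 \<in> L" for x r
      using viol(3) lf lf' \<Gamma>_0 \<Gamma>'_0 by auto
    obtain e where e: "e > 0" "\<forall>p'\<in>ball p e. hall_violator L L' Del p'"
      using hall_violator_open[OF lfL(1) Del opDel viol(2)] by blast
    have f: "m'' q = 1" if "q \<in> ball p e" and s: "state m'' Del" for q m''
    proof (rule hall_violator_forces[where L = L and L' = L' and Del = Del and R = "3 * t"])
      show "periodic_sum_one L m''" "periodic_sum_one L' m''"
        using s state_sum'[OF s] viol(3) by (auto simp: state_def)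
      show "hall_violator L L' Del q" using e that by blast
    qed (use s lfL Del in \<open>auto simp: state_def\<close>)
    show ?thesis
    proof (rule that[OF g, of "ball p e \<inter> U"])
      have "p \<in> ball p e \<inter> U" using viol(1) e(1) by simp
      then show "ball p e \<inter> U \<noteq> {}" by blast
    qed (use U f in auto)
  next
    case remove
    have "\<exists>\<rho>\<ge>0. \<forall>p. norm p \<le> 3 * t \<longrightarrow> \<not> hall_violator \<Gamma> \<Gamma>' Del p \<longrightarrow> \<not> hall_violator \<Gamma>' \<Gamma> Del p \<longrightarrow>
      (\<exists>\<delta>. (\<forall>s c. \<delta> s c \<noteq> 0 \<longrightarrow> s \<in> \<Gamma>' \<inter> cball 0 \<rho> \<and> c \<in> \<Gamma> \<inter> cball 0 \<rho> \<and> p + s + c \<notin> Del) \<and>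
       (\<forall>s\<in>\<Gamma>'. \<forall>c\<in>\<Gamma>. 0 \<le> m (p + s + c) + \<delta> s c) \<and> \<delta> 0 0 = - m p \<and>
       (\<forall>s. (\<Sum>c\<in>\<Gamma> \<inter> cball 0 \<rho>. \<delta> s c) = 0) \<and> (\<forall>c. (\<Sum>s\<in>\<Gamma>' \<inter> cball 0 \<rho>. \<delta> s c) = 0))"
      by (rule local_removal[OF g]) blast
    then obtain \<rho> where \<rho>: "0 \<le> \<rho>" and ex: "\<And>p. norm p \<le> 3 * t \<Longrightarrow> \<not> hall_violator \<Gamma> \<Gamma>' Del p \<Longrightarrow> \<not> hall_violator \<Gamma>' \<Gamma> Del p \<Longrightarrow>
      (\<exists>\<delta>. (\<forall>s c. \<delta> s c \<noteq> 0 \<longrightarrow> s \<in> \<Gamma>' \<inter> cball 0 \<rho> \<and> c \<in> \<Gamma> \<inter> cball 0 \<rho> \<and> p + s + c \<notin> Del) \<and>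
       (\<forall>s\<in>\<Gamma>'. \<forall>c\<in>\<Gamma>. 0 \<le> m (p + s + c) + \<delta> s c) \<and> \<delta> 0 0 = - m p \<and>
       (\<forall>s. (\<Sum>c\<in>\<Gamma> \<inter> cball 0 \<rho>. \<delta> s c) = 0) \<and> (\<forall>c. (\<Sum>s\<in>\<Gamma>' \<inter> cball 0 \<rho>. \<delta> s c) = 0))"
      by blast
    define \<Phi>s where "\<Phi>s = \<Gamma>' \<inter> cball 0 \<rho>"
    define \<Phi>c where "\<Phi>c = \<Gamma> \<inter> cball 0 \<rho>"
    have finPhi: "finite \<Phi>s" "finite \<Phi>c" using lf lf' by (auto simp: \<Phi>s_def \<Phi>c_def)
    have zPhi: "0 \<in> \<Phi>s" "0 \<in> \<Phi>c" using \<Gamma>_0 \<Gamma>'_0 \<rho> by (auto simp: \<Phi>s_def \<Phi>c_def)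
    define P where "P p \<delta> \<longleftrightarrow> (\<forall>s c. \<delta> s c \<noteq> 0 \<longrightarrow> p + s + c \<notin> Del) \<and>
       (\<forall>s\<in>\<Gamma>'. \<forall>c\<in>\<Gamma>. 0 \<le> m (p + s + c) + \<delta> s c) \<and> \<delta> 0 0 = - m p \<and>
       (\<forall>s. (\<Sum>c\<in>\<Phi>c. \<delta> s c) = 0) \<and> (\<forall>c. (\<Sum>s\<in>\<Phi>s. \<delta> s c) = 0)" for p :: 'a and \<delta> :: "'a \<Rightarrow> 'a \<Rightarrow> real"
    have "\<exists>\<delta>. P p \<delta>" if p: "p \<in> U" for p
    proof -
      obtain \<delta> where "\<forall>s c. \<delta> s c \<noteq> 0 \<longrightarrow> s \<in> \<Gamma>' \<inter> cball 0 \<rho> \<and> c \<in> \<Gamma> \<inter> cball 0 \<rho> \<and> p + s + c \<notin> Del"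
       "\<forall>s\<in>\<Gamma>'. \<forall>c\<in>\<Gamma>. 0 \<le> m (p + s + c) + \<delta> s c" "\<delta> 0 0 = - m p"
       "\<forall>s. (\<Sum>c\<in>\<Phi>c. \<delta> s c) = 0" "\<forall>c. (\<Sum>s\<in>\<Phi>s. \<delta> s c) = 0"
        using ex[of p] remove[OF p] unfolding \<Phi>s_def \<Phi>c_def by blast
      then show ?thesis unfolding P_def by blast
    qed
    then obtain \<delta> where \<delta>: "\<And>p. p \<in> U \<Longrightarrow> P p (\<delta> p)" by metis
    have \<delta>Del: "\<And>p s c. p \<in> U \<Longrightarrow> \<delta> p s c \<noteq> 0 \<Longrightarrow> p + s + c \<notin> Del"
      and \<delta>nn: "\<And>p s c. p \<in> U \<Longrightarrow> s \<in> \<Gamma>' \<Longrightarrow> c \<in> \<Gamma> \<Longrightarrow> 0 \<le> m (p + s + c) + \<delta> p s c"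
      and \<delta>0: "\<And>p. p \<in> U \<Longrightarrow> \<delta> p 0 0 = - m p"
      and \<delta>r: "\<And>p s. p \<in> U \<Longrightarrow> (\<Sum>c\<in>\<Phi>c. \<delta> p s c) = 0"
      and \<delta>c: "\<And>p c. p \<in> U \<Longrightarrow> (\<Sum>s\<in>\<Phi>s. \<delta> p s c) = 0"
      using \<delta> unfolding P_def by blast+
    define J where "J = D \<times> \<Phi>s \<times> \<Phi>c"
    have finJ: "finite J" using finD finPhi by (simp add: J_def)
    \<comment> \<open>If two repairs change the same entry, a motion
      \<open>x \<mapsto> g x + y\<close> with \<open>g\<close> in \<open>D\<close> and
      \<open>y\<close> in the finite set \<open>\<Delta>\<close> takes one centre to the other. A
      point moved by all non-trivial motions of this kind has a neighbourhood without such
      conflicts.\<close>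
    define \<Delta> where "\<Delta> = (\<lambda>(g, s, c, s', c'). g (s + c) - s' - c') ` (D \<times> \<Phi>s \<times> \<Phi>c \<times> \<Phi>s \<times> \<Phi>c)"
    have fin\<Delta>: "finite \<Delta>" using finD finPhi by (simp add: \<Delta>_def)
    define \<Psi> where "\<Psi> = {(g, x) \<in> D \<times> \<Delta>. \<not> (g = id \<and> x = 0)}"
    have fin\<Psi>: "finite \<Psi>" by (rule finite_subset[of _ "D \<times> \<Delta>"]) (use finD fin\<Delta> in \<open>auto simp: \<Psi>_def\<close>)
    obtain x0 where x0: "x0 \<in> U" "\<And>g x. (g, x) \<in> \<Psi> \<Longrightarrow> g x0 + x \<noteq> x0"
    proof -
      \<comment> \<open>Non-zero translations fix no point; the motions with
        \<open>g \<noteq> id\<close> have null sets of fixed points.\<close>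
      define N where "N = (\<Union>y\<in>{y \<in> \<Psi>. fst y \<noteq> id}. {x. fst y x + snd y = x})"
      have "negligible N" unfolding N_def
      proof (rule negligible_Union)
        show "finite ((\<lambda>y. {x. fst y x + snd y = x}) ` {y \<in> \<Psi>. fst y \<noteq> id})" using fin\<Psi> by simp
        show "negligible T" if "T \<in> (\<lambda>y. {x. fst y x + snd y = x}) ` {y \<in> \<Psi>. fst y \<noteq> id}" for T
          using that linearD by (force simp: \<Psi>_def intro!: negligible_affine_fixed_points)
      qed
      then have "\<not> U \<subseteq> N" using U open_not_negligible negligible_subset by blast
      then obtain x where x: "x \<in> U" "x \<notin> N" by blast
      show thesis
      proof (rule that[OF x(1)])
        show "h x + y \<noteq> x" if "(h, y) \<in> \<Psi>" for h y
          using that x by (cases "h = id") (auto simp: N_def \<Psi>_def)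
      qed
    qed
    have "0 < norm (fst y x0 + snd y - x0)" if "y \<in> \<Psi>" for y using x0(2)[of "fst y" "snd y"] that by simp
    then obtain e1 where e1: "0 < e1" "\<And>y. y \<in> \<Psi> \<Longrightarrow> e1 \<le> norm (fst y x0 + snd y - x0)"
      using finite_positive_lower_bound[OF fin\<Psi>, of "\<lambda>y. norm (fst y x0 + snd y - x0)"] by metis
    obtain L where L: "\<And>x u v. (link (12 * t) (bad_cols Z x))\<^sup>*\<^sup>* u v \<Longrightarrow> dist u v \<le> L"
      using spZ unfolding sparse_def by blast
    have "0 \<le> 12 * t" using t_pos by simp
    from link_add_finitely_many_separated[OF finJ this, where 'a='a and L=L]
    obtain L' S where LS: "\<And>Y (N :: _ \<Rightarrow> 'a set). (\<forall>u v. (link (12 * t) Y)\<^sup>*\<^sup>* u v \<longrightarrow> dist u v \<le> L) \<Longrightarrow>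
      (\<forall>j\<in>J. \<forall>x\<in>N j. \<forall>y\<in>N j. dist x y \<le> S \<longrightarrow> x = y) \<Longrightarrow>
      (\<forall>u v. (link (12 * t) (Y \<union> (\<Union>j\<in>J. N j)))\<^sup>*\<^sup>* u v \<longrightarrow> dist u v \<le> L')"
      by blast
    obtain e2 where e2: "0 < e2" "\<And>\<gamma> s. \<gamma> \<in> \<Gamma> \<Longrightarrow> s \<in> \<Gamma>' \<Longrightarrow> norm \<gamma> \<le> S \<Longrightarrow> norm (\<gamma> + s) < e2 \<Longrightarrow> \<gamma> = 0"
      using separation by metis
    obtain e3 where e3: "0 < e3" "ball x0 e3 \<subseteq> U" using U x0(1) open_contains_ball by blast
    \<comment> \<open>\<open>e3\<close> keeps the ball inside \<open>U\<close>,
      \<open>e1 / 2\<close> excludes overlapping repairs, and \<open>e2 / 2\<close> separates the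
      touched columns by more than \<open>S\<close>.\<close>
    define \<epsilon> where "\<epsilon> = min e3 (min (e1 / 2) (e2 / 2))"
    have \<epsilon>: "0 < \<epsilon>" "\<epsilon> \<le> e3" "2 * \<epsilon> \<le> e1" "2 * \<epsilon> \<le> e2" using e1 e2 e3 by (auto simp: \<epsilon>_def)
    define V where "V = ball x0 \<epsilon>"
    have V: "open V" "V \<noteq> {}" "V \<subseteq> U" using \<epsilon> e3 by (auto simp: V_def)
    have Vd: "norm (x - y) < 2 * \<epsilon>" if "x \<in> V" "y \<in> V" for x y
      using that dist_triangle[of x y x0] by (simp add: V_def dist_norm norm_minus_commute)
    have uniq: "d = d' \<and> s = s' \<and> c = c'"
      if j: "(d, s, c) \<in> J" "(d', s', c') \<in> J" and v: "d q - s - c \<in> V" "d' q - s' - c' \<in> V" for d s c d' s' c' q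
    proof -
      have dD: "d \<in> D" "d' \<in> D" using j by (auto simp: J_def)
      obtain e where e: "e \<in> D" "e \<circ> d = id" using invD[OF dD(1)] by blast
      define h where "h = d' \<circ> e"
      have hD: "h \<in> D" using compD dD e by (simp add: h_def)
      have hd: "h (d x) = d' x" for x using fun_cong[OF e(2), of x] by (simp add: h_def)
      define p where "p = d q - s - c"
      define x where "x = h (s + c) - s' - c'"
      have "x \<in> \<Delta>" unfolding \<Delta>_def x_def using hD j by (force simp: J_def)
      have "d' q = h (p + (s + c))" by (simp add: p_def hd)
      then have eq: "d' q - s' - c' = h p + x" by (simp add: x_def linear_add[OF linearD[OF hD]] algebra_simps)
      have "h = id \<and> x = 0"
      proof (rule ccontr)
        assume "\<not> (h = id \<and> x = 0)"
        then have "(h, x) \<in> \<Psi>" using hD \<open>x \<in> \<Delta>\<close> by (auto simp: \<Psi>_def)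
        then have "e1 \<le> norm (h x0 + x - x0)" using e1(2) by fastforce
        also have "h x0 + x - x0 = h (x0 - p) + (d' q - s' - c' - x0)"
          by (simp add: eq linear_diff[OF linearD[OF hD]])
        also have "norm \<dots> \<le> norm (h (x0 - p)) + norm (d' q - s' - c' - x0)" by (rule norm_triangle_ineq)
        also have "\<dots> < \<epsilon> + \<epsilon>"
        proof (rule add_strict_mono)
          show "norm (h (x0 - p)) < \<epsilon>" unfolding normD[OF hD] using v by (simp add: V_def p_def dist_norm)
          show "norm (d' q - s' - c' - x0) < \<epsilon>" using v by (simp add: V_def dist_norm norm_minus_commute)
        qed
        finally show False using \<epsilon> by simp
      qed
      then have hx: "h = id" "x = 0" by auto
      have "d' = d" using hd hx by auto
      \<comment> \<open>Once the motion is trivial, this difference lies in both lattices and hence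
        is zero.\<close>
      have "s - s' = c' - c" using hx by (simp add: x_def algebra_simps)
      moreover have "s - s' \<in> \<Gamma>'" "c' - c \<in> \<Gamma>" using j \<Gamma>_diff \<Gamma>'_diff by (auto simp: J_def \<Phi>s_def \<Phi>c_def)
      ultimately have "s - s' \<in> \<Gamma> \<inter> \<Gamma>'" by simp
      then have "s = s'" using indep by simp
      then show ?thesis using \<open>s - s' = c' - c\<close> \<open>d' = d\<close> by simp
    qed
    \<comment> \<open>The change at \<open>y\<close> due to the repair centred at
      \<open>y - s - c\<close>, in which \<open>y\<close> has the relative position
      \<open>(s, c)\<close>. Summation over \<open>D\<close> in \<open>m'\<close> restores the
      symmetry.\<close>
    define tm where "tm s c y = (if y - s - c \<in> V then \<delta> (y - s - c) s c else 0)" for s c y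
    define A where "A y = (\<Sum>s\<in>\<Phi>s. \<Sum>c\<in>\<Phi>c. tm s c y)" for y
    define m' where "m' q = m q + (\<Sum>d\<in>D. A (d q))" for q
    define Del' where "Del' = Del \<union> {q. \<exists>d\<in>D. d q \<in> V}"
    define Z' where "Z' = Z \<union> (\<Union>j\<in>J. {q. fst j q - fst (snd j) - snd (snd j) \<in> V})"
    have tmDel: "y \<notin> Del" if "tm s c y \<noteq> 0" for s c y
    proof -
      have "y - s - c \<in> U" "\<delta> (y - s - c) s c \<noteq> 0" using that V by (auto simp: tm_def split: if_splits)
      then show ?thesis using \<delta>Del[of "y - s - c" s c] by simp
    qed
    have m'J: "m' q = m q + (\<Sum>(d, s, c)\<in>J. tm s c (d q))" for q
      unfolding m'_def A_def J_def by (simp add: sum.cartesian_product)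
    have single: "m' q = m q + tm s c (d q)" if j: "(d, s, c) \<in> J" and v: "d q - s - c \<in> V" for d s c q
    proof -
      have "(\<Sum>(d, s, c)\<in>J. tm s c (d q)) = (\<Sum>(d, s, c)\<in>{(d, s, c)}. tm s c (d q))"
      proof (rule sum.mono_neutral_right)
        show "\<forall>i\<in>J - {(d, s, c)}. (case i of (d, s, c) \<Rightarrow> tm s c (d q)) = 0"
        proof
          fix i assume "i \<in> J - {(d, s, c)}"
          then obtain d' s' c' where i: "i = (d', s', c')" "(d', s', c') \<in> J" "(d', s', c') \<noteq> (d, s, c)"
            by (cases i) auto
          then have "d' q - s' - c' \<notin> V" using uniq[OF i(2) j _ v] by blast
          then show "(case i of (d, s, c) \<Rightarrow> tm s c (d q)) = 0" by (simp add: tm_def i(1))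
        qed
      qed (use finJ j in auto)
      then show ?thesis by (simp add: m'J)
    qed
    have none: "m' q = m q" if "\<And>d s c. (d, s, c) \<in> J \<Longrightarrow> d q - s - c \<notin> V" for q
      using that unfolding m'J by (auto simp: tm_def intro!: sum.neutral)
    have m'nn: "0 \<le> m' q" for q
    proof (cases "\<exists>d s c. (d, s, c) \<in> J \<and> d q - s - c \<in> V")
      case True
      then obtain d s c where j: "(d, s, c) \<in> J" "d q - s - c \<in> V" by blast
      then have "m' q = m (d q) + \<delta> (d q - s - c) s c"
        using single[OF j] mD by (simp add: tm_def J_def)
      then show ?thesis using \<delta>nn[of "d q - s - c" s c] j V by (auto simp: J_def \<Phi>s_def \<Phi>c_def)
    next
      case False then show ?thesis using none mnn by metis
    qed
    have m'Del: "m' q = 0" if q: "q \<in> Del'" for q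
    proof -
      have "m' q = 0" if "q \<in> Del"
      proof -
        have "tm s c (d q) = 0" if "d \<in> D" for s c d
          using tmDel[of s c "d q"] DelD[OF that] \<open>q \<in> Del\<close> by blast
        then show ?thesis using mDel[OF \<open>q \<in> Del\<close>] by (simp add: m'_def A_def)
      qed
      moreover have "m' q = 0" if "d \<in> D" "d q \<in> V" for d
      proof -
        have j: "(d, 0, 0) \<in> J" using that zPhi by (simp add: J_def)
        have "m' q = m q + tm 0 0 (d q)" using single[OF j] that by simp
        also have "\<dots> = 0" using that \<delta>0[of "d q"] V mD by (auto simp: tm_def)
        finally show ?thesis .
      qed
      ultimately show ?thesis using q by (auto simp: Del'_def)
    qed
    have m'D: "m' (e q) = m' q" if e: "e \<in> D" for e q
    proof -
      obtain e' where e': "e' \<in> D" "e' \<circ> e = id" "e \<circ> e' = id" using invD[OF e] by blast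
      have b: "bij_betw (\<lambda>d. d \<circ> e) D D"
        by (rule bij_betw_byWitness[where f' = "\<lambda>d. d \<circ> e'"])
          (use e e' compD in \<open>auto simp: o_assoc[symmetric]\<close>)
      have "(\<Sum>d\<in>D. A (d (e q))) = (\<Sum>d\<in>D. A ((d \<circ> e) q))" by simp
      also have "\<dots> = (\<Sum>d\<in>D. A (d q))" by (rule sum.reindex_bij_betw[OF b])
      finally show ?thesis using mD[OF e] by (simp add: m'_def)
    qed
    have Del'sub: "Del \<subseteq> Del'" "V \<subseteq> Del'" using idD by (auto simp: Del'_def intro!: bexI[of _ id])
    have m'sum: "periodic_sum_one \<Gamma> m'"
    proof (rule periodic_sum_oneI)
      fix q
      define T where "T = \<Gamma> \<inter> cball (- q) (3 * t)"
      have finT: "finite T" using lf by (simp add: T_def)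
      have inT: "\<gamma> \<in> T" if "\<gamma> \<in> \<Gamma>" "q + \<gamma> \<notin> Del" for \<gamma>
        using that Del by (force simp: T_def dist_minus_left)
      have Asum: "(\<Sum>\<gamma>\<in>T. A (d (q + \<gamma>))) = 0" if d: "d \<in> D" for d
      proof -
        have dadd: "d (q + \<gamma>) = d q + d \<gamma>" for \<gamma> by (rule linear_add[OF linearD[OF d]])
        have inj: "inj d" using bijD[OF d] by (rule bij_is_inj)
        have supp: "\<gamma> \<in> T" if "\<gamma> \<in> \<Gamma>" "tm s c (d q + d \<gamma>) \<noteq> 0" for \<gamma> s c
          using inT[OF that(1)] tmDel[OF that(2)] DelD[OF d, of "q + \<gamma>"] by (simp add: dadd)
        \<comment> \<open>If \<open>d\<close> preserves \<open>\<Gamma>\<close>, the sum runs along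
          rows and the row balance of \<open>\<delta>\<close> applies; if \<open>d\<close> exchanges
          the lattices, the column balance does.\<close>
        show ?thesis
        proof (cases "d ` \<Gamma> = \<Gamma>")
          case True
          have "(\<Sum>\<gamma>\<in>T. \<Sum>c\<in>\<Phi>c. tm s c (d q + d \<gamma>)) = 0" for s
          proof -
            define f where "f y c = (if y - s \<in> V then \<delta> (y - s) s c else 0)" for y c
            have f: "f (d q + d \<gamma> - c) c = tm s c (d q + d \<gamma>)" for \<gamma> c
              by (simp add: f_def tm_def algebra_simps)
            have "(\<Sum>\<gamma>\<in>T. \<Sum>c\<in>\<Phi>c. f (d q + d \<gamma> - c) c) = 0"
            proof (rule shifted_sum_zero[where L = \<Gamma>])
              show "(\<Sum>c\<in>\<Phi>c. f y c) = 0" for y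
                using \<delta>r[of "y - s"] V by (cases "y - s \<in> V") (auto simp: f_def)
              show "\<exists>\<gamma>'\<in>\<Gamma>. d \<gamma>' = d \<gamma> - c + c'" if "\<gamma> \<in> \<Gamma>" "c \<in> \<Phi>c" "c' \<in> \<Phi>c" for \<gamma> c c'
              proof -
                have "d \<gamma> \<in> \<Gamma>" using True that by blast
                then have "d \<gamma> - (c - c') \<in> \<Gamma>" using that \<Gamma>_diff by (auto simp: \<Phi>c_def)
                then have "d \<gamma> - c + c' \<in> d ` \<Gamma>" using True by (simp add: algebra_simps)
                then show ?thesis by force
              qed
            qed (use finT finPhi inj supp f in \<open>auto simp: T_def\<close>)
            then show ?thesis by (simp add: f)
          qed
          then have "(\<Sum>s\<in>\<Phi>s. \<Sum>\<gamma>\<in>T. \<Sum>c\<in>\<Phi>c. tm s c (d q + d \<gamma>)) = 0" by simp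
          then show ?thesis unfolding A_def dadd by (subst sum.swap)
        next
          case False
          then have dG: "d ` \<Gamma> = \<Gamma>'" using actD[OF d] by blast
          have "(\<Sum>\<gamma>\<in>T. \<Sum>s\<in>\<Phi>s. tm s c (d q + d \<gamma>)) = 0" for c
          proof -
            define f where "f y s = (if y - c \<in> V then \<delta> (y - c) s c else 0)" for y s
            have f: "f (d q + d \<gamma> - s) s = tm s c (d q + d \<gamma>)" for \<gamma> s
              by (simp add: f_def tm_def)
            have "(\<Sum>\<gamma>\<in>T. \<Sum>s\<in>\<Phi>s. f (d q + d \<gamma> - s) s) = 0"
            proof (rule shifted_sum_zero[where L = \<Gamma>])
              show "(\<Sum>s\<in>\<Phi>s. f y s) = 0" for y
                using \<delta>c[of "y - c"] V by (cases "y - c \<in> V") (auto simp: f_def)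
              show "\<exists>\<gamma>'\<in>\<Gamma>. d \<gamma>' = d \<gamma> - s + s'" if "\<gamma> \<in> \<Gamma>" "s \<in> \<Phi>s" "s' \<in> \<Phi>s" for \<gamma> s s'
              proof -
                have "d \<gamma> \<in> \<Gamma>'" using dG that by blast
                then have "d \<gamma> - (s - s') \<in> \<Gamma>'" using that \<Gamma>'_diff by (auto simp: \<Phi>s_def)
                then have "d \<gamma> - s + s' \<in> d ` \<Gamma>" using dG by (simp add: algebra_simps)
                then show ?thesis by force
              qed
            qed (use finT finPhi inj supp f in \<open>auto simp: T_def\<close>)
            then show ?thesis by (simp add: f)
          qed
          then have "(\<Sum>c\<in>\<Phi>c. \<Sum>\<gamma>\<in>T. \<Sum>s\<in>\<Phi>s. tm s c (d q + d \<gamma>)) = 0" by simp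
          then have "(\<Sum>\<gamma>\<in>T. \<Sum>c\<in>\<Phi>c. \<Sum>s\<in>\<Phi>s. tm s c (d q + d \<gamma>)) = 0" by (subst sum.swap)
          moreover have "A y = (\<Sum>c\<in>\<Phi>c. \<Sum>s\<in>\<Phi>s. tm s c y)" for y unfolding A_def by (rule sum.swap)
          ultimately show ?thesis by (simp add: dadd)
        qed
      qed
      have "(\<Sum>\<gamma>\<in>T. m (q + \<gamma>)) = 1"
        by (rule periodic_sum_oneD[OF msum finT]) (use inT mDel in \<open>auto simp: T_def\<close>)
      moreover have "(\<Sum>\<gamma>\<in>T. \<Sum>d\<in>D. A (d (q + \<gamma>))) = 0"
        by (subst sum.swap) (simp add: Asum)
      ultimately have "(\<Sum>\<gamma>\<in>T. m' (q + \<gamma>)) = 1" by (simp add: m'_def sum.distrib)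
      moreover have "\<gamma> \<in> T" if "\<gamma> \<in> \<Gamma>" "m' (q + \<gamma>) \<noteq> 0" for \<gamma>
        using inT m'Del Del'sub that by blast
      ultimately show "\<exists>T. finite T \<and> T \<subseteq> \<Gamma> \<and> (\<forall>\<gamma>\<in>\<Gamma>. m' (q + \<gamma>) \<noteq> 0 \<longrightarrow> \<gamma> \<in> T) \<and> (\<Sum>\<gamma>\<in>T. m' (q + \<gamma>)) = 1"
        using finT by (intro exI[of _ T]) (auto simp: T_def)
    qed
    have "state m' Del'" using m'nn m'Del m'D m'sum by (simp add: state_def)
    moreover have "open Del'"
    proof -
      have "open (\<Union>d\<in>D. d -` V)"
      proof (intro open_UN ballI open_vimage)
        fix d assume "d \<in> D"
        then have "bounded_linear d" using linearD linear_conv_bounded_linear by blast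
        then show "continuous_on UNIV d" by (rule linear_continuous_on)
      qed (rule V)
      moreover have "{q. \<exists>d\<in>D. d q \<in> V} = (\<Union>d\<in>D. d -` V)" by auto
      ultimately show ?thesis using opDel by (auto simp: Del'_def)
    qed
    moreover have "e q \<in> Del' \<longleftrightarrow> q \<in> Del'" if e: "e \<in> D" for e q
    proof -
      obtain e' where e': "e' \<in> D" "e' \<circ> e = id" "e \<circ> e' = id" using invD[OF e] by blast
      have "(\<exists>d\<in>D. d (e q) \<in> V) \<longleftrightarrow> (\<exists>d\<in>D. d q \<in> V)"
      proof
        assume "\<exists>d\<in>D. d (e q) \<in> V"
        then obtain d where "d \<in> D" "(d \<circ> e) q \<in> V" by auto
        then show "\<exists>d\<in>D. d q \<in> V" using compD e by blast
      next
        assume "\<exists>d\<in>D. d q \<in> V"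
        then obtain d where d: "d \<in> D" "d q \<in> V" by auto
        have "e' (e q) = q" using fun_cong[OF e'(2), of q] by simp
        then show "\<exists>d\<in>D. d (e q) \<in> V"
          using compD[OF d(1) e'(1)] d(2) by (intro bexI[of _ "d \<circ> e'"]) simp_all
      qed
      then show ?thesis using DelD[OF e] by (auto simp: Del'_def)
    qed
    moreover have "m' q = m0 q \<and> (norm q \<le> 3 * t \<longrightarrow> q \<notin> Del')" if q: "q \<notin> Z'" for q
    proof -
      have no: "d q - s - c \<notin> V" if "(d, s, c) \<in> J" for d s c using q that by (force simp: Z'_def)
      have "d q \<notin> V" if "d \<in> D" for d using no[of d 0 0] that zPhi by (auto simp: J_def)
      moreover have "m' q = m q" by (rule none) (rule no)
      moreover have "q \<notin> Z" using q by (simp add: Z'_def)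
      ultimately show ?thesis using clean by (auto simp: Del'_def)
    qed
    moreover have "sparse Z'"
    proof -
      have eq: "bad_cols Z' x = bad_cols Z x \<union> (\<Union>j\<in>J. bad_cols {q. fst j q - fst (snd j) - snd (snd j) \<in> V} x)" for x
        unfolding Z'_def bad_cols_def by blast
      have "\<gamma>1 = \<gamma>2" if j: "(d, s, c) \<in> J" and b: "\<gamma>1 \<in> bad_cols {q. d q - s - c \<in> V} x" "\<gamma>2 \<in> bad_cols {q. d q - s - c \<in> V} x"
        and S: "dist \<gamma>1 \<gamma>2 \<le> S" for d s c x \<gamma>1 \<gamma>2
      proof -
        have dD: "d \<in> D" using j by (simp add: J_def)
        obtain s1 s2 where s: "s1 \<in> \<Gamma>'" "s2 \<in> \<Gamma>'" "d (x + s1 + \<gamma>1) - s - c \<in> V" "d (x + s2 + \<gamma>2) - s - c \<in> V"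
          and \<gamma>: "\<gamma>1 \<in> \<Gamma>" "\<gamma>2 \<in> \<Gamma>"
          using b by (auto simp: bad_cols_def)
        have "norm ((d (x + s1 + \<gamma>1) - s - c) - (d (x + s2 + \<gamma>2) - s - c)) < 2 * \<epsilon>" using Vd s by blast
        also have "(d (x + s1 + \<gamma>1) - s - c) - (d (x + s2 + \<gamma>2) - s - c) = d ((\<gamma>1 - \<gamma>2) + (s1 - s2))"
          by (simp add: linear_add[OF linearD[OF dD]] linear_diff[OF linearD[OF dD]])
        finally have "norm ((\<gamma>1 - \<gamma>2) + (s1 - s2)) < e2" using normD[OF dD] \<epsilon> by simp
        then have "\<gamma>1 - \<gamma>2 = 0"
          using \<Gamma>_diff \<Gamma>'_diff \<gamma> s S by (intro e2(2)[of "\<gamma>1 - \<gamma>2" "s1 - s2"]) (auto simp: dist_norm)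
        then show ?thesis by simp
      qed
      then have "\<forall>j\<in>J. \<forall>u\<in>bad_cols {q. fst j q - fst (snd j) - snd (snd j) \<in> V} x.
          \<forall>v\<in>bad_cols {q. fst j q - fst (snd j) - snd (snd j) \<in> V} x. dist u v \<le> S \<longrightarrow> u = v" for x
        by (intro ballI impI) (metis prod.collapse)
      then have "\<forall>u v. (link (12 * t) (bad_cols Z' x))\<^sup>*\<^sup>* u v \<longrightarrow> dist u v \<le> L'" for x
        unfolding eq by (intro LS) (use L in blast)+
      then show ?thesis unfolding sparse_def by blast
    qed
    ultimately have "good m' Del' Z'"
      using Del Del'sub by (auto simp: good_def)
    then show ?thesis using that Del'sub V by blast
  qed
qed

end

section \<open>The set forced by the deletion process\<close>

context lattice_pair
begin

lemma good_initial: "good m0 {p. 3 * t < norm p} {}"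
proof -
  have "(link (12 * t) {})\<^sup>*\<^sup>* u v \<Longrightarrow> u = v" for u v :: 'a
    by (induction rule: rtranclp_induct) (auto simp: link_def)
  then have "sparse {}" unfolding sparse_def bad_cols_def by (intro exI[of _ 0]) auto
  moreover have "m0 p = 0" if "3 * t < norm p" for p
    using m0_supp[of p] that t \<kappa> R0 by force
  moreover have "open {p :: 'a. 3 * t < norm p}" by (intro open_Collect_less continuous_intros)
  ultimately show ?thesis
    using m0_nonneg m0_D m0_sum normD by (auto simp: good_def state_def)
qed

text \<open>A set is decided if it is deleted, or if all remaining states equal one on it; both are
  inherited by later stages, as deleting more leaves fewer states. Two congruent points of
  \<open>I\<close> would make a coset sum at least two. For density, all relevant translates of a
  small open set are decided at a common stage; a coset sum equal to one then exhibits a translate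
  that is not deleted and so is forced.\<close>

theorem invariant_open_transversal:
  obtains I where "open I" "bounded I" "\<And>d p. d \<in> D \<Longrightarrow> p \<in> I \<Longrightarrow> d p \<in> I"
    "\<And>x y. x \<in> I \<Longrightarrow> y \<in> I \<Longrightarrow> x - y \<in> \<Gamma> \<Longrightarrow> x = y"
    "\<And>W. open W \<Longrightarrow> W \<noteq> {} \<Longrightarrow> \<exists>p\<in>W. \<exists>\<gamma>\<in>\<Gamma>. p + \<gamma> \<in> I"
proof -
  obtain B :: "nat \<Rightarrow> 'a set" where "inj B" and opB: "\<And>n. open (B n)"
    and basis: "\<And>S. open S \<Longrightarrow> \<exists>k. S = \<Union> {B n |n. n \<in> k}"
    by (rule univ_second_countable_sequence) blast
  define decided where "decided W Del \<longleftrightarrow> W \<subseteq> Del \<or> (\<forall>p\<in>W. \<forall>m. state m Del \<longrightarrow> m p = 1)" for W Del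
  define step where "step n s s' \<longleftrightarrow> fst (snd s) \<subseteq> fst (snd s') \<and>
      (B n \<noteq> {} \<longrightarrow> (\<exists>V. open V \<and> V \<noteq> {} \<and> V \<subseteq> B n \<and> decided V (fst (snd s'))))"
    for n and s s' :: "('a \<Rightarrow> real) \<times> 'a set \<times> 'a set"
  have "\<exists>f. \<forall>n. good (fst (f n)) (fst (snd (f n))) (snd (snd (f n))) \<and> step n (f n) (f (Suc n))"
  proof (rule dependent_nat_choice)
    show "\<exists>x. good (fst x) (fst (snd x)) (snd (snd x))"
      using good_initial by (intro exI[of _ "(m0, {p. 3 * t < norm p}, {})"]) simp
  next
    fix x n assume g: "good (fst x) (fst (snd x)) (snd (snd x))"
    show "\<exists>y. good (fst y) (fst (snd y)) (snd (snd y)) \<and> step n x y"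
    proof (cases "B n = {}")
      case True
      then show ?thesis using g by (intro exI[of _ x]) (simp add: step_def)
    next
      case False
      show ?thesis
      proof (rule stage[OF g opB False])
        fix m' Del' Z' V
        assume a: "good m' Del' Z'" "fst (snd x) \<subseteq> Del'" "open V" "V \<noteq> {}" "V \<subseteq> B n"
          "V \<subseteq> Del' \<or> (\<forall>p\<in>V. \<forall>m''. state m'' Del' \<longrightarrow> m'' p = 1)"
        then show ?thesis
          by (intro exI[of _ "(m', Del', Z')"]) (auto simp: step_def decided_def)
      qed
    qed
  qed
  then obtain f where f: "\<And>n. good (fst (f n)) (fst (snd (f n))) (snd (snd (f n)))" "\<And>n. step n (f n) (f (Suc n))"
    by blast
  define M where "M n = fst (f n)" for n
  define E where "E n = fst (snd (f n))" for n
  have st: "state (M n) (E n)" and far: "{p. 3 * t < norm p} \<subseteq> E n" for n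
    using f(1)[of n] by (auto simp: good_def M_def E_def)
  have mono: "E n \<subseteq> E k" if "n \<le> k" for n k
    by (rule lift_Suc_mono_le[of E, OF _ that]) (use f(2) in \<open>auto simp: step_def E_def\<close>)
  have state_mono: "state m (E n)" if "n \<le> k" "state m (E k)" for m n k
    using that mono[OF that(1)] by (auto simp: state_def)
  have Mnn: "\<And>n p. 0 \<le> M n p" and ME: "\<And>n p. p \<in> E n \<Longrightarrow> M n p = 0" and Msum: "\<And>n. periodic_sum_one \<Gamma> (M n)"
    using st by (auto simp: state_def)
  define forced where "forced n = {p. \<forall>m. state m (E n) \<longrightarrow> m p = 1}" for n
  have forced_mono: "forced n \<subseteq> forced k" if "n \<le> k" for n k
    using state_mono[OF that] by (auto simp: forced_def)
  have M1: "M n p = 1" if "p \<in> forced n" for n p using that st by (auto simp: forced_def)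
  have dec: "decided W (E n) \<longleftrightarrow> W \<subseteq> E n \<or> W \<subseteq> forced n" for W n
    by (auto simp: decided_def forced_def)
  have dec_mono: "decided W (E k)" if "decided W (E n)" "n \<le> k" for W n k
    using that mono[of n k] forced_mono[of n k] by (auto simp: dec)
  have decide: "\<exists>V n. open V \<and> V \<noteq> {} \<and> V \<subseteq> W \<and> decided V (E n)" if W: "open W" "W \<noteq> {}" for W
  proof -
    obtain k where k: "W = \<Union> {B n |n. n \<in> k}" using basis[OF W(1)] by blast
    then obtain n where n: "B n \<noteq> {}" "B n \<subseteq> W" using W(2) by blast
    then obtain V where "open V" "V \<noteq> {}" "V \<subseteq> B n" "decided V (E (Suc n))"
      using f(2)[of n] by (auto simp: step_def E_def)
    then show ?thesis using n by blast
  qed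
  define I where "I = (\<Union>n. interior (forced n))"
  have I_forced: "\<exists>n. p \<in> forced n" if "p \<in> I" for p
    using that interior_subset by (fastforce simp: I_def)
  show thesis
  proof
    show "open I" by (auto simp: I_def)
    show "bounded I"
    proof (rule bounded_subset[OF bounded_cball])
      show "I \<subseteq> cball 0 (3 * t)"
      proof
        fix p assume "p \<in> I"
        then obtain n where "M n p = 1" using I_forced M1 by blast
        then have "p \<notin> E n" using ME by force
        then show "p \<in> cball 0 (3 * t)" using far[of n] by force
      qed
    qed
    show "d p \<in> I" if d: "d \<in> D" and p: "p \<in> I" for d p
    proof -
      obtain n where n: "p \<in> interior (forced n)" using p by (auto simp: I_def)
      obtain e where e: "e \<in> D" "e \<circ> d = id" using invD[OF d] by blast
      have "bounded_linear e" using linearD[OF e(1)] linear_conv_bounded_linear by blast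
      then have "open (e -` interior (forced n))" by (intro open_vimage linear_continuous_on) auto
      moreover have "d p \<in> e -` interior (forced n)" using fun_cong[OF e(2), of p] n by simp
      moreover have "e -` interior (forced n) \<subseteq> forced n"
      proof
        fix x assume "x \<in> e -` interior (forced n)"
        then have "e x \<in> forced n" using interior_subset by blast
        then show "x \<in> forced n" using e(1) by (auto simp: forced_def state_def)
      qed
      ultimately have "d p \<in> interior (forced n)" by (meson interiorI)
      then show ?thesis by (auto simp: I_def)
    qed
    show "x = y" if xy: "x \<in> I" "y \<in> I" "x - y \<in> \<Gamma>" for x y
    proof (rule ccontr)
      assume "x \<noteq> y"
      obtain n k where nk: "x \<in> forced n" "y \<in> forced k" using xy I_forced by blast
      define N where "N = max n k"
      have one: "M N x = 1" "M N y = 1"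
        using nk forced_mono[of n N] forced_mono[of k N] M1 by (auto simp: N_def)
      have "(\<Sum>\<gamma>\<in>{0, x - y}. M N (y + \<gamma>)) \<le> 1"
      proof (rule periodic_sum_one_le[OF Msum Mnn _ lf])
        show "norm p \<le> 3 * t" if "M N p \<noteq> 0" for p using that ME[of p N] far[of N] by force
      qed (use \<Gamma>_0 xy in auto)
      then show False using one \<open>x \<noteq> y\<close> by simp
    qed
    show "\<exists>p\<in>W. \<exists>\<gamma>\<in>\<Gamma>. p + \<gamma> \<in> I" if W: "open W" "W \<noteq> {}" for W
    proof -
      obtain x0 where x0: "x0 \<in> W" using W by blast
      \<comment> \<open>For points of \<open>ball x0 1\<close> all other translates have norm above
        \<open>3 * t\<close> and are deleted from the start, so only finitely many have to be
        decided.\<close>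
      define \<Phi> where "\<Phi> = \<Gamma> \<inter> cball 0 (3 * t + norm x0 + 1)"
      have "finite \<Phi>" using lf by (simp add: \<Phi>_def)
      then have "\<exists>W' n. open W' \<and> W' \<noteq> {} \<and> W' \<subseteq> W \<inter> ball x0 1 \<and> (\<forall>\<gamma>\<in>\<Phi>. decided ((\<lambda>p. p + \<gamma>) ` W') (E n))"
      proof (induction \<Phi> rule: finite_induct)
        case empty
        have "x0 \<in> W \<inter> ball x0 1" using x0 by simp
        then show ?case using W by (intro exI[of _ "W \<inter> ball x0 1"]) auto
      next
        case (insert \<gamma> F)
        then obtain W' n where W': "open W'" "W' \<noteq> {}" "W' \<subseteq> W \<inter> ball x0 1" "\<forall>\<gamma>\<in>F. decided ((\<lambda>p. p + \<gamma>) ` W') (E n)"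
          by blast
        have "open ((\<lambda>p. p + \<gamma>) ` W')" using open_translation[OF W'(1), of \<gamma>] by (simp add: add.commute)
        then obtain V k where V: "open V" "V \<noteq> {}" "V \<subseteq> (\<lambda>p. p + \<gamma>) ` W'" "decided V (E k)"
          using decide[of "(\<lambda>p. p + \<gamma>) ` W'"] W'(2) by blast
        define V' where "V' = (\<lambda>p. p - \<gamma>) ` V"
        have V'V: "(\<lambda>p. p + \<gamma>) ` V' = V" by (simp add: V'_def image_image)
        have "open V'" using open_translation_subtract[OF V(1), of \<gamma>] by (simp add: V'_def)
        moreover have "V' \<noteq> {}" using V by (simp add: V'_def)
        moreover have sub: "V' \<subseteq> W'" using V(3) by (auto simp: V'_def)
        moreover have "decided ((\<lambda>p. p + \<beta>) ` V') (E (max n k))" if "\<beta> \<in> insert \<gamma> F" for \<beta>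
        proof (cases "\<beta> = \<gamma>")
          case True
          then show ?thesis using dec_mono[OF V(4), of "max n k"] V'V by simp
        next
          case False
          then have "decided ((\<lambda>p. p + \<beta>) ` W') (E (max n k))"
            using that W'(4) dec_mono[of _ n "max n k"] by simp
          then show ?thesis using sub unfolding dec by blast
        qed
        ultimately show ?case using W'(3) by (intro exI[of _ V'] exI[of _ "max n k"]) blast
      qed
      then obtain W' n where W': "open W'" "W' \<noteq> {}" "W' \<subseteq> W \<inter> ball x0 1"
        and dW: "\<And>\<gamma>. \<gamma> \<in> \<Phi> \<Longrightarrow> decided ((\<lambda>p. p + \<gamma>) ` W') (E n)"
        by blast
      obtain p where p: "p \<in> W'" using W'(2) by blast
      define T where "T = \<Gamma> \<inter> cball (- p) (3 * t)"
      have sum1: "(\<Sum>\<gamma>\<in>T. M n (p + \<gamma>)) = 1"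
      proof (rule periodic_sum_oneD[OF Msum])
        show "\<gamma> \<in> T" if "\<gamma> \<in> \<Gamma>" "M n (p + \<gamma>) \<noteq> 0" for \<gamma>
          using that ME[of "p + \<gamma>" n] far[of n] by (force simp: T_def dist_minus_left)
      qed (use lf in \<open>auto simp: T_def\<close>)
      have "\<exists>\<gamma>\<in>T. M n (p + \<gamma>) \<noteq> 0"
      proof (rule ccontr)
        assume "\<not> ?thesis"
        then have "(\<Sum>\<gamma>\<in>T. M n (p + \<gamma>)) = 0" by (intro sum.neutral) blast
        then show False using sum1 by simp
      qed
      then obtain \<gamma> where \<gamma>: "\<gamma> \<in> T" "M n (p + \<gamma>) \<noteq> 0" by blast
      have "norm p \<le> norm x0 + 1"
        using p W'(3) norm_triangle_ineq2[of p x0] by (auto simp: dist_norm norm_minus_commute)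
      moreover have "norm (p + \<gamma>) \<le> 3 * t" using \<gamma>(1) by (simp add: T_def dist_minus_left)
      moreover have "norm \<gamma> \<le> norm (p + \<gamma>) + norm p" using norm_triangle_ineq4[of "p + \<gamma>" p] by simp
      ultimately have "\<gamma> \<in> \<Phi>" using \<gamma>(1) by (simp add: \<Phi>_def T_def)
      then have "decided ((\<lambda>p. p + \<gamma>) ` W') (E n)" by (rule dW)
      moreover have "p + \<gamma> \<notin> E n" using \<gamma>(2) ME by blast
      ultimately have "(\<lambda>p. p + \<gamma>) ` W' \<subseteq> forced n" using p unfolding dec by blast
      moreover have "open ((\<lambda>p. p + \<gamma>) ` W')" using open_translation[OF W'(1), of \<gamma>] by (simp add: add.commute)
      ultimately have "p + \<gamma> \<in> interior (forced n)" using p by (meson interiorI imageI)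
      then have "p + \<gamma> \<in> I" by (auto simp: I_def)
      then show ?thesis using p W'(3) \<gamma>(1) by (auto simp: T_def)
    qed
  qed
qed

end

section \<open>Planar lattices\<close>

definition rot90 :: "real^2 \<Rightarrow> real^2" where
  "rot90 x = vector [- x $ 2, x $ 1]"

lemma rot90_nth [simp]: "rot90 x $ 1 = - x $ 2" "rot90 x $ 2 = x $ 1"
  by (simp_all add: rot90_def)

lemma vec2_eq_iff: "x = y \<longleftrightarrow> x $ 1 = y $ 1 \<and> x $ 2 = y $ 2" for x y :: "real^2"
  by (auto simp: vec_eq_iff forall_2)

lemma inner_vec2: "x \<bullet> y = x $ 1 * y $ 1 + x $ 2 * y $ 2" for x y :: "real^2"
  by (simp add: inner_vec_def sum_2)

lemma norm_rot90 [simp]: "norm (rot90 x) = norm x"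
  by (simp add: norm_eq_sqrt_inner inner_vec2 algebra_simps)

lemma linear_rot90: "linear rot90"
  by (rule linearI) (simp_all add: vec2_eq_iff)

text \<open>The determinant of the two vectors, that is the oriented area of their
  parallelogram.\<close>

definition area :: "real^2 \<Rightarrow> real^2 \<Rightarrow> real" where
  "area x y = rot90 x \<bullet> y"

lemma area_nth: "area x y = x $ 1 * y $ 2 - x $ 2 * y $ 1"
  by (simp add: area_def inner_vec2)

lemma area_le: "\<bar>area x y\<bar> \<le> norm x * norm y"
  unfolding area_def using Cauchy_Schwarz_ineq2[of "rot90 x" y] by simp

lemma area_self [simp]: "area x x = 0"
  by (simp add: area_nth)

lemma area_linear:
  "area (x + y) z = area x z + area y z" "area z (x + y) = area z x + area z y"
  "area (c *\<^sub>R x) z = c * area x z" "area z (c *\<^sub>R x) = c * area z x"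
  "area (x - y) z = area x z - area y z" "area z (x - y) = area z x - area z y"
  by (simp_all add: area_nth algebra_simps)

text \<open>Cramer's rule.\<close>

lemma plane_coordinates:
  assumes "area u v \<noteq> 0"
  shows "x = (area x v / area u v) *\<^sub>R u + (area u x / area u v) *\<^sub>R v"
proof -
  have *: "area u v *\<^sub>R x = area x v *\<^sub>R u + area u x *\<^sub>R v"
    by (simp add: vec2_eq_iff area_nth algebra_simps)
  have "x = inverse (area u v) *\<^sub>R (area x v *\<^sub>R u + area u x *\<^sub>R v)"
    using assms by (simp flip: *)
  then show ?thesis by (simp add: scaleR_add_right divide_inverse mult.commute)
qed

section \<open>Lattices spanned by two vectors and their cells\<close>

definition lat :: "real^2 \<Rightarrow> real^2 \<Rightarrow> (real^2) set" where
  "lat u v = {of_int i *\<^sub>R u + of_int j *\<^sub>R v | i j :: int. True}"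

lemma latI: "of_int i *\<^sub>R u + of_int j *\<^sub>R v \<in> lat u v"
  by (auto simp: lat_def)

lemma zero_in_lat: "0 \<in> lat u v"
  using latI[of 0 u 0 v] by simp

lemma basis_in_lat: "u \<in> lat u v" "v \<in> lat u v"
  using latI[of 1 u 0 v] latI[of 0 u 1 v] by simp_all

lemma diff_in_lat: "x \<in> lat u v \<Longrightarrow> y \<in> lat u v \<Longrightarrow> x - y \<in> lat u v"
proof -
  assume "x \<in> lat u v" "y \<in> lat u v"
  then obtain i j k l where "x = of_int i *\<^sub>R u + of_int j *\<^sub>R v" "y = of_int k *\<^sub>R u + of_int l *\<^sub>R v"
    by (auto simp: lat_def)
  then have "x - y = of_int (i - k) *\<^sub>R u + of_int (j - l) *\<^sub>R v" by (simp add: algebra_simps)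
  then show ?thesis by (metis latI)
qed

lemma lat_coordinates:
  assumes "area u v \<noteq> 0" "x \<in> lat u v"
  obtains i j :: int where "x = of_int i *\<^sub>R u + of_int j *\<^sub>R v" "area x v = of_int i * area u v" "area u x = of_int j * area u v"
proof -
  obtain i j :: int where "x = of_int i *\<^sub>R u + of_int j *\<^sub>R v" using assms by (auto simp: lat_def)
  then show thesis by (intro that[of i j]) (auto simp: area_linear)
qed

text \<open>By Cramer's rule the norm of a lattice vector bounds its two integer
  coordinates.\<close>

lemma finite_lat_cball:
  assumes "area u v \<noteq> 0"
  shows "finite (lat u v \<inter> cball x r)"
proof -
  define R where "R = norm x + r"
  define N where "N = \<lceil>(R * norm v + R * norm u) / \<bar>area u v\<bar>\<rceil>"
  have "lat u v \<inter> cball x r \<subseteq> (\<lambda>(i, j). of_int i *\<^sub>R u + of_int j *\<^sub>R v) ` ({- N..N} \<times> {- N..N})"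
  proof
    fix y assume y: "y \<in> lat u v \<inter> cball x r"
    then obtain i j :: int where ij: "y = of_int i *\<^sub>R u + of_int j *\<^sub>R v" "area y v = of_int i * area u v" "area u y = of_int j * area u v"
      using lat_coordinates[OF assms] by blast
    have yR: "norm y \<le> R" using y norm_triangle_ineq2[of y x] by (simp add: R_def dist_norm norm_minus_commute)
    then have R0: "0 \<le> R" using norm_ge_zero order_trans by blast
    have "\<bar>of_int i\<bar> * \<bar>area u v\<bar> \<le> R * norm v"
      using area_le[of y v] mult_right_mono[OF yR norm_ge_zero[of v]] ij(2) by (simp add: abs_mult)
    then have "\<bar>of_int i\<bar> \<le> (R * norm v + R * norm u) / \<bar>area u v\<bar>"
      using assms R0 by (simp add: pos_le_divide_eq add_increasing2)
    then have i: "\<bar>i\<bar> \<le> N" unfolding N_def by linarith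
    have "\<bar>of_int j\<bar> * \<bar>area u v\<bar> \<le> R * norm u"
      using area_le[of u y] mult_left_mono[OF yR norm_ge_zero[of u]] ij(3) by (simp add: abs_mult mult.commute)
    then have "\<bar>of_int j\<bar> \<le> (R * norm v + R * norm u) / \<bar>area u v\<bar>"
      using assms R0 by (simp add: pos_le_divide_eq add_increasing)
    then have j: "\<bar>j\<bar> \<le> N" unfolding N_def by linarith
    show "y \<in> (\<lambda>(i, j). of_int i *\<^sub>R u + of_int j *\<^sub>R v) ` ({- N..N} \<times> {- N..N})"
      using i j ij(1) by (intro image_eqI[of _ _ "(i, j)"]) auto
  qed
  then show ?thesis by (rule finite_subset) auto
qed

text \<open>By \<open>plane_coordinates\<close> the two quotients are the coordinates with respect
  to \<open>u\<close> and \<open>v\<close>. The cell is half-open so that its translates partition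
  the plane exactly.\<close>

definition half_open_cell :: "real^2 \<Rightarrow> real^2 \<Rightarrow> (real^2) set" where
  "half_open_cell u v = {x. 0 \<le> area x v / area u v \<and> area x v / area u v < 1 \<and>
     0 \<le> area u x / area u v \<and> area u x / area u v < 1}"

lemma half_open_cell_unique:
  assumes "area u v \<noteq> 0"
  shows "\<exists>!\<gamma>. \<gamma> \<in> lat u v \<and> x - \<gamma> \<in> half_open_cell u v"
proof
  let ?i = "\<lfloor>area x v / area u v\<rfloor>" and ?j = "\<lfloor>area u x / area u v\<rfloor>"
  show "(of_int ?i *\<^sub>R u + of_int ?j *\<^sub>R v) \<in> lat u v \<and> x - (of_int ?i *\<^sub>R u + of_int ?j *\<^sub>R v) \<in> half_open_cell u v"
    using assms by (simp add: latI half_open_cell_def area_linear diff_divide_distrib) linarith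
  fix \<gamma> assume \<gamma>: "\<gamma> \<in> lat u v \<and> x - \<gamma> \<in> half_open_cell u v"
  then obtain i j :: int where ij: "\<gamma> = of_int i *\<^sub>R u + of_int j *\<^sub>R v" "area \<gamma> v = of_int i * area u v" "area u \<gamma> = of_int j * area u v"
    using lat_coordinates[OF assms] by blast
  have "0 \<le> area x v / area u v - of_int i" "area x v / area u v - of_int i < 1"
    "0 \<le> area u x / area u v - of_int j" "area u x / area u v - of_int j < 1"
    using \<gamma> assms by (simp_all add: half_open_cell_def area_linear diff_divide_distrib ij(2,3))
  then have "i = ?i" "j = ?j" by linarith+
  then show "\<gamma> = of_int ?i *\<^sub>R u + of_int ?j *\<^sub>R v" using ij(1) by simp
qed

lemma half_open_cell_norm:
  assumes "area u v \<noteq> 0" "x \<in> half_open_cell u v"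
  shows "norm x \<le> norm u + norm v"
proof -
  have "norm x = norm ((area x v / area u v) *\<^sub>R u + (area u x / area u v) *\<^sub>R v)"
    using plane_coordinates[OF assms(1), of x] by simp
  also have "\<dots> \<le> norm ((area x v / area u v) *\<^sub>R u) + norm ((area u x / area u v) *\<^sub>R v)"
    by (rule norm_triangle_ineq)
  also have "\<dots> = (area x v / area u v) * norm u + (area u x / area u v) * norm v"
    using assms(2) by (simp only: norm_scaleR half_open_cell_def mem_Collect_eq abs_of_nonneg)
  also have "\<dots> \<le> 1 * norm u + 1 * norm v"
    using assms(2) by (intro add_mono mult_right_mono) (auto simp: half_open_cell_def)
  finally show ?thesis by simp
qed

lemma lat_dense:
  assumes "area u v \<noteq> 0"
  shows "\<exists>\<gamma>\<in>lat u v. dist \<gamma> x \<le> norm u + norm v"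
proof -
  obtain \<gamma> where \<gamma>: "\<gamma> \<in> lat u v" "x - \<gamma> \<in> half_open_cell u v" using half_open_cell_unique[OF assms] by blast
  have "dist \<gamma> x \<le> norm u + norm v"
    using half_open_cell_norm[OF assms \<gamma>(2)] by (simp add: dist_norm norm_minus_commute)
  then show ?thesis using \<gamma>(1) by blast
qed

lemma continuous_area: "continuous_on S (\<lambda>x. area x v)" "continuous_on S (\<lambda>x. area u x)"
  unfolding area_nth by (intro continuous_intros)+

lemma half_open_cell_lmeasurable:
  assumes "area u v \<noteq> 0"
  shows "half_open_cell u v \<in> lmeasurable" "0 < measure lebesgue (half_open_cell u v)"
proof -
  let ?f = "\<lambda>x. area x v / area u v" and ?g = "\<lambda>x. area u x / area u v"
  have cont: "continuous_on S ?f" "continuous_on S ?g" for S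
    using assms by (intro continuous_on_divide continuous_area continuous_on_const; simp)+
  have eq: "half_open_cell u v = {x. 0 \<le> ?f x} \<inter> {x. ?f x < 1} \<inter> {x. 0 \<le> ?g x} \<inter> {x. ?g x < 1}"
    by (auto simp: half_open_cell_def)
  have "{x. 0 \<le> ?f x} \<in> sets lebesgue" "{x. 0 \<le> ?g x} \<in> sets lebesgue"
    by (simp_all add: borel_closed sets_completionI_sets closed_Collect_le cont)
  moreover have "{x. ?f x < 1} \<in> sets lebesgue" "{x. ?g x < 1} \<in> sets lebesgue"
    by (simp_all add: borel_open sets_completionI_sets open_Collect_less cont)
  ultimately have "half_open_cell u v \<in> sets lebesgue" unfolding eq by blast
  moreover have "bounded (half_open_cell u v)"
    using half_open_cell_norm[OF assms] by (auto simp: bounded_iff)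
  ultimately show lm: "half_open_cell u v \<in> lmeasurable" by (rule bounded_set_imp_lmeasurable[rotated])
  define W where "W = {x. 0 < ?f x} \<inter> {x. ?f x < 1} \<inter> {x. 0 < ?g x} \<inter> {x. ?g x < 1}"
  have "open W" unfolding W_def by (intro open_Int open_Collect_less cont continuous_on_const)
  moreover have "(1/2) *\<^sub>R u + (1/2) *\<^sub>R v \<in> W" using assms by (simp add: W_def area_linear)
  ultimately have "\<not> negligible W" using open_not_negligible by blast
  moreover have "W \<subseteq> half_open_cell u v" by (auto simp: W_def half_open_cell_def)
  ultimately have "\<not> negligible (half_open_cell u v)" using negligible_subset by blast
  then show "0 < measure lebesgue (half_open_cell u v)"
    using negligible_iff_measure0[OF lm] measure_nonneg[of lebesgue "half_open_cell u v"] by linarith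
qed

section \<open>Overlap areas of fundamental cells\<close>

lemma sum_measure_tiles:
  fixes A :: "'i \<Rightarrow> 'a::euclidean_space set"
  assumes tile: "\<And>x. \<exists>!\<gamma>. \<gamma> \<in> L \<and> x \<in> A \<gamma>" and S: "S \<in> lmeasurable" and A: "\<And>\<gamma>. \<gamma> \<in> L \<Longrightarrow> A \<gamma> \<in> lmeasurable"
    and fin: "finite {\<gamma> \<in> L. S \<inter> A \<gamma> \<noteq> {}}"
    and T: "finite T" "T \<subseteq> L" "\<And>\<gamma>. \<gamma> \<in> L \<Longrightarrow> measure lebesgue (S \<inter> A \<gamma>) \<noteq> 0 \<Longrightarrow> \<gamma> \<in> T"
  shows "(\<Sum>\<gamma>\<in>T. measure lebesgue (S \<inter> A \<gamma>)) = measure lebesgue S"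
proof -
  let ?T = "{\<gamma> \<in> L. S \<inter> A \<gamma> \<noteq> {}}"
  have "(\<Sum>\<gamma>\<in>T. measure lebesgue (S \<inter> A \<gamma>)) = (\<Sum>\<gamma>\<in>?T. measure lebesgue (S \<inter> A \<gamma>))"
    by (rule sum.mono_neutral_cong) (use T fin in auto)
  also have "\<dots> = measure lebesgue (\<Union>\<gamma>\<in>?T. S \<inter> A \<gamma>)"
  proof (rule measure_finite_Union[symmetric, OF fin])
    show "(\<lambda>\<gamma>. S \<inter> A \<gamma>) ` ?T \<subseteq> sets lebesgue" using S A by (auto simp: fmeasurableD)
    show "disjoint_family_on (\<lambda>\<gamma>. S \<inter> A \<gamma>) ?T" using tile by (auto simp: disjoint_family_on_def)
    show "emeasure lebesgue (S \<inter> A i) \<noteq> \<infinity>" if "i \<in> ?T" for i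
    proof -
      have "S \<inter> A i \<in> lmeasurable" using S A that by blast
      then show ?thesis unfolding infinity_ennreal_def by (rule fmeasurableD2)
    qed
  qed
  also have "(\<Union>\<gamma>\<in>?T. S \<inter> A \<gamma>) = S"
  proof (intro equalityI subsetI)
    fix x assume "x \<in> S"
    then show "x \<in> (\<Union>\<gamma>\<in>?T. S \<inter> A \<gamma>)" using ex1_implies_ex[OF tile[of x]] by auto
  qed auto
  finally show ?thesis .
qed

definition finite_orthogonal_group :: "('a::real_inner \<Rightarrow> 'a) set \<Rightarrow> bool" where
  "finite_orthogonal_group D \<longleftrightarrow> finite D \<and> id \<in> D \<and> (\<forall>d\<in>D. \<forall>e\<in>D. d \<circ> e \<in> D) \<and>
     (\<forall>d\<in>D. \<exists>e\<in>D. e \<circ> d = id \<and> d \<circ> e = id) \<and> (\<forall>d\<in>D. orthogonal_transformation d)"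

text \<open>
  The overlap areas of a cell of the first lattice with the translates of a cell of the second one
  form a periodic partition of unity for both lattices at once.
\<close>

lemma overlap_periodic_sum:
  fixes Q Q' :: "'a::euclidean_space set"
  assumes Q: "Q \<in> lmeasurable" "\<And>x. \<exists>!\<gamma>. \<gamma> \<in> L \<and> x - \<gamma> \<in> Q" "bounded Q"
    and Q': "Q' \<in> lmeasurable" "\<And>x. \<exists>!\<gamma>. \<gamma> \<in> L' \<and> x - \<gamma> \<in> Q'" "bounded Q'"
    and lf: "\<And>x r. finite (L \<inter> cball x r)" "\<And>x r. finite (L' \<inter> cball x r)"
    and minus: "\<And>x. x \<in> L \<Longrightarrow> - x \<in> L"
    and pos: "measure lebesgue Q = \<alpha>" "measure lebesgue Q' = \<alpha>" "\<alpha> \<noteq> 0"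
  defines "m \<equiv> (\<lambda>p. measure lebesgue (Q \<inter> (+) p ` Q') / \<alpha>)"
  shows "periodic_sum_one L m" "periodic_sum_one L' m"
proof -
  obtain b where b: "\<And>x. x \<in> Q \<Longrightarrow> norm x \<le> b" using Q(3) by (auto simp: bounded_iff)
  obtain b' where b': "\<And>x. x \<in> Q' \<Longrightarrow> norm x \<le> b'" using Q'(3) by (auto simp: bounded_iff)
  have mem: "x \<in> (+) q ` B \<longleftrightarrow> x - q \<in> B" for x q :: 'a and B
    by (auto simp: image_iff algebra_simps intro: bexI[of _ "x - q"])
  show "periodic_sum_one L' m"
    unfolding periodic_sum_one_def
  proof (intro allI impI)
    fix p T assume T: "finite T" "T \<subseteq> L'" "\<forall>\<gamma>\<in>L'. m (p + \<gamma>) \<noteq> 0 \<longrightarrow> \<gamma> \<in> T"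
    have "(\<Sum>\<gamma>\<in>T. measure lebesgue (Q \<inter> (+) (p + \<gamma>) ` Q')) = measure lebesgue Q"
    proof (rule sum_measure_tiles[where L = L'])
      show "\<exists>!\<gamma>. \<gamma> \<in> L' \<and> x \<in> (+) (p + \<gamma>) ` Q'" for x
        using Q'(2)[of "x - p"] by (simp add: mem diff_diff_eq)
      show "finite {\<gamma> \<in> L'. Q \<inter> (+) (p + \<gamma>) ` Q' \<noteq> {}}"
      proof (rule finite_subset[OF _ lf(2)[of 0 "b + b' + norm p"]], rule subsetI)
        fix \<gamma> assume "\<gamma> \<in> {\<gamma> \<in> L'. Q \<inter> (+) (p + \<gamma>) ` Q' \<noteq> {}}"
        then obtain x where x: "\<gamma> \<in> L'" "x \<in> Q" "x \<in> (+) (p + \<gamma>) ` Q'" by blast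
        then have "norm (x - (p + \<gamma>)) \<le> b'" "norm x \<le> b" using b b' mem by blast+
        moreover have "norm \<gamma> \<le> norm x + norm (x - (p + \<gamma>)) + norm p"
          using norm_triangle_ineq4[of "p + \<gamma>" p] norm_triangle_ineq4[of x "x - (p + \<gamma>)"] by (simp add: add.commute)
        ultimately show "\<gamma> \<in> L' \<inter> cball 0 (b + b' + norm p)" using x by simp
      qed
      show "\<gamma> \<in> T" if "\<gamma> \<in> L'" "measure lebesgue (Q \<inter> (+) (p + \<gamma>) ` Q') \<noteq> 0" for \<gamma>
        using T(3) that pos(3) by (simp add: m_def)
    qed (use Q Q' T measurable_translation in auto)
    then show "(\<Sum>\<gamma>\<in>T. m (p + \<gamma>)) = 1"
      using pos by (simp add: m_def sum_divide_distrib[symmetric])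
  qed
  show "periodic_sum_one L m"
    unfolding periodic_sum_one_def
  proof (intro allI impI)
    fix p T assume T: "finite T" "T \<subseteq> L" "\<forall>\<gamma>\<in>L. m (p + \<gamma>) \<noteq> 0 \<longrightarrow> \<gamma> \<in> T"
    have shift: "measure lebesgue (Q \<inter> (+) (p + \<gamma>) ` Q') = measure lebesgue ((+) p ` Q' \<inter> (+) (- \<gamma>) ` Q)" for \<gamma>
    proof -
      have "(+) (- \<gamma>) ` (Q \<inter> (+) (p + \<gamma>) ` Q') = (+) p ` Q' \<inter> (+) (- \<gamma>) ` Q"
        by (auto simp: mem set_eq_iff algebra_simps simp del: image_add_0)
      then show ?thesis using measure_translation[of "- \<gamma>" "Q \<inter> (+) (p + \<gamma>) ` Q'"] by simp
    qed
    have "(\<Sum>\<gamma>\<in>T. measure lebesgue ((+) p ` Q' \<inter> (+) (- \<gamma>) ` Q)) = measure lebesgue ((+) p ` Q')"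
    proof (rule sum_measure_tiles[where L = L])
      show "\<exists>!\<gamma>. \<gamma> \<in> L \<and> x \<in> (+) (- \<gamma>) ` Q" for x
      proof -
        obtain \<gamma> where "\<gamma> \<in> L \<and> x - \<gamma> \<in> Q" and "\<forall>y. y \<in> L \<and> x - y \<in> Q \<longrightarrow> y = \<gamma>"
          using Q(2)[of x] by (rule ex1E)
        then have \<gamma>: "\<gamma> \<in> L" "x - \<gamma> \<in> Q" "\<And>\<gamma>'. \<gamma>' \<in> L \<Longrightarrow> x - \<gamma>' \<in> Q \<Longrightarrow> \<gamma>' = \<gamma>"
          by blast+
        show ?thesis
        proof (rule ex1I[of _ "- \<gamma>"])
          show "- \<gamma> \<in> L \<and> x \<in> (+) (- (- \<gamma>)) ` Q" using \<gamma>(1,2) minus by (simp add: mem)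
          show "y = - \<gamma>" if "y \<in> L \<and> x \<in> (+) (- y) ` Q" for y
          proof -
            have "- y = \<gamma>" using that minus by (intro \<gamma>(3)) (auto simp: mem)
            then show ?thesis by auto
          qed
        qed
      qed
      show "finite {\<gamma> \<in> L. (+) p ` Q' \<inter> (+) (- \<gamma>) ` Q \<noteq> {}}"
      proof (rule finite_subset[OF _ lf(1)[of 0 "b + b' + norm p"]], rule subsetI)
        fix \<gamma> assume "\<gamma> \<in> {\<gamma> \<in> L. (+) p ` Q' \<inter> (+) (- \<gamma>) ` Q \<noteq> {}}"
        then obtain x where x: "\<gamma> \<in> L" "x \<in> (+) p ` Q'" "x \<in> (+) (- \<gamma>) ` Q" by blast
        then have "norm (x - p) \<le> b'" "norm (x - (- \<gamma>)) \<le> b" using b b' mem by blast+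
        moreover have "norm \<gamma> \<le> norm (x - (- \<gamma>)) + norm (x - p) + norm p"
          using norm_triangle_ineq4[of "x - (- \<gamma>)" x] norm_triangle_ineq[of "x - p" p] by simp
        ultimately show "\<gamma> \<in> L \<inter> cball 0 (b + b' + norm p)" using x by simp
      qed
      show "\<gamma> \<in> T" if "\<gamma> \<in> L" "measure lebesgue ((+) p ` Q' \<inter> (+) (- \<gamma>) ` Q) \<noteq> 0" for \<gamma>
        using T(3) that pos(3) shift by (simp add: m_def)
      show "(+) (- \<gamma>) ` Q \<in> lmeasurable" for \<gamma> by (rule measurable_translation[OF Q(1)])
    qed (use Q' T measurable_translation in auto)
    then show "(\<Sum>\<gamma>\<in>T. m (p + \<gamma>)) = 1"
      using pos by (simp add: m_def shift sum_divide_distrib[symmetric] measure_translation)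
  qed
qed

text \<open>Supplies the input of \<open>lattice_pair\<close>. A cell and its image under
  \<open>\<sigma>\<close> have equal area, so their overlaps sum to one over both lattices. The
  average over \<open>D\<close> is invariant, and its sums remain one because each element of
  \<open>D\<close> permutes the two lattices.\<close>

theorem planar_open_transversal:
  fixes u v :: "real^2"
  assumes uv: "area u v \<noteq> 0" and D: "finite_orthogonal_group D"
    and act: "\<And>d. d \<in> D \<Longrightarrow> d ` lat u v = lat u v \<or> d ` lat u v = \<Gamma>'"
    and \<sigma>: "\<sigma> \<in> D" "\<sigma> ` lat u v = \<Gamma>'" and indep: "lat u v \<inter> \<Gamma>' = {0}"
  obtains I where "open I" "bounded I" "\<And>d p. d \<in> D \<Longrightarrow> p \<in> I \<Longrightarrow> d p \<in> I"
    "\<And>x y. x \<in> I \<Longrightarrow> y \<in> I \<Longrightarrow> x - y \<in> lat u v \<Longrightarrow> x = y"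
    "\<And>W. open W \<Longrightarrow> W \<noteq> {} \<Longrightarrow> \<exists>p\<in>W. \<exists>\<gamma>\<in>lat u v. p + \<gamma> \<in> I"
proof -
  define \<Gamma> where "\<Gamma> = lat u v"
  define Q where "Q = half_open_cell u v"
  have finD: "finite D" and idD: "id \<in> D" and compD: "\<And>d e. d \<in> D \<Longrightarrow> e \<in> D \<Longrightarrow> d \<circ> e \<in> D"
    and invD: "\<And>d. d \<in> D \<Longrightarrow> \<exists>e\<in>D. e \<circ> d = id \<and> d \<circ> e = id"
    and orthD: "\<And>d. d \<in> D \<Longrightarrow> orthogonal_transformation d"
    using D by (auto simp: finite_orthogonal_group_def)
  have o\<sigma>: "orthogonal_transformation \<sigma>" using orthD \<sigma> by blast
  have lin\<sigma>: "linear \<sigma>" and bij\<sigma>: "bij \<sigma>" and norm\<sigma>: "\<And>x. norm (\<sigma> x) = norm x"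
    using o\<sigma> orthogonal_transformation_linear orthogonal_transformation_bij orthogonal_transformation_norm by blast+
  have \<Gamma>': "\<Gamma>' = \<sigma> ` \<Gamma>" using \<sigma> by (simp add: \<Gamma>_def)
  have lf: "finite (\<Gamma> \<inter> cball x r)" for x r using finite_lat_cball[OF uv] by (simp add: \<Gamma>_def)
  have lf': "finite (\<Gamma>' \<inter> cball x r)" for x r
  proof (rule finite_subset)
    show "\<Gamma>' \<inter> cball x r \<subseteq> \<sigma> ` (\<Gamma> \<inter> cball 0 (norm x + r))"
    proof
      fix y assume y: "y \<in> \<Gamma>' \<inter> cball x r"
      then obtain z where z: "z \<in> \<Gamma>" "y = \<sigma> z" by (auto simp: \<Gamma>')
      have "norm z \<le> norm x + r"
        using y norm\<sigma>[of z] z norm_triangle_ineq2[of y x] by (simp add: dist_norm norm_minus_commute)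
      then show "y \<in> \<sigma> ` (\<Gamma> \<inter> cball 0 (norm x + r))" using z by auto
    qed
  qed (use lf in auto)
  have \<Gamma>0: "0 \<in> \<Gamma>" and \<Gamma>diff: "\<And>x y. x \<in> \<Gamma> \<Longrightarrow> y \<in> \<Gamma> \<Longrightarrow> x - y \<in> \<Gamma>"
    unfolding \<Gamma>_def by (auto intro: zero_in_lat diff_in_lat)
  have \<Gamma>'0: "0 \<in> \<Gamma>'" using imageI[OF \<Gamma>0, of \<sigma>] linear_0[OF lin\<sigma>] by (simp add: \<Gamma>')
  have \<Gamma>'diff: "x - y \<in> \<Gamma>'" if "x \<in> \<Gamma>'" "y \<in> \<Gamma>'" for x y
    using that \<Gamma>diff unfolding \<Gamma>' by (auto simp: linear_diff[OF lin\<sigma>, symmetric])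
  have ne: "\<Gamma> \<noteq> \<Gamma>'"
  proof
    assume "\<Gamma> = \<Gamma>'"
    then have "\<Gamma> = {0}" using indep by (simp add: \<Gamma>_def)
    then have "u = 0" using basis_in_lat(1)[of u v] by (simp add: \<Gamma>_def)
    then show False using uv by (simp add: area_nth)
  qed
  have actD: "d ` \<Gamma> = \<Gamma> \<and> d ` \<Gamma>' = \<Gamma>' \<or> d ` \<Gamma> = \<Gamma>' \<and> d ` \<Gamma>' = \<Gamma>" if d: "d \<in> D" for d
  proof -
    have "d ` \<Gamma>' = (d \<circ> \<sigma>) ` \<Gamma>" by (simp add: \<Gamma>' image_comp)
    then have 1: "d ` \<Gamma>' = \<Gamma> \<or> d ` \<Gamma>' = \<Gamma>'" using act[OF compD[OF d \<sigma>(1)]] by (simp add: \<Gamma>_def)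
    have 2: "d ` \<Gamma> = \<Gamma> \<or> d ` \<Gamma> = \<Gamma>'" using act[OF d] by (simp add: \<Gamma>_def)
    have "inj d" using orthD[OF d] orthogonal_transformation_bij bij_is_inj by blast
    then have "d ` \<Gamma> \<noteq> d ` \<Gamma>'" using ne by (simp add: inj_image_eq_iff)
    then show ?thesis using 1 2 by auto
  qed
  define \<alpha> where "\<alpha> = measure lebesgue Q"
  have Q: "Q \<in> lmeasurable" "\<alpha> > 0" "\<And>x. \<exists>!\<gamma>. \<gamma> \<in> \<Gamma> \<and> x - \<gamma> \<in> Q"
    unfolding Q_def \<alpha>_def \<Gamma>_def by (fact half_open_cell_lmeasurable[OF uv] half_open_cell_unique[OF uv])+
  define b where "b = norm u + norm v"
  have b: "norm x \<le> b" if "x \<in> Q" for x using half_open_cell_norm[OF uv] that by (simp add: b_def Q_def)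
  have b': "norm x \<le> b" if "x \<in> \<sigma> ` Q" for x using that b norm\<sigma> by auto
  have bpos: "0 < b" using uv by (cases "u = 0") (auto simp: b_def area_nth add_pos_nonneg)
  have Q': "\<sigma> ` Q \<in> lmeasurable" "measure lebesgue (\<sigma> ` Q) = \<alpha>"
    using measurable_orthogonal_image[OF o\<sigma> Q(1)] measure_orthogonal_image[OF o\<sigma> Q(1)] by (simp_all add: \<alpha>_def)
  have Q'u: "\<exists>!\<gamma>. \<gamma> \<in> \<Gamma>' \<and> x - \<gamma> \<in> \<sigma> ` Q" for x
  proof -
    obtain x0 where x0: "x = \<sigma> x0" using bij\<sigma> by (meson bij_pointE)
    obtain \<gamma> where "\<gamma> \<in> \<Gamma> \<and> x0 - \<gamma> \<in> Q" and "\<forall>y. y \<in> \<Gamma> \<and> x0 - y \<in> Q \<longrightarrow> y = \<gamma>"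
      using Q(3)[of x0] by (rule ex1E)
    then have \<gamma>: "\<gamma> \<in> \<Gamma>" "x0 - \<gamma> \<in> Q" "\<And>\<gamma>'. \<gamma>' \<in> \<Gamma> \<Longrightarrow> x0 - \<gamma>' \<in> Q \<Longrightarrow> \<gamma>' = \<gamma>"
      by blast+
    show ?thesis
    proof (rule ex1I[of _ "\<sigma> \<gamma>"])
      show "\<sigma> \<gamma> \<in> \<Gamma>' \<and> x - \<sigma> \<gamma> \<in> \<sigma> ` Q"
        using \<gamma>(1,2) unfolding \<Gamma>' x0 linear_diff[OF lin\<sigma>, symmetric] by blast
      fix y assume "y \<in> \<Gamma>' \<and> x - y \<in> \<sigma> ` Q"
      then obtain \<gamma>' where g': "\<gamma>' \<in> \<Gamma>" "y = \<sigma> \<gamma>'" "\<sigma> x0 - \<sigma> \<gamma>' \<in> \<sigma> ` Q"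
        unfolding \<Gamma>' x0 by blast
      then have "\<sigma> (x0 - \<gamma>') \<in> \<sigma> ` Q" by (simp only: linear_diff[OF lin\<sigma>])
      then have "x0 - \<gamma>' \<in> Q" by (simp only: inj_image_mem_iff[OF bij_is_inj[OF bij\<sigma>]])
      then show "y = \<sigma> \<gamma>" using \<gamma>(3) g' by simp
    qed
  qed
  define m1 where "m1 = (\<lambda>p. measure lebesgue (Q \<inter> (+) p ` (\<sigma> ` Q)) / \<alpha>)"
  have bnd: "bounded Q" "bounded (\<sigma> ` Q)" using b b' by (auto simp: bounded_iff)
  have minus: "- x \<in> \<Gamma>" if "x \<in> \<Gamma>" for x using \<Gamma>diff[OF \<Gamma>0 that] by simp
  have m1: "periodic_sum_one \<Gamma> m1" "periodic_sum_one \<Gamma>' m1"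
    unfolding m1_def
    using overlap_periodic_sum[OF Q(1,3) bnd(1) Q'(1) Q'u bnd(2) lf lf' minus \<alpha>_def[symmetric] Q'(2)] Q(2) by simp_all
  have m1nn: "0 \<le> m1 p" for p using Q(2) by (simp add: m1_def)
  have m1supp: "norm p \<le> 2 * b" if "m1 p \<noteq> 0" for p
  proof -
    have "Q \<inter> (+) p ` (\<sigma> ` Q) \<noteq> {}" using that by (auto simp: m1_def)
    then obtain y where y: "y \<in> \<sigma> ` Q" "p + y \<in> Q" by blast
    then show ?thesis using b[OF y(2)] b'[OF y(1)] norm_triangle_ineq4[of "p + y" y] by simp
  qed
  define m0 where "m0 p = (\<Sum>d\<in>D. m1 (d p)) / real (card D)" for p
  have cD: "0 < real (card D)" using finD idD by (auto simp: card_gt_0_iff)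
  have m0nn: "0 \<le> m0 p" for p using m1nn by (simp add: m0_def sum_nonneg)
  have m0m1: "m0 p \<noteq> 0" if "d \<in> D" "m1 (d p) \<noteq> 0" for d p
    using that m1nn finD cD by (auto simp: m0_def sum_nonneg_eq_0_iff)
  \<comment> \<open>Both cells lie in the ball of radius \<open>b\<close>, so overlaps vanish beyond
    \<open>2 * b\<close>; the same \<open>b\<close> is a covering radius of the lattice.\<close>
  interpret lattice_pair \<Gamma> \<Gamma>' D m0 "2 * b" b "2 * b + b"
  proof
    show "m0 (d p) = m0 p" if d: "d \<in> D" for d p
    proof -
      obtain e where e: "e \<in> D" "e \<circ> d = id" "d \<circ> e = id" using invD[OF d] by blast
      have bb: "bij_betw (\<lambda>x. x \<circ> d) D D"
        by (rule bij_betw_byWitness[where f' = "\<lambda>x. x \<circ> e"])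
          (use d e compD in \<open>auto simp: o_assoc[symmetric]\<close>)
      have "(\<Sum>x\<in>D. m1 (x (d p))) = (\<Sum>x\<in>D. m1 ((x \<circ> d) p))" by simp
      also have "\<dots> = (\<Sum>x\<in>D. m1 (x p))" by (rule sum.reindex_bij_betw[OF bb])
      finally show ?thesis by (simp add: m0_def)
    qed
    show "norm p \<le> 2 * b" if nz: "m0 p \<noteq> 0" for p
    proof -
      have "\<not> (\<forall>d\<in>D. m1 (d p) = 0)"
      proof
        assume "\<forall>d\<in>D. m1 (d p) = 0"
        then have "(\<Sum>d\<in>D. m1 (d p)) = 0" by (rule sum.neutral)
        then show False using nz by (simp add: m0_def)
      qed
      then obtain d where d: "d \<in> D" "m1 (d p) \<noteq> 0" by blast
      then show ?thesis using m1supp[of "d p"] orthogonal_transformation_norm[OF orthD[OF d(1)], of p] by simp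
    qed
    show "periodic_sum_one \<Gamma> m0"
      unfolding periodic_sum_one_def
    proof (intro allI impI)
      fix p T assume T: "finite T" "T \<subseteq> \<Gamma>" "\<forall>\<gamma>\<in>\<Gamma>. m0 (p + \<gamma>) \<noteq> 0 \<longrightarrow> \<gamma> \<in> T"
      have one: "(\<Sum>\<gamma>\<in>T. m1 (d (p + \<gamma>))) = 1" if d: "d \<in> D" for d
      proof -
        have lin: "linear d" and inj: "inj d"
          using orthD[OF d] orthogonal_transformation_linear orthogonal_transformation_bij bij_is_inj by blast+
        have "(\<Sum>\<gamma>\<in>T. m1 (d (p + \<gamma>))) = (\<Sum>\<gamma>\<in>d ` T. m1 (d p + \<gamma>))"
          using inj by (subst sum.reindex) (auto simp: linear_add[OF lin] intro: inj_on_subset)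
        also have "\<dots> = 1"
        proof (rule periodic_sum_oneD[of "d ` \<Gamma>"])
          show "periodic_sum_one (d ` \<Gamma>) m1" using actD[OF d] m1 by auto
          show "\<gamma> \<in> d ` T" if "\<gamma> \<in> d ` \<Gamma>" "m1 (d p + \<gamma>) \<noteq> 0" for \<gamma>
          proof -
            obtain \<beta> where \<beta>: "\<beta> \<in> \<Gamma>" "\<gamma> = d \<beta>" using \<open>\<gamma> \<in> d ` \<Gamma>\<close> by blast
            then have "m1 (d (p + \<beta>)) \<noteq> 0" using that by (simp add: linear_add[OF lin])
            then show ?thesis using m0m1[OF d] T(3) \<beta> by blast
          qed
        qed (use T in auto)
        finally show ?thesis .
      qed
      have "(\<Sum>\<gamma>\<in>T. m0 (p + \<gamma>)) = (\<Sum>d\<in>D. \<Sum>\<gamma>\<in>T. m1 (d (p + \<gamma>))) / real (card D)"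
        unfolding m0_def by (subst sum.swap) (simp add: sum_divide_distrib[symmetric])
      also have "\<dots> = 1" using one cD by simp
      finally show "(\<Sum>\<gamma>\<in>T. m0 (p + \<gamma>)) = 1" .
    qed
    show "\<exists>c\<in>\<Gamma>. dist c z \<le> b" for z using lat_dense[OF uv] by (simp add: \<Gamma>_def b_def)
    show "\<exists>d\<in>D. d ` \<Gamma> = \<Gamma>'" using \<sigma> \<Gamma>' by auto
    show "\<Gamma> \<inter> \<Gamma>' = {0}" using indep by (simp add: \<Gamma>_def)
  qed (use \<Gamma>0 \<Gamma>diff \<Gamma>'0 \<Gamma>'diff lf lf' finD idD compD invD orthD actD bpos m0nn in auto)
  show thesis
    by (rule invariant_open_transversal[unfolded \<Gamma>_def]) (rule that, assumption, assumption, blast, blast, blast)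
qed

section \<open>From open transversals to fundamental cells\<close>

lemma countable_if_locally_finite:
  fixes L :: "'a::real_normed_vector set"
  assumes "\<And>r. finite (L \<inter> cball 0 r)"
  shows "countable L"
proof -
  have "L \<subseteq> (\<Union>n::nat. L \<inter> cball 0 (real n))" using real_arch_simple by auto
  moreover have "countable (\<Union>n::nat. L \<inter> cball 0 (real n))" by (intro countable_UN countableI_type countable_finite assms)
  ultimately show ?thesis by (rule countable_subset)
qed

text \<open>Near \<open>x\<close> only finitely many translates of the bounded set
  \<open>closure I\<close> matter. Their union is closed, and density brings \<open>x\<close> into
  it.\<close>

lemma closed_translates_cover:
  fixes I L :: "'a::real_normed_vector set"
  assumes lf: "\<And>r. finite (L \<inter> cball 0 r)" and b: "I \<subseteq> cball 0 b"
    and dense: "\<And>W. open W \<Longrightarrow> W \<noteq> {} \<Longrightarrow> \<exists>p\<in>W. \<exists>\<gamma>\<in>L. p + \<gamma> \<in> I"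
  shows "\<exists>\<gamma>\<in>L. x + \<gamma> \<in> closure I"
proof -
  define G0 where "G0 = L \<inter> cball 0 (norm x + b + 1)"
  define K where "K = (\<Union>\<gamma>\<in>G0. (\<lambda>y. y - \<gamma>) ` closure I)"
  have "closed K" unfolding K_def
    using lf by (intro closed_UN) (auto simp: G0_def intro: closed_translation_subtract)
  have "x \<in> K"
  proof (rule ccontr)
    assume "x \<notin> K"
    then have "x \<in> - K" "open (- K)" using \<open>closed K\<close> by auto
    then obtain e where e: "e > 0" "ball x e \<subseteq> - K" using open_contains_ball by blast
    have "x \<in> ball x (min e 1)" using e by simp
    then obtain p \<gamma> where p: "p \<in> ball x (min e 1)" "\<gamma> \<in> L" "p + \<gamma> \<in> I"
      using dense[of "ball x (min e 1)"] by blast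
    have "norm (p + \<gamma>) \<le> b" using p b by auto
    moreover have "norm p \<le> norm x + 1"
      using p(1) norm_triangle_ineq2[of p x] by (auto simp: dist_norm norm_minus_commute)
    moreover have "norm \<gamma> \<le> norm (p + \<gamma>) + norm p" using norm_triangle_ineq4[of "p + \<gamma>" p] by simp
    ultimately have "\<gamma> \<in> G0" using p by (simp add: G0_def)
    moreover have "p + \<gamma> \<in> closure I" using p closure_subset by blast
    ultimately have "p + \<gamma> - \<gamma> \<in> K" unfolding K_def by blast
    then show False using p(1) e(2) by auto
  qed
  then obtain \<gamma> y where "\<gamma> \<in> L" "y \<in> closure I" "x = y - \<gamma>" by (auto simp: K_def G0_def)
  then show ?thesis by (intro bexI[of _ \<gamma>]) auto
qed

lemma open_ball_minus_finite_nonempty: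
  fixes I :: "'a::euclidean_space set"
  assumes "open I" "x \<in> closure I" "0 < e" "finite A"
  obtains y where "y \<in> I" "dist y x < e" "y \<notin> A"
proof -
  have "open (I \<inter> ball x e)" using assms by auto
  moreover have "I \<inter> ball x e \<noteq> {}"
  proof -
    obtain y where "y \<in> I" "dist y x < e" using assms(2,3) unfolding closure_approachable by blast
    then have "y \<in> I \<inter> ball x e" by (simp add: dist_commute)
    then show ?thesis by blast
  qed
  ultimately have "infinite (I \<inter> ball x e)" using finite_imp_not_open by blast
  then have "I \<inter> ball x e - A \<noteq> {}" using assms(4) by (metis finite.emptyI finite_Diff2)
  then obtain y where y: "y \<in> I \<inter> ball x e - A" by blast
  show thesis by (rule that[of y]) (use y in \<open>auto simp: dist_commute\<close>)
qed

text \<open>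
  A symmetry of the cell permutes its isolated points, which form two orbits of different radii about
  their centroid \<open>0\<close>. It is therefore linear, and the genericity of the orbits puts it into \<open>D\<close>.
\<close>

theorem fundamental_cell_with_symmetry:
  fixes \<Gamma> :: "(real^2) set"
  assumes \<Gamma>0: "0 \<in> \<Gamma>" and \<Gamma>diff: "\<And>x y. x \<in> \<Gamma> \<Longrightarrow> y \<in> \<Gamma> \<Longrightarrow> x - y \<in> \<Gamma>"
    and lf: "\<And>x r. finite (\<Gamma> \<inter> cball x r)"
    and D: "finite_orthogonal_group D" and uminusD: "uminus \<in> D"
    and I: "open I" "bounded I" "\<And>d p. d \<in> D \<Longrightarrow> p \<in> I \<Longrightarrow> d p \<in> I"
    and Iinj: "\<And>x y. x \<in> I \<Longrightarrow> y \<in> I \<Longrightarrow> x - y \<in> \<Gamma> \<Longrightarrow> x = y"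
    and dense: "\<And>W. open W \<Longrightarrow> W \<noteq> {} \<Longrightarrow> \<exists>p\<in>W. \<exists>\<gamma>\<in>\<Gamma>. p + \<gamma> \<in> I"
  obtains F where "fundamental_cell \<Gamma> F" "carrier (symmetry_group F) = D"
proof -
  have finD: "finite D" and idD: "id \<in> D" and compD: "\<And>d e. d \<in> D \<Longrightarrow> e \<in> D \<Longrightarrow> d \<circ> e \<in> D"
    and invD: "\<And>d. d \<in> D \<Longrightarrow> \<exists>e\<in>D. e \<circ> d = id \<and> d \<circ> e = id"
    and orthD: "\<And>d. d \<in> D \<Longrightarrow> orthogonal_transformation d"
    using D by (auto simp: finite_orthogonal_group_def)
  have linD: "linear d" and bijD: "bij d" and normD: "norm (d x) = norm x" if "d \<in> D" for d x
    using orthD[OF that] orthogonal_transformation_linear orthogonal_transformation_bij orthogonal_transformation_norm by blast+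
  have \<Gamma>minus: "- x \<in> \<Gamma>" if "x \<in> \<Gamma>" for x using \<Gamma>diff[OF \<Gamma>0 that] by simp
  have \<Gamma>add: "x + y \<in> \<Gamma>" if "x \<in> \<Gamma>" "y \<in> \<Gamma>" for x y using \<Gamma>diff[OF that(1) \<Gamma>minus[OF that(2)]] by simp
  have eq_sym: "y - x \<in> \<Gamma>" if "x - y \<in> \<Gamma>" for x y using \<Gamma>minus[OF that] by simp
  have eq_trans: "x - z \<in> \<Gamma>" if "x - y \<in> \<Gamma>" "y - z \<in> \<Gamma>" for x y z using \<Gamma>add[OF that] by simp
  have count: "countable \<Gamma>" using countable_if_locally_finite[OF lf] .
  obtain b where b: "I \<subseteq> cball 0 b" "0 \<le> b"
  proof -
    obtain c where "\<forall>x\<in>I. norm x \<le> c" using I(2) bounded_iff by blast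
    then have "I \<subseteq> cball 0 (max c 0)" by auto
    then show thesis using that by auto
  qed
  have clb: "closure I \<subseteq> cball 0 b" using b by (simp add: closure_minimal)
  have pick: "\<exists>x. r < norm x \<and> x \<notin> \<Union> \<N>" if "countable \<N>" "\<And>S. S \<in> \<N> \<Longrightarrow> negligible S" for r and \<N> :: "(real^2) set set"
  proof -
    have "negligible (\<Union> \<N>)" using that by (intro negligible_countable_Union) auto
    moreover have "open {x :: real^2. r < norm x}" by (intro open_Collect_less continuous_intros)
    moreover have "{x :: real^2. r < norm x} \<noteq> {}"
    proof -
      obtain x :: "real^2" where "x \<notin> cball 0 r" using bounded_cball not_bounded_UNIV by (metis UNIV_eq_I)
      then show ?thesis by (auto simp: not_le)
    qed
    ultimately have "\<not> {x :: real^2. r < norm x} \<subseteq> \<Union> \<N>" using open_not_negligible negligible_subset by blast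
    then show ?thesis by blast
  qed
  \<comment> \<open>Outside these null sets an orbit of \<open>D\<close> is free and its points are
    pairwise incongruent modulo \<open>\<Gamma>\<close>.\<close>
  define Bad where "Bad = (\<lambda>(d, d', \<gamma>). {x. d x - d' x = \<gamma>}) ` ({(d, d', \<gamma>). d \<in> D \<and> d' \<in> D \<and> d \<noteq> d' \<and> \<gamma> \<in> \<Gamma>})"
  have cDG: "countable (D \<times> D \<times> \<Gamma>)"
    by (rule countable_SIGMA[OF countable_finite[OF finD] countable_SIGMA[OF countable_finite[OF finD] count]])
  have "countable {(d, d', \<gamma>). d \<in> D \<and> d' \<in> D \<and> d \<noteq> d' \<and> \<gamma> \<in> \<Gamma>}"
    by (rule countable_subset[OF _ cDG]) auto
  then have cBad: "countable Bad" unfolding Bad_def by (rule countable_image)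
  have nBad: "negligible S" if S: "S \<in> Bad" for S
  proof -
    obtain d d' \<gamma> where dd: "d \<in> D" "d' \<in> D" "d \<noteq> d'" "S = {x. d x - d' x = \<gamma>}" using S by (auto simp: Bad_def)
    obtain v where "d v \<noteq> d' v" using dd(3) by blast
    then show ?thesis unfolding dd(4)
      using linD dd by (intro negligible_linear_fibre[of _ v] linear_compose_sub) auto
  qed
  obtain p0 where p0: "b < norm p0" "p0 \<notin> \<Union> Bad" using pick[OF cBad nBad] by blast
  have p0': "d = d'" if "d \<in> D" "d' \<in> D" "d p0 - d' p0 \<in> \<Gamma>" for d d' using p0(2) that by (auto simp: Bad_def)
  have p0nz: "p0 \<noteq> 0" using p0 b(2) by auto
  \<comment> \<open>For \<open>p1\<close> three more things are avoided: congruence with the orbit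
    of \<open>p0\<close>, equality of \<open>p0 \<bullet> p1\<close> and
    \<open>d p0 \<bullet> p1\<close> for some \<open>d \<noteq> id\<close>, and dependence on
    \<open>p0\<close>. The second rules out isometries that fix \<open>p0\<close> and permute the
    orbit of \<open>p1\<close>.\<close>
  define Bad1 where "Bad1 = Bad \<union> (\<lambda>(d, d', \<gamma>). {x. d x = d' p0 + \<gamma>}) ` (D \<times> D \<times> \<Gamma>) \<union>
      (\<lambda>d. {x. (p0 - d p0) \<bullet> x = 0}) ` (D - {id}) \<union> {{x. rot90 p0 \<bullet> x = 0}}"
  have "countable ((\<lambda>(d, d', \<gamma>). {x. d x = d' p0 + \<gamma>}) ` (D \<times> D \<times> \<Gamma>))"
    by (rule countable_image[OF cDG])
  moreover have "countable ((\<lambda>d. {x. (p0 - d p0) \<bullet> x = 0}) ` (D - {id}))"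
    using finD by (intro countable_finite) simp
  ultimately have cBad1: "countable Bad1" unfolding Bad1_def using cBad by simp
  have nBad1: "negligible S" if "S \<in> Bad1" for S
  proof -
    have "negligible {x. d x = y}" if "d \<in> D" for d y
    proof -
      have "norm (d p0) \<noteq> 0" using normD[OF that] p0nz by simp
      then show ?thesis using linD[OF that] by (intro negligible_linear_fibre[of _ p0]) auto
    qed
    moreover have "negligible {x. (p0 - d p0) \<bullet> x = 0}" if "d \<in> D" "d \<noteq> id" for d
    proof -
      have "p0 - d p0 \<noteq> 0" using p0'[OF idD that(1)] that(2) \<Gamma>0 by auto
      then show ?thesis by (intro negligible_hyperplane) simp
    qed
    moreover have "negligible {x. rot90 p0 \<bullet> x = 0}"
    proof -
      have "rot90 p0 \<noteq> 0" using norm_rot90[of p0] p0nz by (metis norm_eq_zero)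
      then show ?thesis by (intro negligible_hyperplane) simp
    qed
    ultimately show ?thesis using that nBad by (auto simp: Bad1_def)
  qed
  obtain p1 where p1: "norm p0 < norm p1" "p1 \<notin> \<Union> Bad1" using pick[OF cBad1 nBad1] by blast
  have p1': "d = d'" if "d \<in> D" "d' \<in> D" "d p1 - d' p1 \<in> \<Gamma>" for d d'
    using p1(2) that by (auto simp: Bad1_def Bad_def)
  have p01: "d p1 - d' p0 \<notin> \<Gamma>" if "d \<in> D" "d' \<in> D" for d d'
  proof
    assume "d p1 - d' p0 \<in> \<Gamma>"
    moreover have "p1 \<in> {x. d x = d' p0 + (d p1 - d' p0)}" by simp
    ultimately show False using p1(2) that unfolding Bad1_def by blast
  qed
  have p1inner: "d = id" if "d \<in> D" "(p0 - d p0) \<bullet> p1 = 0" for d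
    using p1(2) that by (auto simp: Bad1_def)
  have p1area: "area p0 p1 \<noteq> 0" using p1(2) by (auto simp: Bad1_def area_def)
  define N where "N = (\<lambda>d. d p0) ` D \<union> (\<lambda>d. d p1) ` D"
  have finN: "finite N" using finD by (simp add: N_def)
  have ND: "d x \<in> N" if "d \<in> D" "x \<in> N" for d x
  proof -
    have "d (e y) \<in> (\<lambda>d. d y) ` D" if "e \<in> D" for e y using compD[OF \<open>d \<in> D\<close> that] by (metis comp_apply image_eqI)
    then show ?thesis using that(2) by (auto simp: N_def)
  qed
  have Nnorm: "norm x = norm p0 \<or> norm x = norm p1" if "x \<in> N" for x using that normD by (auto simp: N_def)
  have N0: "\<exists>d\<in>D. x = d p0" if "x \<in> N" "norm x = norm p0" for x using that normD p1(1) by (auto simp: N_def)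
  have N1: "\<exists>d\<in>D. x = d p1" if "x \<in> N" "norm x = norm p1" for x using that normD p1(1) by (auto simp: N_def)
  have pN: "p0 \<in> N" "p1 \<in> N" using idD by (auto simp: N_def intro!: image_eqI[of _ _ id])
  have Ndist: "x = y" if xy: "x \<in> N" "y \<in> N" "x - y \<in> \<Gamma>" for x y
  proof -
    consider d d' where "d \<in> D" "d' \<in> D" "x = d p0" "y = d' p0"
      | d d' where "d \<in> D" "d' \<in> D" "x = d p1" "y = d' p1"
      | d d' where "d \<in> D" "d' \<in> D" "x = d p1" "y = d' p0"
      | d d' where "d \<in> D" "d' \<in> D" "x = d p0" "y = d' p1"
      using xy by (auto simp: N_def)
    then show ?thesis
    proof cases
      case 1 then show ?thesis using p0' xy(3) by blast
    next
      case 2 then show ?thesis using p1' xy(3) by blast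
    next
      case 3 then show ?thesis using p01 xy(3) by blast
    next
      case 4 then show ?thesis using p01 eq_sym[OF xy(3)] by blast
    qed
  qed
  have NI: "x \<notin> closure I" if "x \<in> N" for x using Nnorm[OF that] p0(1) p1(1) clb by auto
  define F where "F = closure I \<union> N"
  have cover: "\<exists>\<gamma>\<in>\<Gamma>. x + \<gamma> \<in> closure I" for x
    using closed_translates_cover[OF lf b(1) dense] .
  have clF: "closed F" unfolding F_def using finN by (simp add: closed_Un finite_imp_closed)
  have compF: "compact F"
    using clF I(2) finN by (simp add: F_def compact_eq_bounded_closed finite_imp_bounded bounded_closure)
  \<comment> \<open>The transversal takes \<open>N\<close>, then the points of \<open>I\<close> not
    congruent to \<open>N\<close>, and for the remaining cosets a point of \<open>closure I\<close>.
    The set from which \<open>rep\<close> chooses depends only on the coset, so congruent points get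
    the same representative.\<close>
  define S where "S = {y. (\<forall>n\<in>N. y - n \<notin> \<Gamma>) \<and> (\<forall>i\<in>I. y - i \<notin> \<Gamma>)}"
  define rep where "rep y = (SOME z. z \<in> {z \<in> closure I. z - y \<in> \<Gamma>})" for y
  define E where "E = N \<union> {y \<in> I. \<forall>n\<in>N. y - n \<notin> \<Gamma>} \<union> rep ` S"
  have rep: "rep y \<in> closure I" "rep y - y \<in> \<Gamma>" for y
  proof -
    obtain \<gamma> where "\<gamma> \<in> \<Gamma>" "y + \<gamma> \<in> closure I" using cover by blast
    then have "\<exists>z. z \<in> {z \<in> closure I. z - y \<in> \<Gamma>}" by (intro exI[of _ "y + \<gamma>"]) simp
    then have "rep y \<in> {z \<in> closure I. z - y \<in> \<Gamma>}" unfolding rep_def by (rule someI_ex)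
    then show "rep y \<in> closure I" "rep y - y \<in> \<Gamma>" by auto
  qed
  have rep_eq: "rep x = rep y" if "x - y \<in> \<Gamma>" for x y
  proof -
    have "{z \<in> closure I. z - x \<in> \<Gamma>} = {z \<in> closure I. z - y \<in> \<Gamma>}"
      using eq_trans[OF _ that] eq_trans[OF _ eq_sym[OF that]] by blast
    then show ?thesis by (simp add: rep_def)
  qed
  have E_inj: "x = y" if xy: "x \<in> E" "y \<in> E" "x - y \<in> \<Gamma>" for x y
  proof -
    have key: "x = y" if x: "x \<in> N \<or> x \<in> {y \<in> I. \<forall>n\<in>N. y - n \<notin> \<Gamma>}" and y: "y \<in> E" and "x - y \<in> \<Gamma>" for x y
      using x
    proof
      assume xN: "x \<in> N"
      consider "y \<in> N" | "y \<in> I" "\<forall>n\<in>N. y - n \<notin> \<Gamma>" | s where "s \<in> S" "y = rep s" using y by (auto simp: E_def)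
      then show ?thesis
      proof cases
        case 1 then show ?thesis using Ndist xN that by blast
      next
        case 2 then show ?thesis using xN eq_sym[OF \<open>x - y \<in> \<Gamma>\<close>] by blast
      next
        case 3
        have "s - x \<in> \<Gamma>" using eq_trans[OF eq_sym[OF rep(2)[of s]], of x] 3 eq_sym[OF \<open>x - y \<in> \<Gamma>\<close>] by simp
        then show ?thesis using 3 xN by (auto simp: S_def)
      qed
    next
      assume xI: "x \<in> {y \<in> I. \<forall>n\<in>N. y - n \<notin> \<Gamma>}"
      consider "y \<in> N" | "y \<in> I" "\<forall>n\<in>N. y - n \<notin> \<Gamma>" | s where "s \<in> S" "y = rep s" using y by (auto simp: E_def)
      then show ?thesis
      proof cases
        case 1 then show ?thesis using xI \<open>x - y \<in> \<Gamma>\<close> by blast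
      next
        case 2 then show ?thesis using xI Iinj \<open>x - y \<in> \<Gamma>\<close> by blast
      next
        case 3
        have "s - x \<in> \<Gamma>" using eq_trans[OF eq_sym[OF rep(2)[of s]], of x] 3 eq_sym[OF \<open>x - y \<in> \<Gamma>\<close>] by simp
        then show ?thesis using 3 xI by (auto simp: S_def)
      qed
    qed
    show ?thesis
    proof (cases "x \<in> rep ` S \<and> y \<in> rep ` S")
      case True
      then obtain s s' where s: "x = rep s" "y = rep s'" by blast
      have "s - s' \<in> \<Gamma>"
        using eq_trans[OF eq_trans[OF eq_sym[OF rep(2)[of s]], of "rep s'"] rep(2)[of s']] xy(3) s by simp
      then show ?thesis using rep_eq s by simp
    next
      case False
      then consider "x \<in> N \<or> x \<in> {y \<in> I. \<forall>n\<in>N. y - n \<notin> \<Gamma>}" | "y \<in> N \<or> y \<in> {y \<in> I. \<forall>n\<in>N. y - n \<notin> \<Gamma>}"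
        using xy(1,2) unfolding E_def by blast
      then show ?thesis
      proof cases
        case 1 then show ?thesis using key[OF _ xy(2,3)] by blast
      next
        case 2 then show ?thesis using key[OF _ xy(1) eq_sym[OF xy(3)]] by blast
      qed
    qed
  qed
  have E_ex: "\<exists>y. y \<in> E \<and> y - x \<in> \<Gamma>" for x
  proof -
    consider n where "n \<in> N" "x - n \<in> \<Gamma>" | i where "\<forall>n\<in>N. x - n \<notin> \<Gamma>" "i \<in> I" "x - i \<in> \<Gamma>" | "x \<in> S"
      by (auto simp: S_def)
    then show ?thesis
    proof cases
      case 1 then show ?thesis using eq_sym by (auto simp: E_def)
    next
      case 2
      have "i - n \<notin> \<Gamma>" if "n \<in> N" for n using eq_trans[OF 2(3), of n] 2(1) that by blast
      then show ?thesis using 2 eq_sym by (auto simp: E_def)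
    next
      case 3 then show ?thesis using rep(2)[of x] by (auto simp: E_def)
    qed
  qed
  have clE: "F = closure E"
  proof
    have "E \<subseteq> F" using rep(1) closure_subset by (auto simp: E_def F_def)
    then show "closure E \<subseteq> F" using clF by (simp add: closure_minimal)
    have "x \<in> closure E" if x: "x \<in> closure I" for x
      unfolding closure_approachable
    proof (intro allI impI)
      fix e :: real assume e: "0 < e"
      \<comment> \<open>Only finitely many points of the bounded set \<open>I\<close> are congruent
        to \<open>N\<close>; leaving them out does not change the closure.\<close>
      define A where "A = (\<Union>n\<in>N. (\<lambda>\<gamma>. n + \<gamma>) ` (\<Gamma> \<inter> cball 0 (b + norm n)))"
      have "finite A" using finN lf by (auto simp: A_def)
      then obtain y where y: "y \<in> I" "dist y x < e" "y \<notin> A"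
        using open_ball_minus_finite_nonempty[OF I(1) x e] by blast
      have "y - n \<notin> \<Gamma>" if "n \<in> N" for n
      proof
        assume "y - n \<in> \<Gamma>"
        moreover have "norm (y - n) \<le> b + norm n" using y(1) b(1) norm_triangle_ineq4[of y n] by auto
        ultimately have "n + (y - n) \<in> A" using that unfolding A_def by (intro UN_I[of n] imageI) auto
        then show False using y by simp
      qed
      then show "\<exists>y\<in>E. dist y x < e" using y by (auto simp: E_def)
    qed
    moreover have "N \<subseteq> closure E" using closure_subset by (auto simp: E_def)
    ultimately show "F \<subseteq> closure E" by (auto simp: F_def)
  qed
  have cell: "fundamental_cell \<Gamma> F"
    unfolding fundamental_cell_def
  proof (intro conjI compF ballI impI)
    show "\<exists>E. (\<forall>x. \<exists>!y. y \<in> E \<and> y - x \<in> \<Gamma>) \<and> F = closure E"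
    proof (intro exI[of _ E] conjI allI clE)
      fix x
      obtain y where "y \<in> E \<and> y - x \<in> \<Gamma>" using E_ex by blast
      then show "\<exists>!y. y \<in> E \<and> y - x \<in> \<Gamma>"
        using E_inj eq_trans eq_sym by (intro ex1I[of _ y]) blast+
    qed
    show "(\<Union>g\<in>\<Gamma>. (\<lambda>x. x + g) ` F) = UNIV"
    proof (intro equalityI subsetI UNIV_I)
      fix x :: "real^2"
      obtain \<gamma> where "\<gamma> \<in> \<Gamma>" "x + \<gamma> \<in> closure I" using cover by blast
      then show "x \<in> (\<Union>g\<in>\<Gamma>. (\<lambda>x. x + g) ` F)"
        using \<Gamma>minus by (intro UN_I[of "- \<gamma>"] image_eqI[of _ _ "x + \<gamma>"]) (auto simp: F_def)
    qed
    show "interior ((\<lambda>x. x + g) ` F) \<inter> interior ((\<lambda>x. x + h) ` F) = {}"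
      if gh: "g \<in> \<Gamma>" "h \<in> \<Gamma>" "g \<noteq> h" for g h
    proof (rule ccontr)
      define W where "W = interior ((\<lambda>x. x + g) ` F) \<inter> interior ((\<lambda>x. x + h) ` F)"
      assume "interior ((\<lambda>x. x + g) ` F) \<inter> interior ((\<lambda>x. x + h) ` F) \<noteq> {}"
      then have W: "open W" "W \<noteq> {}" by (auto simp: W_def)
      have Wm: "x - k \<in> F" if "x \<in> W" "k \<in> {g, h}" for x k
        using that interior_subset[of "(\<lambda>x. x + g) ` F"] interior_subset[of "(\<lambda>x. x + h) ` F"] by (auto simp: W_def)
      \<comment> \<open>Away from the finitely many isolated points both tiles are translates of
        \<open>closure I\<close>. Approximating twice, with \<open>I\<close> open, yields two
        congruent points of \<open>I\<close>.\<close>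
      define W1 where "W1 = W - ((\<lambda>x. x + g) ` N \<union> (\<lambda>x. x + h) ` N)"
      have "open W1" unfolding W1_def using W(1) finN by (intro open_Diff finite_imp_closed) auto
      moreover have "W1 \<noteq> {}"
      proof
        assume "W1 = {}"
        then have "finite W" using finN finite_subset[of W "(\<lambda>x. x + g) ` N \<union> (\<lambda>x. x + h) ` N"] by (auto simp: W1_def)
        then show False using W finite_imp_not_open by blast
      qed
      moreover have Wc: "x - k \<in> closure I" if "x \<in> W1" "k \<in> {g, h}" for x k
      proof -
        have "x - k \<notin> N"
        proof
          assume "x - k \<in> N"
          then have "x - k + k \<in> (\<lambda>x. x + k) ` N" by (rule imageI)
          then show False using that by (auto simp: W1_def)
        qed
        then show ?thesis using Wm[of x k] that by (auto simp: W1_def F_def)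
      qed
      ultimately obtain x where x: "x \<in> W1" by blast
      obtain e where e: "e > 0" "ball x e \<subseteq> W1" using x \<open>open W1\<close> open_contains_ball by blast
      have "x - g \<in> closure I" using Wc x by blast
      then obtain y where y: "y \<in> I" "dist y (x - g) < e" using e(1) unfolding closure_approachable by blast
      obtain e2 where e2: "e2 > 0" "ball y e2 \<subseteq> I" using y(1) I(1) open_contains_ball by blast
      have "y + g \<in> ball x e" using y(2) by (simp add: dist_norm norm_minus_commute algebra_simps)
      then have yW: "y + g \<in> W1" using e by blast
      have "y + g - h \<in> closure I" using Wc[OF yW] by blast
      then obtain z where z: "z \<in> I" "dist z (y + g - h) < e2" using e2(1) unfolding closure_approachable by blast
      have "z + h - g \<in> ball y e2" using z(2) by (simp add: dist_norm norm_minus_commute algebra_simps)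
      then have zI: "z + h - g \<in> I" using e2 by blast
      have "z - (z + h - g) \<in> \<Gamma>" using \<Gamma>diff[OF gh(1,2)] by simp
      then have "z = z + h - g" using Iinj[OF z(1) zI] by blast
      then show False using gh(3) by simp
    qed
  qed
  have sym: "carrier (symmetry_group F) = D"
  proof (intro equalityI subsetI)
    fix d assume d: "d \<in> D"
    obtain e where e: "e \<in> D" "d \<circ> e = id" using invD[OF d] by blast
    have de: "d (e x) = x" for x using fun_cong[OF e(2), of x] by simp
    have inv: "d ` A = A" if "\<And>c x. c \<in> D \<Longrightarrow> x \<in> A \<Longrightarrow> c x \<in> A" for A
    proof (intro equalityI subsetI)
      fix x assume "x \<in> A"
      then have "e x \<in> A" using that e by blast
      then have "d (e x) \<in> d ` A" by (rule imageI)
      then show "x \<in> d ` A" by (simp only: de)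
    qed (use that d in blast)
    have "d ` closure I = closure (d ` I)"
      by (rule closure_injective_linear_image) (use linD[OF d] bijD[OF d] bij_is_inj in auto)
    also have "d ` I = I" using I(3) by (rule inv)
    finally have "d ` F = F" using inv[of N] ND by (simp add: F_def image_Un)
    then show "d \<in> carrier (symmetry_group F)"
      using orthD[OF d] by (simp add: symmetry_group_def orthogonal_transformation_isometry)
  next
    fix \<phi> assume "\<phi> \<in> carrier (symmetry_group F)"
    then have iso: "\<And>x y. dist (\<phi> x) (\<phi> y) = dist x y" and im: "\<phi> ` F = F" by (auto simp: symmetry_group_def)
    have bij: "bij \<phi>" using isometry_bij[OF iso] .
    \<comment> \<open>Points of \<open>N\<close> are isolated in \<open>F\<close>, whereas every
      point of \<open>closure I\<close> is a limit of other points of \<open>I\<close>.\<close>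
    have \<phi>N: "\<phi> x \<in> N" if x: "x \<in> N" for x
    proof (rule ccontr)
      assume "\<phi> x \<notin> N"
      moreover have "\<phi> x \<in> F" using im x by (auto simp: F_def)
      ultimately have c: "\<phi> x \<in> closure I" by (auto simp: F_def)
      define K where "K = closure I \<union> (N - {x})"
      have "closed K" using finN by (simp add: K_def closed_Un finite_imp_closed)
      moreover have "x \<in> - K" using NI[OF x] by (simp add: K_def)
      ultimately have "\<exists>e>0. ball x e \<subseteq> - K" using open_Compl open_contains_ball by blast
      then obtain e where e: "e > 0" "ball x e \<inter> F \<subseteq> {x}" by (auto simp: F_def K_def)
      obtain y where y: "y \<in> I" "dist y (\<phi> x) < e" "y \<noteq> \<phi> x"
        using open_ball_minus_finite_nonempty[OF I(1) c e(1), of "{\<phi> x}"] by auto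
      have "y \<in> \<phi> ` F" using im y closure_subset by (auto simp: F_def)
      then obtain z where z: "z \<in> F" "y = \<phi> z" by blast
      then have "z \<in> ball x e" using y(2) iso by (simp add: dist_commute)
      then show False using e z y by blast
    qed
    have \<phi>imN: "\<phi> ` N = N"
      using \<phi>N finN bij by (intro endo_inj_surj) (auto intro: inj_on_subset bij_is_inj)
    define f where "f x = \<phi> x - \<phi> 0" for x
    have f: "orthogonal_transformation f"
      unfolding orthogonal_transformation_isometry using iso by (simp add: f_def dist_norm)
    have linf: "linear f" using f by (rule orthogonal_transformation_linear)
    have s0: "(\<Sum>n\<in>N. n) = 0"
    proof -
      have "(\<Sum>n\<in>N. n) = (\<Sum>n\<in>uminus ` N. n)"
      proof (rule sum.cong)
        have "x \<in> uminus ` N" if "x \<in> N" for x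
          using ND[OF uminusD that] by (intro image_eqI[of _ _ "- x"]) auto
        then show "N = uminus ` N" using ND[OF uminusD] by auto
      qed simp
      also have "\<dots> = (\<Sum>n\<in>N. - n)" by (subst sum.reindex) auto
      finally have "(\<Sum>n\<in>N. n) = - (\<Sum>n\<in>N. n)" by (simp add: sum_negf)
      then have "2 *\<^sub>R (\<Sum>n\<in>N. n) = 0" unfolding scaleR_2 by (metis add.right_inverse)
      then show ?thesis by simp
    qed
    have "(\<Sum>n\<in>N. \<phi> n) = (\<Sum>n\<in>\<phi> ` N. n)"
      using bij by (subst sum.reindex) (auto intro: inj_on_subset bij_is_inj)
    then have "(\<Sum>n\<in>N. f n + \<phi> 0) = 0" using \<phi>imN s0 by (simp add: f_def)
    then have "f (\<Sum>n\<in>N. n) + real (card N) *\<^sub>R \<phi> 0 = 0"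
      by (simp only: sum.distrib linear_sum[OF linf] sum_constant_scaleR)
    then have "\<phi> 0 = 0" using s0 linear_0[OF linf] finN pN by auto
    then have \<phi>f: "\<phi> = f" by (auto simp: f_def)
    have o: "orthogonal_transformation \<phi>" using f \<phi>f by simp
    obtain d where d: "d \<in> D" "\<phi> p0 = d p0"
      using N0[OF \<phi>N[OF pN(1)]] orthogonal_transformation_norm[OF o] by blast
    obtain e where e: "e \<in> D" "e \<circ> d = id" "d \<circ> e = id" using invD[OF d(1)] by blast
    \<comment> \<open>After composition with an inverse from \<open>D\<close>, \<open>p0\<close> is
      fixed and \<open>p1\<close> goes to some \<open>d1 p1\<close>. Since
      \<open>p0 \<bullet> p1\<close> is preserved, the choice of \<open>p1\<close> forces
      \<open>d1 = id\<close>, and a linear map that fixes the basis \<open>p0\<close>,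
      \<open>p1\<close> is the identity.\<close>
    define \<psi> where "\<psi> = e \<circ> \<phi>"
    have o\<psi>: "orthogonal_transformation \<psi>" unfolding \<psi>_def
      by (rule orthogonal_transformation_compose[OF orthD[OF e(1)] o])
    have \<psi>0: "\<psi> p0 = p0" using fun_cong[OF e(2), of p0] d by (simp add: \<psi>_def)
    have "\<psi> p1 \<in> N" using ND[OF e(1) \<phi>N[OF pN(2)]] by (simp add: \<psi>_def)
    then obtain d1 where d1: "d1 \<in> D" "\<psi> p1 = d1 p1"
      using N1 orthogonal_transformation_norm[OF o\<psi>] by blast
    obtain e1 where e1: "e1 \<in> D" "e1 \<circ> d1 = id" "d1 \<circ> e1 = id" using invD[OF d1(1)] by blast
    have "p0 \<bullet> p1 = \<psi> p0 \<bullet> \<psi> p1" using o\<psi> by (simp add: orthogonal_transformation_def)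
    also have "\<dots> = d1 (e1 p0) \<bullet> d1 p1" using \<psi>0 d1 fun_cong[OF e1(3), of p0] by simp
    also have "\<dots> = e1 p0 \<bullet> p1" using orthD[OF d1(1)] by (simp add: orthogonal_transformation_def)
    finally have "(p0 - e1 p0) \<bullet> p1 = 0" by (simp add: inner_diff_left)
    then have "e1 = id" using p1inner[OF e1(1)] by blast
    then have \<psi>1: "\<psi> p1 = p1" using e1(2) d1(2) by simp
    have "\<psi> x = x" for x
    proof -
      have lin: "linear \<psi>" using o\<psi> by (rule orthogonal_transformation_linear)
      have x: "x = (area x p1 / area p0 p1) *\<^sub>R p0 + (area p0 x / area p0 p1) *\<^sub>R p1"
        by (rule plane_coordinates[OF p1area])
      have "\<psi> ((area x p1 / area p0 p1) *\<^sub>R p0 + (area p0 x / area p0 p1) *\<^sub>R p1) =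
          (area x p1 / area p0 p1) *\<^sub>R p0 + (area p0 x / area p0 p1) *\<^sub>R p1"
        by (simp only: linear_add[OF lin] linear_cmul[OF lin] \<psi>0 \<psi>1)
      then show ?thesis using x by simp
    qed
    then have "d (e (\<phi> x)) = d x" for x by (simp add: \<psi>_def)
    then have "\<phi> x = d x" for x using fun_cong[OF e(3), of "\<phi> x"] by simp
    then have "\<phi> = d" by blast
    then show "\<phi> \<in> D" using d by simp
  qed
  show thesis using that cell sym by blast
qed

section \<open>Classification of lattices that are not rhombic\<close>

lemma lattice_basis_iff_area:
  fixes b :: "2 \<Rightarrow> real^2"
  shows "lattice_basis b \<Gamma> \<longleftrightarrow> area (b 1) (b 2) \<noteq> 0 \<and> \<Gamma> = lat (b 1) (b 2)"
proof -
  have r: "range b = {b 1, b 2}" by (auto simp: UNIV_2)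
  have "inj b \<and> independent (range b) \<longleftrightarrow> area (b 1) (b 2) \<noteq> 0"
  proof
    assume *: "inj b \<and> independent (range b)"
    then have ne: "b 1 \<noteq> b 2" using inj_eq[of b 1 2] by simp
    have ind: "independent {b 1, b 2}" using * r by simp
    then have nz: "b 2 \<noteq> 0" using dependent_zero[of "{b 1, b 2}"] by auto
    have ns: "b 1 \<notin> span {b 2}" using ind ne by (simp add: independent_insert)
    show "area (b 1) (b 2) \<noteq> 0"
    proof
      assume "area (b 1) (b 2) = 0"
      then have "(b 2 \<bullet> b 2) *\<^sub>R b 1 = (b 1 \<bullet> b 2) *\<^sub>R b 2"
        by (simp add: vec2_eq_iff inner_vec2 area_nth algebra_simps)
      then have "b 1 = ((b 1 \<bullet> b 2) / (b 2 \<bullet> b 2)) *\<^sub>R b 2"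
        using nz by (metis (no_types, lifting) divide_inverse_commute inner_eq_zero_iff left_inverse scaleR_one scaleR_scaleR)
      then show False using ns by (metis span_singleton rangeI)
    qed
  next
    assume a: "area (b 1) (b 2) \<noteq> 0"
    then have ne: "b 1 \<noteq> b 2" "b 2 \<noteq> 0" by (auto simp: area_nth)
    have "inj b"
    proof (rule injI)
      fix x y assume "b x = b y"
      then show "x = y" using ne(1) exhaust_2[of x] exhaust_2[of y] by auto
    qed
    moreover have "b 1 \<notin> span {b 2}"
    proof
      assume "b 1 \<in> span {b 2}"
      then obtain k where "b 1 = k *\<^sub>R b 2" by (auto simp: span_singleton)
      then show False using a by (simp add: area_linear)
    qed
    ultimately show "inj b \<and> independent (range b)"
      using ne by (simp add: r independent_insert dependent_single)
  qed
  moreover have "{(\<Sum>i\<in>UNIV. of_int (c i) *\<^sub>R b i) | c :: 2 \<Rightarrow> int. True} = lat (b 1) (b 2)"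
  proof (intro equalityI subsetI)
    fix x assume "x \<in> {(\<Sum>i\<in>UNIV. of_int (c i) *\<^sub>R b i) | c :: 2 \<Rightarrow> int. True}"
    then show "x \<in> lat (b 1) (b 2)" by (auto simp: sum_2 intro: latI)
  next
    fix x assume "x \<in> lat (b 1) (b 2)"
    then obtain i j where "x = of_int i *\<^sub>R b 1 + of_int j *\<^sub>R b 2" by (auto simp: lat_def)
    then show "x \<in> {(\<Sum>i\<in>UNIV. of_int (c i) *\<^sub>R b i) | c :: 2 \<Rightarrow> int. True}"
      by (intro CollectI exI[of _ "\<lambda>k. if k = 1 then i else j"]) (simp add: sum_2)
  qed
  ultimately show ?thesis unfolding lattice_basis_def by auto
qed

text \<open>The three angles exempted in \<open>rhombic\<close> are those with cosine 1/2, 0 and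
  -1/2.\<close>

lemma equal_norm_basis_of_nonrhombic:
  assumes "area x y \<noteq> 0" "norm x = norm y" "\<not> rhombic (lat x y)"
  shows "x \<bullet> y = 0 \<or> x \<bullet> y = (norm x)\<^sup>2 / 2 \<or> x \<bullet> y = - ((norm x)\<^sup>2 / 2)"
proof -
  define b :: "2 \<Rightarrow> real^2" where "b i = (if i = 1 then x else y)" for i
  have b: "b 1 = x" "b 2 = y" by (auto simp: b_def)
  have "lattice_basis b (lat x y)" using assms(1) by (simp add: lattice_basis_iff_area b)
  then have ang: "vec_angle x y \<in> {pi / 3, pi / 2, 2 * pi / 3}"
    using assms(2,3) unfolding rhombic_def using b by metis
  define c where "c = x \<bullet> y / (norm x * norm y)"
  have nz: "norm x > 0" using assms(1) by (cases "x = 0") (auto simp: area_nth)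
  have "\<bar>x \<bullet> y\<bar> \<le> norm x * norm y" by (rule Cauchy_Schwarz_ineq2)
  then have "\<bar>c\<bar> \<le> 1" using nz assms(2) by (simp add: c_def divide_le_eq)
  then have "cos (vec_angle x y) = c" unfolding vec_angle_def c_def[symmetric] by (simp add: abs_le_iff cos_arccos)
  moreover have "cos (vec_angle x y) = 1/2 \<or> cos (vec_angle x y) = 0 \<or> cos (vec_angle x y) = - 1/2"
    using ang unfolding insert_iff empty_iff by (elim disjE) (simp_all only: cos_60 cos_120 cos_pi_half simp_thms)
  ultimately have "c \<in> {1/2, 0, - 1/2}" by auto
  moreover have "x \<bullet> y = c * (norm x)\<^sup>2" using nz assms(2) by (simp add: c_def power2_eq_square)
  ultimately show ?thesis by auto
qed

lemma shortest_vector: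
  fixes L S :: "'a::real_normed_vector set"
  assumes lf: "\<And>r. finite (L \<inter> cball 0 r)" and S: "S \<subseteq> L" "S \<noteq> {}"
  obtains x where "x \<in> S" "\<And>y. y \<in> S \<Longrightarrow> norm x \<le> norm y"
proof -
  obtain s where s: "s \<in> S" using S by blast
  let ?A = "S \<inter> cball 0 (norm s)"
  have "finite ?A" using lf[of "norm s"] S by (rule_tac finite_subset[of _ "L \<inter> cball 0 (norm s)"]) auto
  moreover have "?A \<noteq> {}" using s by auto
  ultimately obtain x where x: "is_arg_min norm (\<lambda>x. x \<in> ?A) x" using ex_is_arg_min_if_finite by metis
  have "norm x \<le> norm y" if "y \<in> S" for y
    using x that s by (cases "norm y \<le> norm s") (auto simp: is_arg_min_linorder)
  moreover have "x \<in> S" using x by (auto simp: is_arg_min_linorder)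
  ultimately show thesis using that by blast
qed

text \<open>Gauss reduction: the successive minima of a planar lattice form a basis. After rounding,
  both coordinates of the remainder are at most 1/2 in absolute value. The triangle inequality,
  strict for independent vectors, makes the remainder shorter than \<open>w\<close>, so it is a
  multiple of \<open>v\<close>; minimality of \<open>v\<close> then makes it zero.\<close>

lemma reduced_basis:
  assumes \<Gamma>diff: "\<And>x y. x \<in> \<Gamma> \<Longrightarrow> y \<in> \<Gamma> \<Longrightarrow> x - y \<in> \<Gamma>" and \<Gamma>0: "0 \<in> \<Gamma>"
    and v: "v \<in> \<Gamma>" "\<And>x. x \<in> \<Gamma> \<Longrightarrow> x \<noteq> 0 \<Longrightarrow> norm v \<le> norm x"
    and w: "w \<in> \<Gamma>" "area v w \<noteq> 0" "\<And>x. x \<in> \<Gamma> \<Longrightarrow> area v x \<noteq> 0 \<Longrightarrow> norm w \<le> norm x"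
  shows "\<Gamma> = lat v w"
proof -
  have minus: "- x \<in> \<Gamma>" if "x \<in> \<Gamma>" for x using \<Gamma>diff[OF \<Gamma>0 that] by simp
  have add: "x + y \<in> \<Gamma>" if "x \<in> \<Gamma>" "y \<in> \<Gamma>" for x y using \<Gamma>diff[OF that(1) minus[OF that(2)]] by simp
  have nat_mult: "of_nat n *\<^sub>R x \<in> \<Gamma>" if "x \<in> \<Gamma>" for n and x :: "real^2"
    by (induction n) (use that \<Gamma>0 add in \<open>auto simp: scaleR_add_left\<close>)
  have int_mult: "of_int i *\<^sub>R x \<in> \<Gamma>" if "x \<in> \<Gamma>" for i and x :: "real^2"
    using nat_mult[OF that, of "nat i"] minus[OF nat_mult[OF that, of "nat (- i)"]] by (cases "i \<ge> 0") auto
  have sub: "lat v w \<subseteq> \<Gamma>" using add int_mult v(1) w(1) by (auto simp: lat_def)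
  have nz: "v \<noteq> 0" "w \<noteq> 0" using w(2) by (auto simp: area_nth)
  have vw: "norm v \<le> norm w" using v(2) w(1) nz by blast
  have "x \<in> lat v w" if x: "x \<in> \<Gamma>" for x
  proof -
    define s t where "s = area x w / area v w" and "t = area v x / area v w"
    define s' t' where "s' = s - of_int (round s)" and "t' = t - of_int (round t)"
    define y where "y = of_int (round s) *\<^sub>R v + of_int (round t) *\<^sub>R w"
    define x' where "x' = x - y"
    have yl: "y \<in> lat v w" unfolding y_def by (rule latI)
    have x': "x' \<in> \<Gamma>" using \<Gamma>diff x yl sub by (auto simp: x'_def)
    have x'eq: "x' = s' *\<^sub>R v + t' *\<^sub>R w"
      using plane_coordinates[OF w(2), of x] by (simp add: x'_def y_def s'_def t'_def s_def t_def algebra_simps)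
    have st: "\<bar>s'\<bar> \<le> 1/2" "\<bar>t'\<bar> \<le> 1/2"
      using of_int_round_abs_le[of s] of_int_round_abs_le[of t] by (auto simp: s'_def t'_def abs_minus_commute)
    have t0: "t' = 0"
    proof (rule ccontr)
      assume t': "t' \<noteq> 0"
      then have "area v x' \<noteq> 0" using w(2) by (simp add: x'eq area_linear)
      then have wle: "norm w \<le> norm x'" using w(3) x' by blast
      have le: "\<bar>s'\<bar> * norm v + \<bar>t'\<bar> * norm w \<le> norm w"
        using mult_right_mono[OF st(1) norm_ge_zero[of v]] mult_right_mono[OF st(2) norm_ge_zero[of w]] vw by simp
      show False
      proof (cases "s' = 0")
        case True
        have "norm x' \<le> (1/2) * norm w" using mult_right_mono[OF st(2) norm_ge_zero[of w]] by (simp add: x'eq True)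
        moreover have "0 < norm w" using nz by simp
        ultimately show False using wle by linarith
      next
        case False
        have "norm x' \<le> \<bar>s'\<bar> * norm v + \<bar>t'\<bar> * norm w"
          using norm_triangle_ineq[of "s' *\<^sub>R v" "t' *\<^sub>R w"] by (simp add: x'eq)
        then have "norm x' = norm (s' *\<^sub>R v) + norm (t' *\<^sub>R w)" using le wle by simp
        then have "norm (s' *\<^sub>R v) *\<^sub>R (t' *\<^sub>R w) = norm (t' *\<^sub>R w) *\<^sub>R (s' *\<^sub>R v)"
          unfolding x'eq by (simp only: norm_triangle_eq)
        then have "area (s' *\<^sub>R v) (norm (s' *\<^sub>R v) *\<^sub>R (t' *\<^sub>R w)) = area (s' *\<^sub>R v) (norm (t' *\<^sub>R w) *\<^sub>R (s' *\<^sub>R v))" by simp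
        then show False using False t' w(2) nz by (simp add: area_linear)
      qed
    qed
    have "x' = 0"
    proof (rule ccontr)
      assume "x' \<noteq> 0"
      then have "norm v \<le> norm x'" using v(2) x' by blast
      moreover have "norm x' \<le> (1/2) * norm v"
        using mult_right_mono[OF st(1) norm_ge_zero[of v]] by (simp add: x'eq t0)
      moreover have "0 < norm v" using nz by simp
      ultimately show False by linarith
    qed
    then show ?thesis using yl by (simp add: x'_def)
  qed
  then show ?thesis using sub by blast
qed

text \<open>The squared area is a Gram determinant and so depends on inner products only.\<close>

lemma orthogonal_area_squared:
  assumes "orthogonal_transformation f"
  shows "(area (f x) (f y))\<^sup>2 = (area x y)\<^sup>2"
proof -
  have id: "(area x y)\<^sup>2 = (x \<bullet> x) * (y \<bullet> y) - (x \<bullet> y)\<^sup>2" for x y :: "real^2"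
    by (simp add: area_nth inner_vec2 power2_eq_square algebra_simps)
  show ?thesis unfolding id using assms by (simp add: orthogonal_transformation_def)
qed

lemma linear_eq_on_basis:
  fixes x :: "real^2"
  assumes "area u v \<noteq> 0" "linear f" "linear g" "f u = g u" "f v = g v"
  shows "f x = g x"
proof -
  have "f ((area x v / area u v) *\<^sub>R u + (area u x / area u v) *\<^sub>R v) = g ((area x v / area u v) *\<^sub>R u + (area u x / area u v) *\<^sub>R v)"
    using assms by (simp only: linear_add linear_cmul)
  then show ?thesis by (simp only: plane_coordinates[OF assms(1), of x, symmetric])
qed

lemma lat_unimodular:
  "lat w (w - of_int i *\<^sub>R v) = lat v w" if "i = 1 \<or> i = - 1" for i :: int
proof (intro equalityI subsetI)
  fix x assume "x \<in> lat w (w - of_int i *\<^sub>R v)"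
  then obtain k l :: int where "x = of_int k *\<^sub>R w + of_int l *\<^sub>R (w - of_int i *\<^sub>R v)" by (auto simp: lat_def)
  then have "x = of_int (- l * i) *\<^sub>R v + of_int (k + l) *\<^sub>R w" by (simp add: algebra_simps)
  then show "x \<in> lat v w" using latI by metis
next
  fix x assume "x \<in> lat v w"
  then obtain k l :: int where "x = of_int k *\<^sub>R v + of_int l *\<^sub>R w" by (auto simp: lat_def)
  then have "x = of_int (l + i * k) *\<^sub>R w + of_int (- i * k) *\<^sub>R (w - of_int i *\<^sub>R v)"
    using that by (auto simp: algebra_simps)
  then show "x \<in> lat w (w - of_int i *\<^sub>R v)" using latI by metis
qed

lemma lat_minus: "lat u (- v) = lat u v"
proof -
  have "lat u (- v) \<subseteq> lat u v" for u v
  proof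
    fix x assume "x \<in> lat u (- v)"
    then obtain k l :: int where "x = of_int k *\<^sub>R u + of_int l *\<^sub>R (- v)" by (auto simp: lat_def)
    then have "x = of_int k *\<^sub>R u + of_int (- l) *\<^sub>R v" by simp
    then show "x \<in> lat u v" using latI by metis
  qed
  from this[of u v] this[of u "- v"] show ?thesis by simp
qed

lemma lat_commute: "lat u v = lat v u"
  unfolding lat_def by (metis add.commute)

text \<open>An element \<open>f\<close> of the point group other than \<open>id\<close> and
  \<open>uminus\<close> is tested on a shortest vector \<open>v\<close>. If \<open>f v\<close> is
  independent of \<open>v\<close>, both form a basis of equal norms. Otherwise \<open>f\<close> or
  its negative is the reflection in the line of \<open>v\<close>. It maps the second minimum
  \<open>w\<close> to \<open>i v - w\<close>, and minimality of \<open>w\<close> leaves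
  \<open>i = 0\<close>, the rectangular case, or \<open>i = 1, -1\<close>. In the latter case
  \<open>w\<close> and \<open>w - i v\<close> are a basis of equal norms. For such bases, not being
  rhombic leaves only three angles.\<close>

theorem nonrhombic_lattice_cases:
  assumes "is_lattice \<Gamma>" "\<not> rhombic \<Gamma>"
  obtains (oblique) u v where "area u v \<noteq> 0" "\<Gamma> = lat u v" "point_group \<Gamma> \<subseteq> {id, uminus}"
  | (rectangular) u v where "area u v \<noteq> 0" "\<Gamma> = lat u v" "u \<bullet> v = 0"
  | (hexagonal) u v where "area u v \<noteq> 0" "\<Gamma> = lat u v" "norm u = norm v" "u \<bullet> v = (norm u)\<^sup>2 / 2"
proof -
  obtain u0 v0 where uv: "area u0 v0 \<noteq> 0" "\<Gamma> = lat u0 v0"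
    using assms(1) unfolding is_lattice_def lattice_basis_iff_area by blast
  have lf: "finite (\<Gamma> \<inter> cball 0 r)" for r using finite_lat_cball[OF uv(1)] uv(2) by simp
  have \<Gamma>0: "0 \<in> \<Gamma>" and \<Gamma>diff: "\<And>x y. x \<in> \<Gamma> \<Longrightarrow> y \<in> \<Gamma> \<Longrightarrow> x - y \<in> \<Gamma>"
    unfolding uv(2) by (auto intro: zero_in_lat diff_in_lat)
  have equal: thesis if xy: "area x y \<noteq> 0" "\<Gamma> = lat x y" "norm x = norm y" for x y
  proof -
    consider "x \<bullet> y = 0" | "x \<bullet> y = (norm x)\<^sup>2 / 2" | "x \<bullet> y = - ((norm x)\<^sup>2 / 2)"
      using equal_norm_basis_of_nonrhombic[of x y] xy assms(2) by blast
    then show thesis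
    proof cases
      case 1 then show thesis using rectangular xy by blast
    next
      case 2 then show thesis using hexagonal xy by blast
    next
      case 3
      have "area x (- y) \<noteq> 0" using xy(1) by (simp add: area_nth)
      then show thesis using hexagonal[of x "- y"] xy 3 by (simp add: lat_minus)
    qed
  qed
  show thesis
  proof (cases "point_group \<Gamma> \<subseteq> {id, uminus}")
    case True then show thesis using oblique uv by blast
  next
    case False
    then obtain f where f: "orthogonal_transformation f" "f ` \<Gamma> = \<Gamma>" "f \<noteq> id" "f \<noteq> uminus"
      by (auto simp: point_group_def)
    have "u0 \<noteq> 0" using uv(1) by (auto simp: area_nth)
    then have "\<Gamma> - {0} \<noteq> {}" using basis_in_lat(1)[of u0 v0] uv(2) by blast
    then obtain v where v: "v \<in> \<Gamma> - {0}" "\<And>x. x \<in> \<Gamma> - {0} \<Longrightarrow> norm v \<le> norm x"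
      using shortest_vector[of \<Gamma> "\<Gamma> - {0}"] lf by (metis Diff_subset)
    have v\<Gamma>: "v \<in> \<Gamma>" "v \<noteq> 0" and vmin: "\<And>x. x \<in> \<Gamma> \<Longrightarrow> x \<noteq> 0 \<Longrightarrow> norm v \<le> norm x"
      using v by auto
    have lin: "linear f" and nf: "\<And>x. norm (f x) = norm x"
      using f(1) orthogonal_transformation_linear orthogonal_transformation_norm by blast+
    show thesis
    proof (cases "area v (f v) = 0")
      case False
      have fv: "f v \<in> \<Gamma>" using f(2) v\<Gamma> by blast
      have "\<Gamma> = lat v (f v)"
      proof (rule reduced_basis[OF \<Gamma>diff \<Gamma>0 v\<Gamma>(1) vmin fv False])
        show "norm (f v) \<le> norm x" if "x \<in> \<Gamma>" "area v x \<noteq> 0" for x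
          using vmin[OF that(1)] that(2) nf by (cases "x = 0") (auto simp: area_nth)
      qed auto
      then show thesis using equal[of v "f v"] False nf by simp
    next
      case True
      have "(v \<bullet> v) *\<^sub>R f v = (f v \<bullet> v) *\<^sub>R v"
        using True by (simp add: vec2_eq_iff inner_vec2 area_nth algebra_simps)
      then have fv: "f v = ((f v \<bullet> v) / (v \<bullet> v)) *\<^sub>R v"
        using v\<Gamma>(2) by (metis (no_types, lifting) divide_inverse_commute inner_eq_zero_iff left_inverse scaleR_one scaleR_scaleR)
      define k where "k = (f v \<bullet> v) / (v \<bullet> v)"
      have "\<bar>k\<bar> * norm v = norm v" using nf[of v] fv k_def by (metis norm_scaleR)
      then have k: "k = 1 \<or> k = - 1" using v\<Gamma>(2) by (simp add: abs_eq_iff')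
      define g where "g x = k *\<^sub>R f x" for x
      have gv: "g v = v" using fv k by (auto simp: g_def k_def[symmetric])
      have ling: "linear g" unfolding g_def[abs_def] by (rule linear_compose_scale_right[OF lin])
      then have og: "orthogonal_transformation g"
        using f(1) k by (auto simp: g_def orthogonal_transformation_def)
      have g\<Gamma>: "g x \<in> \<Gamma>" if "x \<in> \<Gamma>" for x
      proof -
        have "f x \<in> \<Gamma>" using f(2) that by blast
        then show ?thesis using k \<Gamma>diff[OF \<Gamma>0, of "f x"] by (auto simp: g_def)
      qed
      have gid: "g \<noteq> id"
      proof
        assume g: "g = id"
        from k show False
        proof
          assume "k = 1" then have "f = id" using g by (auto simp: g_def fun_eq_iff)
          then show False using f by blast
        next
          assume "k = - 1" then have "f x = - x" for x using fun_cong[OF g, of x] by (simp add: g_def minus_equation_iff)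
          then show False using f by auto
        qed
      qed
      obtain w0 where w0: "w0 \<in> \<Gamma>" "area v w0 \<noteq> 0"
      proof -
        have "area v u0 \<noteq> 0 \<or> area v v0 \<noteq> 0"
        proof (rule ccontr)
          assume "\<not> ?thesis"
          then have "area u0 v = 0" "area v v0 = 0" by (auto simp: area_nth mult.commute)
          then have "v = 0" using plane_coordinates[OF uv(1), of v] by simp
          then show False using v\<Gamma> by blast
        qed
        then show thesis using that basis_in_lat uv(2) by blast
      qed
      have "\<exists>w\<in>{x \<in> \<Gamma>. area v x \<noteq> 0}. \<forall>x\<in>{x \<in> \<Gamma>. area v x \<noteq> 0}. norm w \<le> norm x"
        by (rule shortest_vector[of \<Gamma> "{x \<in> \<Gamma>. area v x \<noteq> 0}"]) (use lf w0 in blast)+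
      then obtain w where w: "w \<in> {x \<in> \<Gamma>. area v x \<noteq> 0}" "\<And>x. x \<in> {x \<in> \<Gamma>. area v x \<noteq> 0} \<Longrightarrow> norm w \<le> norm x"
        by blast
      have w\<Gamma>: "w \<in> \<Gamma>" "area v w \<noteq> 0" and wmin: "\<And>x. x \<in> \<Gamma> \<Longrightarrow> area v x \<noteq> 0 \<Longrightarrow> norm w \<le> norm x"
        using w by auto
      have \<Gamma>: "\<Gamma> = lat v w" by (rule reduced_basis[OF \<Gamma>diff \<Gamma>0 v\<Gamma>(1) vmin w\<Gamma> wmin])
      obtain i j :: int where ij: "g w = of_int i *\<^sub>R v + of_int j *\<^sub>R w"
        using g\<Gamma>[OF w\<Gamma>(1)] unfolding \<Gamma> by (auto simp: lat_def)
      have "(area v (g w))\<^sup>2 = (area v w)\<^sup>2" using orthogonal_area_squared[OF og, of v w] gv by simp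
      then have "(of_int j)\<^sup>2 * (area v w)\<^sup>2 = 1 * (area v w)\<^sup>2" by (simp add: ij area_linear power_mult_distrib)
      then have "(of_int j :: real)\<^sup>2 = 1" using w\<Gamma>(2) by simp
      then have j: "j = 1 \<or> j = - 1" by (simp add: power2_eq_1_iff) (metis of_int_1 of_int_eq_iff of_int_minus)
      have "v \<bullet> g w = v \<bullet> w" using og gv unfolding orthogonal_transformation_def by metis
      then have inner: "of_int i * (v \<bullet> v) + of_int j * (v \<bullet> w) = v \<bullet> w" by (simp add: ij inner_add_right)
      have vv: "v \<bullet> v > 0" using v\<Gamma>(2) by simp
      have j1: "j = - 1"
      proof (rule ccontr)
        assume "j \<noteq> - 1"
        then have "j = 1" using j by blast
        then have "i = 0" using inner vv by simp
        then have "g w = w" using ij \<open>j = 1\<close> by simp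
        then have "g x = id x" for x
          using linear_eq_on_basis[OF w\<Gamma>(2) ling linear_id] gv by simp
        then show False using gid by blast
      qed
      have i2: "of_int i * (v \<bullet> v) = 2 * (v \<bullet> w)" using inner j1 by simp
      have "norm w \<le> norm (w - v)" "norm w \<le> norm (w + v)"
        using wmin \<Gamma>diff[OF w\<Gamma>(1) v\<Gamma>(1)] \<Gamma>diff[OF w\<Gamma>(1) \<Gamma>diff[OF \<Gamma>0 v\<Gamma>(1)]] w\<Gamma>(2) by (auto simp: area_linear)
      then have "w \<bullet> w \<le> (w - v) \<bullet> (w - v)" "w \<bullet> w \<le> (w + v) \<bullet> (w + v)" by (simp_all add: norm_le)
      then have "\<bar>2 * (v \<bullet> w)\<bar> \<le> v \<bullet> v" by (simp add: inner_diff inner_add inner_commute abs_le_iff algebra_simps)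
      then have "\<bar>of_int i\<bar> * (v \<bullet> v) \<le> 1 * (v \<bullet> v)" using i2 vv by (metis abs_mult abs_of_pos mult_1)
      then have "\<bar>of_int i :: real\<bar> \<le> 1" using vv mult_le_cancel_right by (metis not_less)
      then have "i = 0 \<or> i = 1 \<or> i = - 1" by linarith
      then show thesis
      proof
        assume "i = 0"
        then have "v \<bullet> w = 0" using i2 by simp
        then show thesis using rectangular \<Gamma> w\<Gamma> by blast
      next
        assume i: "i = 1 \<or> i = - 1"
        define w2 where "w2 = w - of_int i *\<^sub>R v"
        have "w2 \<bullet> w2 = w \<bullet> w - of_int i * (2 * (v \<bullet> w)) + (of_int i)\<^sup>2 * (v \<bullet> v)"
          by (simp add: w2_def inner_diff inner_commute algebra_simps power2_eq_square)
        also have "\<dots> = w \<bullet> w" using i i2 by (auto simp: power2_eq_square)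
        finally have "norm w = norm w2" by (simp add: norm_eq)
        moreover have "area w w2 \<noteq> 0" using w\<Gamma>(2) i by (auto simp: w2_def area_nth algebra_simps)
        moreover have "\<Gamma> = lat w w2" using lat_unimodular[OF i, of w v] \<Gamma> by (simp add: w2_def)
        ultimately show thesis using equal by blast
      qed
    qed
  qed
qed

section \<open>The extension of the point group\<close>

text \<open>For \<open>a \<noteq> 0\<close> the exponent of \<open>p\<close> would be odd on the
  left and even on the right.\<close>

lemma prime_times_square_eq_square:
  fixes a b :: int
  assumes "prime p" "p * a\<^sup>2 = b\<^sup>2"
  shows "a = 0"
proof (rule ccontr)
  assume a: "a \<noteq> 0"
  have p: "prime_elem p" "p \<noteq> 0" using assms(1) by auto
  have b: "b \<noteq> 0" using assms a p by auto
  have "multiplicity p (p * a\<^sup>2) = 1 + 2 * multiplicity p a"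
    using a p by (simp add: prime_elem_multiplicity_mult_distrib prime_elem_multiplicity_power_distrib)
  moreover have "multiplicity p (b\<^sup>2) = 2 * multiplicity p b"
    using b p by (simp add: prime_elem_multiplicity_power_distrib)
  ultimately have "1 + 2 * multiplicity p a = 2 * multiplicity p b" using assms(2) by simp
  then show False by presburger
qed

text \<open>Irrationality of the square root of a prime, in the form that excludes common vectors of
  a lattice and its rotated image.\<close>

lemma sqrt_prime_mult_int:
  fixes a b p :: int
  assumes "prime p" "sqrt (of_int p) * of_int a = of_int b"
  shows "a = 0" "b = 0"
proof -
  have "0 \<le> p" using assms(1) prime_ge_0_int by blast
  then have "of_int p * (of_int a)\<^sup>2 = (of_int b :: real)\<^sup>2"
    using arg_cong[OF assms(2), of "\<lambda>x. x\<^sup>2"] by (simp add: power_mult_distrib)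
  then have "p * a\<^sup>2 = b\<^sup>2" by (metis of_int_eq_iff of_int_mult of_int_power)
  then show a: "a = 0" using prime_times_square_eq_square[OF assms(1)] by blast
  then show "b = 0" using assms(2) by simp
qed

section \<open>Rotations of the plane\<close>

text \<open>In complex notation, multiplication by \<open>C + i S\<close>; \<open>rot_rot\<close> is
  the product of complex numbers.\<close>

definition rot :: "real \<Rightarrow> real \<Rightarrow> real^2 \<Rightarrow> real^2" where
  "rot C S x = C *\<^sub>R x + S *\<^sub>R rot90 x"

lemma rot_nth [simp]: "rot C S x $ 1 = C * x $ 1 - S * x $ 2" "rot C S x $ 2 = C * x $ 2 + S * x $ 1"
  by (simp_all add: rot_def)

lemma rot_0_1: "rot 0 1 = rot90"
  by (rule ext) (simp add: rot_def)

lemma rot_rot: "rot C S (rot C' S' x) = rot (C * C' - S * S') (C * S' + S * C') x"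
  by (simp add: vec2_eq_iff algebra_simps)

lemma linear_rot: "linear (rot C S)"
  by (rule linearI) (simp_all add: vec2_eq_iff algebra_simps)

lemma orthogonal_rot:
  assumes "C\<^sup>2 + S\<^sup>2 = 1"
  shows "orthogonal_transformation (rot C S)"
proof -
  have "rot C S x \<bullet> rot C S y = (C\<^sup>2 + S\<^sup>2) * (x \<bullet> y)" for x y
    by (simp add: inner_vec2 algebra_simps power2_eq_square)
  then show ?thesis using assms linear_rot by (simp add: orthogonal_transformation_def)
qed

lemma rot_inj:
  assumes "rot C S u = rot C' S' u" "u \<noteq> 0"
  shows "C = C'" "S = S'"
proof -
  have *: "rot C S u \<bullet> u = C * (u \<bullet> u)" "rot C S u \<bullet> rot90 u = S * (u \<bullet> u)" for C S
    by (simp_all add: inner_vec2 algebra_simps)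
  have "u \<bullet> u \<noteq> 0" using assms(2) by simp
  moreover have "C * (u \<bullet> u) = C' * (u \<bullet> u)" "S * (u \<bullet> u) = S' * (u \<bullet> u)"
    using assms(1) *[of C S] *[of C' S'] by metis+
  ultimately show "C = C'" "S = S'" by simp_all
qed

lemma orthogonal_vectors_rot90:
  assumes "a \<bullet> b = 0" "norm a = norm b" "a \<noteq> 0"
  shows "b = rot90 a \<or> b = - rot90 a"
proof -
  have "(a \<bullet> a) *\<^sub>R b = (a \<bullet> b) *\<^sub>R a + area a b *\<^sub>R rot90 a"
    by (simp add: vec2_eq_iff inner_vec2 area_nth algebra_simps)
  then have ab: "(a \<bullet> a) *\<^sub>R b = area a b *\<^sub>R rot90 a" using assms(1) by simp
  have "(area a b)\<^sup>2 = (a \<bullet> a) * (b \<bullet> b) - (a \<bullet> b)\<^sup>2"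
    by (simp add: area_nth inner_vec2 power2_eq_square algebra_simps)
  also have "\<dots> = (a \<bullet> a)\<^sup>2" using assms(1,2) by (simp add: power2_norm_eq_inner[symmetric] power2_eq_square)
  finally have "area a b = a \<bullet> a \<or> area a b = - (a \<bullet> a)" by (simp add: power2_eq_iff)
  then show ?thesis
  proof
    assume "area a b = a \<bullet> a"
    then have "(a \<bullet> a) *\<^sub>R b = (a \<bullet> a) *\<^sub>R rot90 a" using ab by simp
    then show ?thesis using assms(3) by simp
  next
    assume "area a b = - (a \<bullet> a)"
    then have "(a \<bullet> a) *\<^sub>R b = (a \<bullet> a) *\<^sub>R (- rot90 a)" using ab by simp
    then show ?thesis using assms(3) by (simp only: scaleR_cancel_left) auto
  qed
qed

text \<open>An orthogonal map of the plane is complex linear or complex antilinear; this is read off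
  from the images of one orthonormal pair.\<close>

lemma orthogonal_rot90_commute:
  assumes f: "orthogonal_transformation f"
  shows "(\<forall>x. f (rot90 x) = rot90 (f x)) \<or> (\<forall>x. f (rot90 x) = - rot90 (f x))"
proof -
  define e :: "real^2" where "e = axis 1 1"
  have lin: "linear f" using f by (rule orthogonal_transformation_linear)
  have e: "e \<noteq> 0" by (simp add: e_def)
  have x: "x = rot (x $ 1) (x $ 2) e" for x by (simp add: vec2_eq_iff e_def axis_def)
  have "f e \<bullet> f (rot90 e) = 0" "norm (f e) = norm (f (rot90 e))" "f e \<noteq> 0"
    using f e by (auto simp: orthogonal_transformation_def inner_vec2 orthogonal_transformation_norm[OF f] dest: arg_cong[of _ _ norm])
  then have "f (rot90 e) = rot90 (f e) \<or> f (rot90 e) = - rot90 (f e)" by (rule orthogonal_vectors_rot90)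
  moreover have K: "(\<forall>x. f (rot90 x) = k *\<^sub>R rot90 (f x))" if k: "f (rot90 e) = k *\<^sub>R rot90 (f e)" "k = 1 \<or> k = - 1" for k
  proof
    fix x
    have r: "f (rot C S e) = C *\<^sub>R f e + S *\<^sub>R k *\<^sub>R rot90 (f e)" for C S
      by (simp add: rot_def linear_add[OF lin] linear_cmul[OF lin] k(1))
    have "rot90 x = rot (- x $ 2) (x $ 1) e" by (simp add: vec2_eq_iff e_def axis_def)
    then have "f (rot90 x) = (- x $ 2) *\<^sub>R f e + (x $ 1) *\<^sub>R k *\<^sub>R rot90 (f e)" by (simp only: r)
    moreover have "f x = (x $ 1) *\<^sub>R f e + (x $ 2) *\<^sub>R k *\<^sub>R rot90 (f e)"
      using r[of "x $ 1" "x $ 2"] by (simp only: x[symmetric])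
    then have "k *\<^sub>R rot90 (f x) = k *\<^sub>R rot90 ((x $ 1) *\<^sub>R f e + (x $ 2) *\<^sub>R k *\<^sub>R rot90 (f e))" by simp
    ultimately show "f (rot90 x) = k *\<^sub>R rot90 (f x)" using k(2) by (auto simp: vec2_eq_iff)
  qed
  ultimately show ?thesis using K[of 1] K[of "- 1"] unfolding scaleR_minus_left scaleR_one by blast
qed

lemma lat_image: "linear f \<Longrightarrow> f ` lat u v = lat (f u) (f v)"
proof (intro equalityI subsetI)
  assume lin: "linear f"
  fix x assume "x \<in> f ` lat u v"
  then obtain i j where "x = f (of_int i *\<^sub>R u + of_int j *\<^sub>R v)" by (auto simp: lat_def)
  then have "x = of_int i *\<^sub>R f u + of_int j *\<^sub>R f v" by (simp add: linear_add[OF lin] linear_cmul[OF lin])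
  then show "x \<in> lat (f u) (f v)" using latI by metis
next
  assume lin: "linear f"
  fix x assume "x \<in> lat (f u) (f v)"
  then obtain i j where "x = of_int i *\<^sub>R f u + of_int j *\<^sub>R f v" by (auto simp: lat_def)
  then have "x = f (of_int i *\<^sub>R u + of_int j *\<^sub>R v)" by (simp add: linear_add[OF lin] linear_cmul[OF lin])
  then show "x \<in> f ` lat u v" using latI by blast
qed

text \<open>Finiteness: an element is determined by the images of \<open>u\<close> and
  \<open>v\<close>, which are among the finitely many lattice vectors in two balls.\<close>

lemma point_group_finite_orthogonal_group:
  assumes uv: "area u v \<noteq> 0"
  shows "finite_orthogonal_group (point_group (lat u v))" "uminus \<in> point_group (lat u v)"
proof -
  let ?P = "point_group (lat u v)"
  have "finite ?P"
  proof (rule finite_imageD)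
    have "(\<lambda>f. (f u, f v)) ` ?P \<subseteq> (lat u v \<inter> cball 0 (norm u)) \<times> (lat u v \<inter> cball 0 (norm v))"
    proof (intro image_subsetI)
      fix f assume f: "f \<in> ?P"
      then have "f u \<in> lat u v" "f v \<in> lat u v" using basis_in_lat by (auto simp: point_group_def)
      moreover have "norm (f u) = norm u" "norm (f v) = norm v"
        using f orthogonal_transformation_norm by (auto simp: point_group_def)
      ultimately show "(f u, f v) \<in> (lat u v \<inter> cball 0 (norm u)) \<times> (lat u v \<inter> cball 0 (norm v))" by simp
    qed
    then show "finite ((\<lambda>f. (f u, f v)) ` ?P)" by (rule finite_subset) (simp add: finite_lat_cball[OF uv])
    show "inj_on (\<lambda>f. (f u, f v)) ?P"
    proof (rule inj_onI)
      fix f g assume "f \<in> ?P" "g \<in> ?P" and eq: "(f u, f v) = (g u, g v)"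
      then have "linear f" "linear g" by (auto simp: point_group_def orthogonal_transformation_linear)
      then show "f = g" using linear_eq_on_basis[OF uv, of f g] eq by auto
    qed
  qed
  moreover have "id \<in> ?P" by (auto simp: point_group_def orthogonal_transformation_id[unfolded id_def[symmetric]])
  moreover have "f \<circ> g \<in> ?P" if "f \<in> ?P" "g \<in> ?P" for f g
  proof -
    have "(f \<circ> g) ` lat u v = f ` (g ` lat u v)" by (simp only: image_comp)
    then show ?thesis using that by (simp add: point_group_def orthogonal_transformation_compose)
  qed
  moreover have "\<exists>g\<in>?P. g \<circ> f = id \<and> f \<circ> g = id" if "f \<in> ?P" for f
  proof -
    have f: "orthogonal_transformation f" "f ` lat u v = lat u v" using that by (auto simp: point_group_def)
    have b: "bij f" using f(1) by (rule orthogonal_transformation_bij)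
    have "inv_into UNIV f ` lat u v = lat u v" using f(2) b by (metis bij_is_inj image_inv_f_f)
    then have "inv_into UNIV f \<in> ?P" using orthogonal_transformation_inv[OF f(1)] by (simp add: point_group_def)
    moreover have "inv_into UNIV f \<circ> f = id" "f \<circ> inv_into UNIV f = id"
      using b by (simp_all add: bij_is_inj bij_is_surj surj_iff[symmetric])
    ultimately show ?thesis by blast
  qed
  moreover have "orthogonal_transformation f" if "f \<in> ?P" for f using that by (simp add: point_group_def)
  ultimately show "finite_orthogonal_group ?P" by (simp add: finite_orthogonal_group_def)
  have "uminus ` lat u v = lat u v"
  proof -
    have "- x \<in> lat u v" if "x \<in> lat u v" for x using diff_in_lat[OF zero_in_lat that] by simp
    then show ?thesis by (force intro: image_eqI[of _ uminus "- _"])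
  qed
  then show "uminus \<in> ?P"
    by (simp add: point_group_def orthogonal_transformation_def linear_uminus)
qed

section \<open>Adjoining an isometry that normalises the point group\<close>

text \<open>Closed under composition because \<open>\<sigma>\<close> can be moved past
  \<open>P\<close> and its square lies in \<open>P\<close>. If \<open>q\<close> inverts that square
  and \<open>g\<close> inverts \<open>f\<close>, then \<open>q \<circ> \<sigma> \<circ> g\<close>
  inverts \<open>f \<circ> \<sigma>\<close>.\<close>

lemma extended_group:
  fixes P :: "('a::euclidean_space \<Rightarrow> 'a) set"
  assumes P: "finite_orthogonal_group P" and s: "orthogonal_transformation \<sigma>" "\<sigma> \<circ> \<sigma> \<in> P"
    and n: "\<And>f. f \<in> P \<Longrightarrow> \<exists>g\<in>P. \<sigma> \<circ> f = g \<circ> \<sigma>"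
  shows "finite_orthogonal_group (P \<union> (\<lambda>f. f \<circ> \<sigma>) ` P)"
proof -
  let ?D = "P \<union> (\<lambda>f. f \<circ> \<sigma>) ` P"
  have finP: "finite P" and idP: "id \<in> P" and compP: "\<And>f g. f \<in> P \<Longrightarrow> g \<in> P \<Longrightarrow> f \<circ> g \<in> P"
    and invP: "\<And>f. f \<in> P \<Longrightarrow> \<exists>g\<in>P. g \<circ> f = id \<and> f \<circ> g = id"
    and orthP: "\<And>f. f \<in> P \<Longrightarrow> orthogonal_transformation f"
    using P by (auto simp: finite_orthogonal_group_def)
  have comp: "d \<circ> e \<in> ?D" if "d \<in> ?D" "e \<in> ?D" for d e
  proof -
    have "f \<circ> (g \<circ> \<sigma>) \<in> ?D" if "f \<in> P" "g \<in> P" for f g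
      using compP[OF that] by (auto simp: o_assoc)
    moreover have "(f \<circ> \<sigma>) \<circ> g \<in> ?D" if fg: "f \<in> P" "g \<in> P" for f g
    proof -
      obtain g' where g': "g' \<in> P" "\<sigma> \<circ> g = g' \<circ> \<sigma>" using n[OF fg(2)] by blast
      have "(f \<circ> \<sigma>) \<circ> g = (f \<circ> g') \<circ> \<sigma>" by (simp only: o_assoc[symmetric] g'(2))
      then show ?thesis using compP[OF fg(1) g'(1)] by blast
    qed
    moreover have "(f \<circ> \<sigma>) \<circ> (g \<circ> \<sigma>) \<in> ?D" if fg: "f \<in> P" "g \<in> P" for f g
    proof -
      obtain g' where g': "g' \<in> P" "\<sigma> \<circ> g = g' \<circ> \<sigma>" using n[OF fg(2)] by blast
      have "(f \<circ> \<sigma>) \<circ> (g \<circ> \<sigma>) = f \<circ> (\<sigma> \<circ> g) \<circ> \<sigma>" by (simp only: o_assoc)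
      also have "\<dots> = (f \<circ> g') \<circ> (\<sigma> \<circ> \<sigma>)" by (simp only: g'(2) o_assoc)
      finally show ?thesis using compP[OF compP[OF fg(1) g'(1)] s(2)] by simp
    qed
    ultimately show ?thesis using that compP by blast
  qed
  obtain q where q: "q \<in> P" "q \<circ> (\<sigma> \<circ> \<sigma>) = id" using invP[OF s(2)] by blast
  have qD: "q \<circ> \<sigma> \<in> ?D" using q by blast
  have orthD: "orthogonal_transformation d" if "d \<in> ?D" for d
    using that orthP s(1) orthogonal_transformation_compose by blast
  have "\<exists>e\<in>?D. e \<circ> d = id \<and> d \<circ> e = id" if d: "d \<in> ?D" for d
  proof -
    have "\<exists>e\<in>?D. e \<circ> d = id"
    proof (cases "d \<in> P")
      case True then show ?thesis using invP by blast
    next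
      case False
      then obtain f where f: "f \<in> P" "d = f \<circ> \<sigma>" using d by blast
      obtain g where g: "g \<in> P" "g \<circ> f = id" using invP[OF f(1)] by blast
      have "(q \<circ> \<sigma> \<circ> g) \<circ> d = q \<circ> \<sigma> \<circ> (g \<circ> f) \<circ> \<sigma>" by (simp only: f(2) o_assoc)
      also have "\<dots> = id" using q(2) by (simp add: g(2) o_assoc)
      finally show ?thesis using comp[OF qD] g(1) by blast
    qed
    then obtain e where e: "e \<in> ?D" "e \<circ> d = id" by blast
    have "bij d" using orthD[OF d] by (rule orthogonal_transformation_bij)
    then have "d (e x) = x" for x
    proof -
      obtain y where y: "x = d y" using \<open>bij d\<close> by (meson bij_pointE)
      have "e (d y) = y" using fun_cong[OF e(2), of y] by simp
      then show ?thesis by (simp add: y)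
    qed
    then have "d \<circ> e = id" by auto
    then show ?thesis using e by blast
  qed
  then show ?thesis
    unfolding finite_orthogonal_group_def using finP idP comp orthD by blast
qed

definition has_index_two_cell :: "(real^2) set \<Rightarrow> bool" where
  "has_index_two_cell \<Gamma> \<longleftrightarrow> (\<exists>F. fundamental_cell \<Gamma> F \<and> subgroup (point_group \<Gamma>) (symmetry_group F) \<and>
     card (rcosets\<^bsub>symmetry_group F\<^esub> (point_group \<Gamma>)) = 2)"

lemma index_two_cell_of_transversal:
  assumes uv: "area u v \<noteq> 0" and \<Gamma>: "\<Gamma> = lat u v" and P: "P = point_group \<Gamma>"
    and s: "orthogonal_transformation \<sigma>" "\<sigma> \<circ> \<sigma> \<in> P" "\<sigma> \<notin> P"
    and n: "\<And>f. f \<in> P \<Longrightarrow> \<exists>g\<in>P. \<sigma> \<circ> f = g \<circ> \<sigma>"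
    and I: "open I" "bounded I" "\<And>f p. f \<in> P \<Longrightarrow> p \<in> I \<Longrightarrow> f p \<in> I" "\<And>p. p \<in> I \<Longrightarrow> \<sigma> p \<in> I"
    and Iinj: "\<And>x y. x \<in> I \<Longrightarrow> y \<in> I \<Longrightarrow> x - y \<in> \<Gamma> \<Longrightarrow> x = y"
    and dense: "\<And>W. open W \<Longrightarrow> W \<noteq> {} \<Longrightarrow> \<exists>p\<in>W. \<exists>\<gamma>\<in>\<Gamma>. p + \<gamma> \<in> I"
  shows "has_index_two_cell \<Gamma>"
proof -
  define D where "D = P \<union> (\<lambda>f. f \<circ> \<sigma>) ` P"
  have PG: "finite_orthogonal_group P" "uminus \<in> P"
    using point_group_finite_orthogonal_group[OF uv] by (simp_all add: P \<Gamma>)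
  have DG: "finite_orthogonal_group D" unfolding D_def by (rule extended_group[OF PG(1) s(1,2) n])
  have idP: "id \<in> P" and compP: "\<And>f g. f \<in> P \<Longrightarrow> g \<in> P \<Longrightarrow> f \<circ> g \<in> P"
    and invP: "\<And>f. f \<in> P \<Longrightarrow> \<exists>g\<in>P. g \<circ> f = id \<and> f \<circ> g = id"
    using PG by (auto simp: finite_orthogonal_group_def)
  obtain F where F: "fundamental_cell \<Gamma> F" "carrier (symmetry_group F) = D"
  proof (rule fundamental_cell_with_symmetry[of \<Gamma> D I])
    show "0 \<in> \<Gamma>" "\<And>x y. x \<in> \<Gamma> \<Longrightarrow> y \<in> \<Gamma> \<Longrightarrow> x - y \<in> \<Gamma>"
      unfolding \<Gamma> by (auto intro: zero_in_lat diff_in_lat)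
    show "finite (\<Gamma> \<inter> cball x r)" for x r using finite_lat_cball[OF uv] by (simp add: \<Gamma>)
    show "uminus \<in> D" using PG by (simp add: D_def)
    show "d p \<in> I" if "d \<in> D" "p \<in> I" for d p using that I(3,4) by (auto simp: D_def)
  qed (use DG I Iinj dense in auto)
  let ?G = "symmetry_group F"
  have G: "group ?G" by (rule group_symmetry_group)
  have mult: "f \<otimes>\<^bsub>?G\<^esub> g = f \<circ> g" for f g by (simp add: symmetry_group_def)
  have one: "\<one>\<^bsub>?G\<^esub> = id" by (simp add: symmetry_group_def)
  have PD: "P \<subseteq> D" by (auto simp: D_def)
  have sub: "subgroup P ?G"
  proof (rule group.subgroupI[OF G])
    show "P \<subseteq> carrier ?G" using PD F by simp
    show "P \<noteq> {}" using idP by blast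
    show "inv\<^bsub>?G\<^esub> f \<in> P" if f: "f \<in> P" for f
    proof -
      obtain g where g: "g \<in> P" "g \<circ> f = id" using invP[OF f] by blast
      have "inv\<^bsub>?G\<^esub> f = g"
        using g f PD F(2) by (intro group.inv_equality[OF G]) (auto simp: mult one)
      then show ?thesis using g by simp
    qed
    show "f \<otimes>\<^bsub>?G\<^esub> g \<in> P" if "f \<in> P" "g \<in> P" for f g using compP that by (simp add: mult)
  qed
  define P\<sigma> where "P\<sigma> = (\<lambda>f. f \<circ> \<sigma>) ` P"
  have coset: "P #>\<^bsub>?G\<^esub> g = (\<lambda>f. f \<circ> g) ` P" for g by (auto simp: r_coset_def mult)
  have cosP: "(\<lambda>f. f \<circ> g) ` P = P" if g: "g \<in> P" for g
  proof (intro equalityI subsetI)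
    fix f assume "f \<in> P"
    obtain h where h: "h \<in> P" "h \<circ> g = id" using invP[OF g] by blast
    have "f = (f \<circ> h) \<circ> g" by (simp only: o_assoc[symmetric] h(2) comp_id)
    then show "f \<in> (\<lambda>f. f \<circ> g) ` P" using compP[OF \<open>f \<in> P\<close> h(1)] by blast
  qed (use compP g in auto)
  have cosS: "(\<lambda>f. f \<circ> (g \<circ> \<sigma>)) ` P = P\<sigma>" if g: "g \<in> P" for g
  proof -
    have "(\<lambda>f. f \<circ> (g \<circ> \<sigma>)) ` P = (\<lambda>f. f \<circ> \<sigma>) ` ((\<lambda>f. f \<circ> g) ` P)" by (simp add: image_image o_assoc)
    then show ?thesis using cosP[OF g] by (simp add: P\<sigma>_def)
  qed
  have "rcosets\<^bsub>?G\<^esub> P = {P, P\<sigma>}"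
  proof (intro equalityI subsetI)
    fix X assume "X \<in> rcosets\<^bsub>?G\<^esub> P"
    then obtain g where "g \<in> D" "X = (\<lambda>f. f \<circ> g) ` P" using F(2) by (auto simp: RCOSETS_def coset)
    moreover have "g \<in> P \<or> (\<exists>h\<in>P. g = h \<circ> \<sigma>)" using \<open>g \<in> D\<close> by (auto simp: D_def)
    ultimately show "X \<in> {P, P\<sigma>}" using cosP cosS by (metis insertCI)
  next
    fix X assume "X \<in> {P, P\<sigma>}"
    moreover have "P = (\<lambda>f. f \<circ> id) ` P" "id \<in> D" using idP PD by auto
    moreover have "P\<sigma> = (\<lambda>f. f \<circ> \<sigma>) ` P" "\<sigma> \<in> D" using idP by (auto simp: P\<sigma>_def D_def intro!: image_eqI[of _ _ id])
    ultimately show "X \<in> rcosets\<^bsub>?G\<^esub> P" using F(2) unfolding RCOSETS_def coset by blast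
  qed
  moreover have "P \<noteq> P\<sigma>"
  proof
    assume "P = P\<sigma>"
    moreover have "id \<circ> \<sigma> \<in> P\<sigma>" unfolding P\<sigma>_def using idP by (rule imageI)
    ultimately show False using s(3) by simp
  qed
  ultimately have "card (rcosets\<^bsub>?G\<^esub> P) = 2" by simp
  then show ?thesis unfolding has_index_two_cell_def using F(1) sub P by blast
qed

lemma index_two_cell_of_extension:
  assumes uv: "area u v \<noteq> 0" and \<Gamma>: "\<Gamma> = lat u v" and P: "P = point_group \<Gamma>"
    and s: "orthogonal_transformation \<sigma>" "\<sigma> \<circ> \<sigma> \<in> P"
    and n: "\<And>f. f \<in> P \<Longrightarrow> \<exists>g\<in>P. \<sigma> \<circ> f = g \<circ> \<sigma>" and n': "\<And>f. f \<in> P \<Longrightarrow> \<exists>g\<in>P. f \<circ> \<sigma> = \<sigma> \<circ> g"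
    and indep: "\<Gamma> \<inter> \<sigma> ` \<Gamma> \<subseteq> {0}"
  shows "has_index_two_cell \<Gamma>"
proof -
  define D where "D = P \<union> (\<lambda>f. f \<circ> \<sigma>) ` P"
  have PG: "finite_orthogonal_group P" using point_group_finite_orthogonal_group[OF uv] by (simp add: P \<Gamma>)
  have idP: "id \<in> P" using PG by (auto simp: finite_orthogonal_group_def)
  have DG: "finite_orthogonal_group D" unfolding D_def by (rule extended_group[OF PG s n])
  have P\<Gamma>: "f ` \<Gamma> = \<Gamma>" if "f \<in> P" for f using that by (simp add: P point_group_def)
  have \<sigma>P: "\<sigma> \<notin> P"
  proof
    assume "\<sigma> \<in> P"
    then have "u \<in> \<Gamma> \<inter> \<sigma> ` \<Gamma>" using P\<Gamma> basis_in_lat[of u v] by (simp add: \<Gamma>)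
    then have "u = 0" using indep by blast
    then show False using uv by (simp add: area_nth)
  qed
  have lin: "linear \<sigma>" using s(1) by (rule orthogonal_transformation_linear)
  obtain I where I: "open I" "bounded I" "\<And>d p. d \<in> D \<Longrightarrow> p \<in> I \<Longrightarrow> d p \<in> I"
    "\<And>x y. x \<in> I \<Longrightarrow> y \<in> I \<Longrightarrow> x - y \<in> lat u v \<Longrightarrow> x = y"
    "\<And>W. open W \<Longrightarrow> W \<noteq> {} \<Longrightarrow> \<exists>p\<in>W. \<exists>\<gamma>\<in>lat u v. p + \<gamma> \<in> I"
  proof (rule planar_open_transversal[OF uv DG, of "\<sigma> ` \<Gamma>" \<sigma>])
    show "d ` lat u v = lat u v \<or> d ` lat u v = \<sigma> ` \<Gamma>" if d: "d \<in> D" for d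
    proof (cases "d \<in> P")
      case True then show ?thesis using P\<Gamma> by (simp add: \<Gamma>)
    next
      case False
      then obtain f where f: "f \<in> P" "d = f \<circ> \<sigma>" using d by (auto simp: D_def)
      obtain g where g: "g \<in> P" "f \<circ> \<sigma> = \<sigma> \<circ> g" using n'[OF f(1)] by blast
      have "d ` \<Gamma> = \<sigma> ` g ` \<Gamma>" by (simp only: f(2) g(2) image_comp)
      then show ?thesis using P\<Gamma>[OF g(1)] by (simp add: \<Gamma>)
    qed
    show "\<sigma> \<in> D" using idP by (auto simp: D_def intro!: image_eqI[of _ _ id])
    show "lat u v \<inter> \<sigma> ` \<Gamma> = {0}"
    proof -
      have "0 \<in> \<Gamma>" by (simp add: \<Gamma> zero_in_lat)
      then have "\<sigma> 0 \<in> \<sigma> ` \<Gamma>" by (rule imageI)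
      then show ?thesis using indep \<open>0 \<in> \<Gamma>\<close> linear_0[OF lin] by (auto simp: \<Gamma>)
    qed
  qed (use \<Gamma> in auto)
  have \<sigma>D: "\<sigma> \<in> D" using idP by (auto simp: D_def intro!: image_eqI[of _ _ id])
  show ?thesis
    by (rule index_two_cell_of_transversal[OF uv \<Gamma> P s \<sigma>P n I(1,2)]) (use I \<sigma>D in \<open>auto simp: \<Gamma> D_def\<close>)
qed

text \<open>With \<open>r\<close> the rotation, \<open>f\<close> either commutes with
  \<open>r\<close> or turns it into its inverse. In the second case
  \<open>r \<circ> f = (f \<circ> q) \<circ> r\<close>, where \<open>q\<close> is the inverse of
  \<open>r \<circ> r\<close> and so belongs to \<open>P\<close>.\<close>

lemma rotation_normalises_point_group:
  assumes uv: "area u v \<noteq> 0" and P: "P = point_group (lat u v)"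
    and CS: "C\<^sup>2 + S\<^sup>2 = 1" and sq: "rot C S \<circ> rot C S \<in> P" and f: "f \<in> P"
  shows "\<exists>g\<in>P. rot C S \<circ> f = g \<circ> rot C S" "\<exists>g\<in>P. f \<circ> rot C S = rot C S \<circ> g"
proof -
  let ?r = "rot C S" and ?r' = "rot C (- S)"
  have PG: "finite_orthogonal_group P" using point_group_finite_orthogonal_group[OF uv] P by simp
  have compP: "\<And>f g. f \<in> P \<Longrightarrow> g \<in> P \<Longrightarrow> f \<circ> g \<in> P"
    and invP: "\<And>f. f \<in> P \<Longrightarrow> \<exists>g\<in>P. g \<circ> f = id \<and> f \<circ> g = id"
    and orthP: "\<And>f. f \<in> P \<Longrightarrow> orthogonal_transformation f"
    using PG by (auto simp: finite_orthogonal_group_def)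
  have rr: "?r (?r' x) = x" "?r' (?r x) = x" for x
    using CS by (simp_all add: rot_rot power2_eq_square) (simp_all add: rot_def algebra_simps)
  obtain q where q: "q \<in> P" "q \<circ> (?r \<circ> ?r) = id" using invP[OF sq] by blast
  have qr: "q (?r (?r x)) = x" for x using fun_cong[OF q(2), of x] by simp
  have qeq: "q x = ?r' (?r' x)" for x using qr[of "?r' (?r' x)"] by (simp add: rr)
  have lin: "linear f" using orthP[OF f] by (rule orthogonal_transformation_linear)
  have fr: "f (?r x) = C *\<^sub>R f x + S *\<^sub>R f (rot90 x)" "f (?r' x) = C *\<^sub>R f x - S *\<^sub>R f (rot90 x)" for x
    by (simp_all add: rot_def linear_add[OF lin] linear_cmul[OF lin] linear_diff[OF lin])
  consider "\<And>x. f (rot90 x) = rot90 (f x)" | "\<And>x. f (rot90 x) = - rot90 (f x)"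
    using orthogonal_rot90_commute[OF orthP[OF f]] by blast
  then have "(\<exists>g\<in>P. ?r \<circ> f = g \<circ> ?r) \<and> (\<exists>g\<in>P. f \<circ> ?r = ?r \<circ> g)"
  proof cases
    case 1
    have "f (?r x) = ?r (f x)" for x unfolding fr(1) 1 by (simp add: rot_def)
    then have "?r \<circ> f = f \<circ> ?r" by auto
    then show ?thesis using f by metis
  next
    case 2
    have a: "f (?r x) = ?r' (f x)" for x unfolding fr(1) 2 by (simp add: rot_def)
    have b: "f (?r' x) = ?r (f x)" for x unfolding fr(2) 2 by (simp add: rot_def)
    have "?r (f x) = f (q (?r x))" for x by (simp add: qeq rr b)
    then have "?r \<circ> f = (f \<circ> q) \<circ> ?r" by auto
    moreover have "f (?r x) = ?r (q (f x))" for x by (simp add: qeq rr a)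
    then have "f \<circ> ?r = ?r \<circ> (q \<circ> f)" by auto
    ultimately show ?thesis using compP[OF f q(1)] compP[OF q(1) f] by blast
  qed
  then show "\<exists>g\<in>P. rot C S \<circ> f = g \<circ> rot C S" "\<exists>g\<in>P. f \<circ> rot C S = rot C S \<circ> g" by blast+
qed

lemma index_two_cell_of_rotation:
  assumes uv: "area u v \<noteq> 0" and CS: "C\<^sup>2 + S\<^sup>2 = 1" and sq: "rot C S \<circ> rot C S \<in> point_group (lat u v)"
    and indep: "lat u v \<inter> rot C S ` lat u v \<subseteq> {0}"
  shows "has_index_two_cell (lat u v)"
  by (rule index_two_cell_of_extension[OF uv refl refl orthogonal_rot[OF CS] sq _ _ indep])
    (use rotation_normalises_point_group[OF uv refl CS sq] in blast)+

section \<open>The individual lattice types\<close>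

text \<open>In complex notation the lattice is \<open>u\<close> times the Gaussian integers. A
  common vector of it and its image under the rotation by \<open>\<pi>/4\<close> makes
  \<open>sqrt 2 * i\<close> and \<open>sqrt 2 * j\<close> integers, so it is zero.\<close>

lemma square_case:
  assumes "area u v \<noteq> 0" "u \<bullet> v = 0" "norm u = norm v"
  shows "has_index_two_cell (lat u v)"
proof -
  have u0: "u \<noteq> 0" using assms(1) by (auto simp: area_nth)
  have "v = rot90 u \<or> v = - rot90 u" using orthogonal_vectors_rot90 assms u0 by blast
  then have lat: "lat u v = lat u (rot90 u)" using lat_minus by auto
  have a: "area u (rot90 u) \<noteq> 0" using u0 by (simp add: area_nth vec2_eq_iff)
  define c where "c = sqrt 2 / 2"
  have c2: "c * c = 1/2" by (simp add: c_def)
  have cc: "c\<^sup>2 + c\<^sup>2 = 1" using c2 by (simp add: power2_eq_square)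
  have "rot c c \<circ> rot c c = rot90"
    by (rule ext) (simp add: rot_rot c2, simp add: rot_def)
  moreover have "rot90 ` lat u (rot90 u) = lat u (rot90 u)"
  proof -
    have rr90: "rot90 (rot90 u) = - u" by (simp add: vec2_eq_iff)
    have "rot90 ` lat u (rot90 u) = lat (rot90 u) (- u)"
      using lat_image[OF linear_rot90, of u "rot90 u"] by (metis rr90)
    also have "\<dots> = lat u (rot90 u)" unfolding lat_minus by (rule lat_commute)
    finally show ?thesis .
  qed
  moreover have "orthogonal_transformation rot90"
    unfolding orthogonal_transformation_def using linear_rot90 by (simp add: inner_vec2 algebra_simps)
  ultimately have sq: "rot c c \<circ> rot c c \<in> point_group (lat u (rot90 u))" by (simp add: point_group_def)
  have "x = 0" if x: "x \<in> lat u (rot90 u)" "x \<in> rot c c ` lat u (rot90 u)" for x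
  proof -
    obtain i j :: int where ij: "x = rot (of_int i) (of_int j) u" using x(1) by (auto simp: lat_def rot_def)
    obtain k l :: int where kl: "x = rot c c (rot (of_int k) (of_int l) u)" using x(2) by (auto simp: lat_def rot_def)
    have "rot (of_int i) (of_int j) u = rot (c * of_int k - c * of_int l) (c * of_int l + c * of_int k) u"
      using ij kl by (simp add: rot_rot)
    then have e: "of_int i = c * of_int k - c * of_int l" "of_int j = c * of_int l + c * of_int k"
      using rot_inj u0 by blast+
    have s: "sqrt 2 * c = 1" by (simp add: c_def)
    have "sqrt 2 * of_int i = (sqrt 2 * c) * of_int k - (sqrt 2 * c) * of_int l" unfolding e by (simp add: algebra_simps)
    then have 1: "sqrt (of_int 2) * of_int i = of_int (k - l)" by (simp add: s)
    have "sqrt 2 * of_int j = (sqrt 2 * c) * of_int l + (sqrt 2 * c) * of_int k" unfolding e by (simp add: algebra_simps)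
    then have 2: "sqrt (of_int 2) * of_int j = of_int (l + k)" by (simp add: s)
    have "prime (2 :: int)" by simp
    then have "i = 0" "j = 0" using sqrt_prime_mult_int(1)[OF _ 1] sqrt_prime_mult_int(1)[OF _ 2] by blast+
    then show ?thesis by (simp add: ij rot_def)
  qed
  then show ?thesis unfolding lat using index_two_cell_of_rotation[OF a cc sq] by blast
qed

text \<open>The same argument with the Eisenstein integers, the rotation by \<open>\<pi>/6\<close>
  and \<open>sqrt 3\<close>. If \<open>v\<close> arises from \<open>u\<close> by the rotation
  through \<open>- \<pi>/3\<close>, the two basis vectors change roles.\<close>

lemma hexagonal_case:
  assumes uv: "area u v \<noteq> 0" "norm u = norm v" "u \<bullet> v = (norm u)\<^sup>2 / 2"
  shows "has_index_two_cell (lat u v)"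
proof -
  define s where "s = sqrt 3 / 2"
  have s2: "s * s = 3/4" by (simp add: s_def)
  have main: "has_index_two_cell (lat u (rot (1/2) s u))" if u0: "u \<noteq> 0" for u
  proof -
    define v where "v = rot (1/2) s u"
    have "area u v = s * (u \<bullet> u)" by (simp add: v_def area_nth inner_vec2 algebra_simps)
    moreover have "s \<noteq> 0" "u \<bullet> u \<noteq> 0" using u0 by (auto simp: s_def)
    ultimately have a: "area u v \<noteq> 0" by simp
    have cc: "s\<^sup>2 + (1/2)\<^sup>2 = 1" using s2 by (simp add: power2_eq_square)
    have rr: "rot s (1/2) \<circ> rot s (1/2) = rot (1/2) s" by (rule ext) (simp add: rot_rot s2)
    have "rot (1/2) s v = rot (- (1/2)) s u" by (simp add: v_def rot_rot s2)
    then have "rot (1/2) s v = v - u" by (simp add: v_def vec2_eq_iff)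
    then have "rot (1/2) s ` lat u v = lat v (v - of_int 1 *\<^sub>R u)"
      using lat_image[OF linear_rot, of "1/2" s u v] by (simp add: v_def)
    also have "\<dots> = lat u v" by (rule lat_unimodular) simp
    finally have "rot s (1/2) \<circ> rot s (1/2) \<in> point_group (lat u v)"
      unfolding rr using orthogonal_rot[of "1/2" s] cc by (simp add: point_group_def add.commute)
    moreover have "x = 0" if x: "x \<in> lat u v" "x \<in> rot s (1/2) ` lat u v" for x
    proof -
      obtain i j :: int where ij: "x = of_int i *\<^sub>R u + of_int j *\<^sub>R v" using x(1) by (auto simp: lat_def)
      obtain k l :: int where kl: "x = rot s (1/2) (of_int k *\<^sub>R u + of_int l *\<^sub>R v)" using x(2) by (auto simp: lat_def)
      have 1: "x = rot (of_int i + of_int j / 2) (s * of_int j) u"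
        by (simp add: ij v_def rot_def algebra_simps)
      have "of_int k *\<^sub>R u + of_int l *\<^sub>R v = rot (of_int k + of_int l / 2) (s * of_int l) u"
        by (simp add: v_def rot_def algebra_simps)
      then have 2: "x = rot (s * of_int k) (of_int k / 2 + (1/4 + s * s) * of_int l) u"
        by (simp add: kl rot_rot algebra_simps)
      have "of_int i + of_int j / 2 = s * of_int k" "s * of_int j = of_int k / 2 + (1/4 + s * s) * of_int l"
        using rot_inj[OF _ u0] 1 2 by metis+
      then have *: "sqrt (of_int 3) * of_int k = of_int (2 * i + j)" "sqrt (of_int 3) * of_int j = of_int (k + 2 * l)"
        by (simp_all add: s2) (simp_all add: s_def field_simps)
      have "prime (3 :: int)" by (simp add: prime_int_numeral_eq)
      then have "2 * i + j = 0" "j = 0" using sqrt_prime_mult_int(2)[OF _ *(1)] sqrt_prime_mult_int(1)[OF _ *(2)] by blast+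
      then show ?thesis by (simp add: ij)
    qed
    ultimately show ?thesis using index_two_cell_of_rotation[OF a cc] unfolding v_def by blast
  qed
  have u0: "u \<noteq> 0" "v \<noteq> 0" using uv(1) by (auto simp: area_nth)
  \<comment> \<open>The part of \<open>v\<close> orthogonal to \<open>u\<close>, scaled to the
    length of \<open>u\<close>; hence \<open>rot90 u\<close> or its negative.\<close>
  define y where "y = (1 / s) *\<^sub>R (v - (1/2) *\<^sub>R u)"
  have s0: "s > 0" by (simp add: s_def)
  have uu: "u \<bullet> v = u \<bullet> u / 2" "v \<bullet> v = u \<bullet> u" using uv(2,3) by (simp_all add: power2_norm_eq_inner norm_eq)
  have "(v - (1/2) *\<^sub>R u) \<bullet> (v - (1/2) *\<^sub>R u) = v \<bullet> v - u \<bullet> v + u \<bullet> u / 4"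
    by (simp add: inner_diff inner_commute algebra_simps)
  also have "\<dots> = (s * s) * (u \<bullet> u)" by (simp add: uu s2)
  finally have "y \<bullet> y = u \<bullet> u" using s0 by (simp add: y_def)
  then have "norm u = norm y" by (simp add: norm_eq)
  moreover have "u \<bullet> y = 0" by (simp add: y_def inner_diff_right uu)
  ultimately have "y = rot90 u \<or> y = - rot90 u" using orthogonal_vectors_rot90 u0 by blast
  moreover have v: "v = (1/2) *\<^sub>R u + s *\<^sub>R y" using s0 by (simp add: y_def)
  ultimately show ?thesis
  proof (elim disjE)
    assume "y = rot90 u"
    then have "v = rot (1/2) s u" using v by (simp add: rot_def)
    then show ?thesis using main u0 by simp
  next
    assume "y = - rot90 u"
    then have vr: "v = rot (1/2) (- s) u" using v by (simp add: rot_def)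
    have "u = rot (1/2) s v" unfolding vr by (simp add: rot_rot s2) (simp add: rot_def)
    then have "has_index_two_cell (lat v u)" using main[OF u0(2)] by simp
    then show ?thesis by (metis lat_commute)
  qed
qed

text \<open>The inner products of a common vector with \<open>u\<close> and \<open>v\<close> give
  integer relations between the side lengths, and these are trivial by assumption.\<close>

lemma irrational_rectangle_case:
  assumes uv: "area u v \<noteq> 0" "u \<bullet> v = 0"
    and irr: "\<And>i j :: int. of_int i * norm u = of_int j * norm v \<Longrightarrow> i = 0 \<and> j = 0"
  shows "has_index_two_cell (lat u v)"
proof -
  have nz: "norm u > 0" "norm v > 0" using uv(1) by (auto simp: area_nth)
  have "rot 0 1 \<circ> rot 0 1 = uminus" by (rule ext) (simp add: rot_rot, simp add: rot_def)
  then have sq: "rot 0 1 \<circ> rot 0 1 \<in> point_group (lat u v)"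
    using point_group_finite_orthogonal_group(2)[OF uv(1)] by simp
  have ra: "\<bar>rot90 u \<bullet> v\<bar> = norm u * norm v"
  proof -
    have "(rot90 u \<bullet> v)\<^sup>2 = (u \<bullet> u) * (v \<bullet> v) - (u \<bullet> v)\<^sup>2"
      by (simp add: inner_vec2 power2_eq_square algebra_simps)
    also have "\<dots> = (norm u * norm v)\<^sup>2" using uv(2) by (simp add: power_mult_distrib power2_norm_eq_inner)
    finally show ?thesis using nz by (metis abs_of_nonneg power2_eq_iff_nonneg power2_abs abs_ge_zero mult_nonneg_nonneg norm_ge_zero)
  qed
  have ra': "\<bar>rot90 v \<bullet> u\<bar> = norm u * norm v"
    using ra by (simp add: inner_vec2 algebra_simps abs_minus_commute)
  have "x = 0" if x: "x \<in> lat u v" "x \<in> rot 0 1 ` lat u v" for x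
  proof -
    obtain i j :: int where ij: "x = of_int i *\<^sub>R u + of_int j *\<^sub>R v" using x(1) by (auto simp: lat_def)
    obtain k l :: int where kl: "x = rot90 (of_int k *\<^sub>R u + of_int l *\<^sub>R v)" using x(2) by (auto simp: lat_def rot_0_1)
    have kl': "x = of_int k *\<^sub>R rot90 u + of_int l *\<^sub>R rot90 v"
      by (simp add: kl linear_add[OF linear_rot90] linear_cmul[OF linear_rot90])
    have z: "rot90 u \<bullet> u = 0" "rot90 v \<bullet> v = 0" by (simp_all add: inner_vec2)
    have "x \<bullet> u = of_int i * (norm u)\<^sup>2" using uv(2) by (simp add: ij inner_add_left inner_commute[of v u] power2_norm_eq_inner)
    moreover have "x \<bullet> u = of_int l * (rot90 v \<bullet> u)" by (simp add: kl' inner_add_left z)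
    ultimately have "\<bar>of_int i\<bar> * (norm u)\<^sup>2 = \<bar>of_int l\<bar> * (norm u * norm v)"
      using ra' by (metis abs_mult abs_of_nonneg zero_le_power2)
    then have "of_int \<bar>i\<bar> * norm u = of_int \<bar>l\<bar> * norm v" using nz by (simp add: power2_eq_square)
    then have "i = 0" using irr[of "\<bar>i\<bar>" "\<bar>l\<bar>"] by simp
    have "x \<bullet> v = of_int j * (norm v)\<^sup>2" using uv(2) by (simp add: ij inner_add_left inner_commute[of v u] power2_norm_eq_inner)
    moreover have "x \<bullet> v = of_int k * (rot90 u \<bullet> v)" by (simp add: kl' inner_add_left z)
    ultimately have "\<bar>of_int j\<bar> * (norm v)\<^sup>2 = \<bar>of_int k\<bar> * (norm u * norm v)"
      using ra by (metis abs_mult abs_of_nonneg zero_le_power2)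
    then have "of_int \<bar>k\<bar> * norm u = of_int \<bar>j\<bar> * norm v" using nz by (simp add: power2_eq_square)
    then have "j = 0" using irr[of "\<bar>k\<bar>" "\<bar>j\<bar>"] by simp
    then show ?thesis using \<open>i = 0\<close> by (simp add: ij)
  qed
  then show ?thesis using index_two_cell_of_rotation[OF uv(1) _ sq] by auto
qed

text \<open>For \<open>C\<close> and \<open>S\<close> the cosine and sine of an angle, the
  reflection in the line at half that angle.\<close>

definition reflection :: "real \<Rightarrow> real \<Rightarrow> real^2 \<Rightarrow> real^2" where
  "reflection C S x = vector [C * x $ 1 + S * x $ 2, S * x $ 1 - C * x $ 2]"

lemma reflection_nth [simp]: "reflection C S x $ 1 = C * x $ 1 + S * x $ 2" "reflection C S x $ 2 = S * x $ 1 - C * x $ 2"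
  by (simp_all add: reflection_def)

text \<open>Every linear map commutes with \<open>uminus\<close>, so the mirror may be generic.
  Non-zero lattice vectors with \<open>x = reflection C S y\<close> determine \<open>C\<close>; only
  countably many values have to be avoided.\<close>

lemma oblique_case:
  assumes uv: "area u v \<noteq> 0" and P: "point_group (lat u v) \<subseteq> {id, uminus}"
  shows "has_index_two_cell (lat u v)"
proof -
  define \<Gamma> where "\<Gamma> = lat u v"
  have count: "countable \<Gamma>" unfolding \<Gamma>_def using countable_if_locally_finite finite_lat_cball[OF uv] by blast
  define A where "A = (\<lambda>(x, y). (x $ 1 * y $ 1 - x $ 2 * y $ 2) / (y \<bullet> y)) ` (\<Gamma> \<times> \<Gamma>)"
  have "countable A" unfolding A_def using count by (intro countable_image countable_SIGMA) auto
  moreover have "uncountable {- 1 .. (1::real)}" by (simp add: uncountable_closed_interval)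
  ultimately obtain C where C: "- 1 \<le> C" "C \<le> 1" "C \<notin> A"
    by (metis atLeastAtMost_iff countable_subset subsetI)
  define S where "S = sqrt (1 - C\<^sup>2)"
  have "C\<^sup>2 \<le> 1" using C by (simp add: abs_square_le_1 abs_le_iff)
  then have CS: "C\<^sup>2 + S\<^sup>2 = 1" by (simp add: S_def)
  let ?s = "reflection C S"
  have lin: "linear ?s" by (rule linearI) (simp_all add: vec2_eq_iff algebra_simps)
  have "?s x \<bullet> ?s y = (C\<^sup>2 + S\<^sup>2) * (x \<bullet> y)" for x y by (simp add: inner_vec2 algebra_simps power2_eq_square)
  then have orth: "orthogonal_transformation ?s" using lin CS by (simp add: orthogonal_transformation_def)
  have "?s (?s x) = (C\<^sup>2 + S\<^sup>2) *\<^sub>R x" for x by (simp add: vec2_eq_iff algebra_simps power2_eq_square)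
  then have "?s \<circ> ?s = id" using CS by auto
  moreover have "id \<in> point_group \<Gamma>"
    using point_group_finite_orthogonal_group(1)[OF uv] by (simp add: finite_orthogonal_group_def \<Gamma>_def)
  ultimately have sq: "?s \<circ> ?s \<in> point_group \<Gamma>" by simp
  have comm: "?s \<circ> f = f \<circ> ?s" if "f \<in> point_group \<Gamma>" for f
  proof -
    have "f = id \<or> f = uminus" using that P by (auto simp: \<Gamma>_def)
    then show ?thesis using linear_neg[OF lin] by auto
  qed
  have "x = 0" if x: "x \<in> \<Gamma>" "x \<in> ?s ` \<Gamma>" for x
  proof (rule ccontr)
    assume "x \<noteq> 0"
    obtain y where y: "y \<in> \<Gamma>" "x = ?s y" using x(2) by blast
    have "y \<noteq> 0" using \<open>x \<noteq> 0\<close> y(2) linear_0[OF lin] by auto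
    then have yy: "y \<bullet> y \<noteq> 0" by simp
    have "x $ 1 * y $ 1 - x $ 2 * y $ 2 = C * (y \<bullet> y)" by (simp add: y(2) inner_vec2 algebra_simps)
    then have "C = (x $ 1 * y $ 1 - x $ 2 * y $ 2) / (y \<bullet> y)" using yy by simp
    then have "C \<in> A" unfolding A_def using x(1) y(1) by (intro image_eqI[of _ _ "(x, y)"]) auto
    then show False using C by blast
  qed
  then have "\<Gamma> \<inter> ?s ` \<Gamma> \<subseteq> {0}" by blast
  then show ?thesis
    using index_two_cell_of_extension[OF uv refl refl orth, folded \<Gamma>_def] sq comm by (metis \<Gamma>_def)
qed

text \<open>
  In units of half the common divisor \<open>c\<close> of the sides, the plane is cut into unit boxes \<open>(K, L)\<close> on
  which the lattice acts by adding \<open>(2pi, 2qj)\<close>. The boxes on the two diagonals \<open>L = K\<close> and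
  \<open>L = - 1 - K\<close> with \<open>- pq \<le> K < pq\<close> form a transversal that is invariant under the quarter turn.
\<close>

lemma folded_index_unique:
  fixes p q i j K L :: int
  assumes pq: "0 < p" "0 < q" "coprime p q"
    and L: "L = K \<or> L = - 1 - K" "L + 2 * q * j = K + 2 * p * i \<or> L + 2 * q * j = - 1 - (K + 2 * p * i)"
    and K: "- (p * q) \<le> K" "K < p * q" "- (p * q) \<le> K + 2 * p * i" "K + 2 * p * i < p * q"
  shows "i = 0 \<and> j = 0"
proof -
  \<comment> \<open>The parity of \<open>L - K\<close> tells the two diagonals apart, so even shifts
    cannot lead from one to the other.\<close>
  have "m = n \<or> m = - n" if "L + 2 * n = K + 2 * m \<or> L + 2 * n = - 1 - (K + 2 * m)" for m n :: int
    using that L(1) by presburger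
  then have eq: "p * i = q * j \<or> p * i = - (q * j)" using L(2) by (simp add: mult.assoc)
  then have "q dvd p * i" by (metis dvd_minus_iff dvd_triv_left)
  then have "q dvd i" using pq(3) by (metis coprime_commute coprime_dvd_mult_right_iff)
  then obtain t where t: "i = q * t" by blast
  have "\<bar>p * i\<bar> < p * q" using K by linarith
  then have "p * q * \<bar>t\<bar> < p * q * 1" using pq by (simp add: t abs_mult mult.assoc)
  then have "t = 0" using pq by (simp add: mult_less_cancel_left_pos)
  then have "i = 0" by (simp add: t)
  then show ?thesis using eq pq by auto
qed

text \<open>The parity of \<open>L - K\<close> selects the diagonal and Bezout's identity reaches
  it. Adding \<open>q * t\<close> to \<open>i\<close> and \<open>e * p * t\<close> to
  \<open>j\<close>, with \<open>e\<close> the slope of the diagonal, stays on it and changes the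
  first index by \<open>2 * p * q * t\<close>; reduction modulo \<open>2 * (p * q)\<close> reaches
  the required range.\<close>

lemma folded_index_exists:
  fixes p q K L :: int
  assumes pq: "0 < p" "0 < q" "coprime p q"
  obtains i j where "L + 2 * q * j = K + 2 * p * i \<or> L + 2 * q * j = - 1 - (K + 2 * p * i)"
    "- (p * q) \<le> K + 2 * p * i" "K + 2 * p * i < p * q"
proof -
  obtain x y where xy: "x * p + y * q = 1" using bezout_int[of p q] pq(3) by (auto simp: coprime_iff_gcd_eq_1)
  obtain i0 j0 e :: int where e: "L + 2 * q * j0 = K + 2 * p * i0 \<and> e = 1 \<or>
      L + 2 * q * j0 = - 1 - (K + 2 * p * i0) \<and> e = - 1"
  proof (cases "even (L - K)")
    case True
    then obtain m where m: "L - K = 2 * m" by blast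
    have "m = m * (x * p + y * q)" by (simp add: xy)
    then have "L + 2 * q * (- (m * y)) = K + 2 * p * (m * x)" using m by (simp add: algebra_simps)
    then show ?thesis using that[of "- (m * y)" "m * x" 1] by blast
  next
    case False
    then have "even (L + K + 1)" by presburger
    then obtain m where m: "L + K + 1 = 2 * m" by blast
    have "m = m * (x * p + y * q)" by (simp add: xy)
    then have "L + 2 * q * (- (m * y)) = - 1 - (K + 2 * p * (- (m * x)))" using m by (simp add: algebra_simps)
    then show ?thesis using that[of "- (m * y)" "- (m * x)" "- 1"] by blast
  qed
  define N where "N = 2 * (p * q)"
  have N: "N > 0" using pq by (simp add: N_def)
  define z where "z = K + 2 * p * i0 + p * q"
  define t where "t = - (z div N)"
  have zt: "z + N * t = z mod N" unfolding t_def using div_mult_mod_eq[of z N] by (simp add: algebra_simps)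
  have K': "K + 2 * p * (i0 + q * t) = z + N * t - p * q" by (simp add: z_def N_def algebra_simps)
  have r: "0 \<le> z mod N" "z mod N < N" using N by simp_all
  show thesis
  proof (rule that[of "j0 + e * p * t" "i0 + q * t"])
    show "L + 2 * q * (j0 + e * p * t) = K + 2 * p * (i0 + q * t) \<or>
        L + 2 * q * (j0 + e * p * t) = - 1 - (K + 2 * p * (i0 + q * t))"
      using e by (elim disjE conjE) (simp_all add: algebra_simps)
    show "- (p * q) \<le> K + 2 * p * (i0 + q * t)" "K + 2 * p * (i0 + q * t) < p * q"
      unfolding K' zt using r by (simp_all add: N_def)
  qed
qed

text \<open>On the negative side the floor is \<open>- 1 - k\<close> and not \<open>- k\<close>;
  this is the origin of the diagonal \<open>L = - 1 - K\<close>.\<close>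

lemma abs_between_imp_floor:
  fixes a :: real
  assumes "of_int k < \<bar>a\<bar>" "\<bar>a\<bar> < of_int k + 1"
  shows "\<lfloor>a\<rfloor> = k \<or> \<lfloor>a\<rfloor> = - 1 - k"
proof (cases "a \<ge> 0")
  case True
  then have "\<lfloor>a\<rfloor> = k" using assms by (intro floor_unique) auto
  then show ?thesis ..
next
  case False
  then have "\<lfloor>a\<rfloor> = - 1 - k" using assms by (intro floor_unique) auto
  then show ?thesis ..
qed

lemma floor_imp_abs_between:
  fixes a :: real
  assumes "\<lfloor>a\<rfloor> = k \<or> \<lfloor>a\<rfloor> = - 1 - k" "k \<ge> 0" "a \<notin> \<int>"
  shows "of_int k < \<bar>a\<bar>" "\<bar>a\<bar> < of_int k + 1"
proof -
  have f: "of_int \<lfloor>a\<rfloor> \<le> a" "a < of_int \<lfloor>a\<rfloor> + 1" by (auto simp: floor_correct)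
  have "of_int \<lfloor>a\<rfloor> \<noteq> a" using assms(3) by (metis Ints_of_int)
  then have f': "of_int \<lfloor>a\<rfloor> < a" by (rule order_le_neq_trans[OF f(1)])
  have k: "real_of_int k \<ge> 0" using assms(2) by simp
  show "of_int k < \<bar>a\<bar>" "\<bar>a\<bar> < of_int k + 1" using assms(1) f f' k by (elim disjE; simp)+
qed

text \<open>The quarter-turned lattice is commensurable with \<open>\<Gamma>\<close>, so the
  transversal is written down directly. The condition defining \<open>I\<close> is symmetric in the
  absolute values of \<open>A x\<close> and \<open>B x\<close>: the quarter turn exchanges them and
  \<open>P\<close> preserves each.\<close>

lemma rational_rectangle_case:
  fixes a :: "real^2" and p q :: int
  assumes a: "norm a = 1" and c: "c > 0" and pq: "0 < p" "p < q" "coprime p q"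
  shows "has_index_two_cell (lat ((of_int p * c) *\<^sub>R a) ((of_int q * c) *\<^sub>R rot90 a))"
proof -
  define b where "b = rot90 a"
  define u where "u = (of_int p * c) *\<^sub>R a"
  define v where "v = (of_int q * c) *\<^sub>R b"
  have q0: "0 < q" using pq by simp
  have pqc: "real_of_int p * c > 0" "real_of_int q * c > 0" using pq c by simp_all
  have aa: "a \<bullet> a = 1" using a by (simp add: norm_eq_1)
  have ab: "a \<bullet> b = 0" "b \<bullet> a = 0" "b \<bullet> b = 1" using aa by (simp_all add: b_def inner_vec2 algebra_simps)
  have uv: "area u v \<noteq> 0"
  proof -
    have "area u v = (of_int p * c) * (of_int q * c) * (a \<bullet> a)"
      by (simp add: u_def v_def b_def area_nth inner_vec2 algebra_simps)
    then have "area u v = (of_int p * c) * (of_int q * c)" by (simp only: aa mult_1_right)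
    then show ?thesis using mult_pos_pos[OF pqc] by linarith
  qed
  define P where "P = point_group (lat u v)"
  define A where "A x = 2 * (a \<bullet> x) / c" for x
  define B where "B x = 2 * (b \<bullet> x) / c" for x
  have shift: "A (x + (of_int i *\<^sub>R u + of_int j *\<^sub>R v)) = A x + of_int (2 * p * i)"
    "B (x + (of_int i *\<^sub>R u + of_int j *\<^sub>R v)) = B x + of_int (2 * q * j)" for x and i j :: int
    using c by (simp_all add: A_def B_def u_def v_def inner_add_right aa ab field_simps)
  have rotAB: "A (rot90 x) = - B x" "B (rot90 x) = A x" for x
    by (simp_all add: A_def B_def b_def inner_vec2 algebra_simps minus_divide_left)
  have PAB: "\<bar>A (f x)\<bar> = \<bar>A x\<bar> \<and> \<bar>B (f x)\<bar> = \<bar>B x\<bar>" and Pa: "f a = a \<or> f a = - a" if f: "f \<in> P" for f x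
  proof -
    have orth: "orthogonal_transformation f" and fl: "f ` lat u v = lat u v" using f by (auto simp: P_def point_group_def)
    have lin: "linear f" using orth by (rule orthogonal_transformation_linear)
    have "u = of_int 1 *\<^sub>R u + of_int 0 *\<^sub>R v" by simp
    then have "u \<in> lat u v" unfolding lat_def by blast
    then have "f u \<in> lat u v" using fl by blast
    then obtain i j :: int where ij: "f u = of_int i *\<^sub>R u + of_int j *\<^sub>R v" by (auto simp: lat_def)
    have "c *\<^sub>R (of_int p *\<^sub>R f a) = c *\<^sub>R ((of_int i * of_int p) *\<^sub>R a + (of_int j * of_int q) *\<^sub>R b)"
      using ij by (simp add: u_def v_def linear_cmul[OF lin] algebra_simps)
    then have fa: "of_int p *\<^sub>R f a = (of_int i * of_int p) *\<^sub>R a + (of_int j * of_int q) *\<^sub>R b"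
      by (rule scaleR_left_imp_eq[rotated]) (use c in simp)
    have faa: "f a \<bullet> f a = 1" using orth aa by (simp add: orthogonal_transformation_def)
    have "(of_int p *\<^sub>R f a) \<bullet> (of_int p *\<^sub>R f a) = real_of_int (p * p)" by (simp add: faa)
    moreover have "(of_int p *\<^sub>R f a) \<bullet> (of_int p *\<^sub>R f a) = real_of_int (i * p * (i * p) + j * q * (j * q))"
      unfolding fa by (simp add: inner_add_left inner_add_right aa ab)
    ultimately have int: "p * p = i * p * (i * p) + j * q * (j * q)" by linarith
    \<comment> \<open>A component of \<open>f a\<close> along the longer side would contribute at
      least \<open>q * q\<close>, which exceeds \<open>p * p\<close>. This is where the sides must
      be distinct.\<close>
    have "j = 0"
    proof (rule ccontr)
      assume "j \<noteq> 0"
      then have "j * j \<ge> 1" by (metis int_one_le_iff_zero_less not_square_less_zero linorder_neqE_linordered_idom mult_eq_0_iff)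
      then have "(q * q) * 1 \<le> (q * q) * (j * j)" by (intro mult_left_mono) auto
      moreover have "p * p < q * q" using pq by (intro mult_strict_mono) auto
      moreover have "0 \<le> i * p * (i * p)" by simp
      moreover have "j * q * (j * q) = (q * q) * (j * j)" by (simp only: ac_simps)
      ultimately show False using int by linarith
    qed
    then have "(p * p) * (i * i) = (p * p) * 1" using int by (simp add: algebra_simps)
    then have "i * i = 1" using pq by simp
    then have i: "i = 1 \<or> i = - 1" by (metis zmult_eq_1_iff)
    have "of_int p *\<^sub>R f a = of_int p *\<^sub>R (of_int i *\<^sub>R a)" using fa \<open>j = 0\<close> by simp
    then have "f a = of_int i *\<^sub>R a" by (rule scaleR_left_imp_eq[rotated]) (use pq in simp)
    then show "f a = a \<or> f a = - a" using i by auto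
    then have fb: "f b = b \<or> f b = - b"
      using orthogonal_rot90_commute[OF orth] linear_neg[OF linear_rot90, of a] by (auto simp: b_def)
    have inner: "f y \<bullet> f x = y \<bullet> x" for y using orth by (simp add: orthogonal_transformation_def)
    have "a \<bullet> f x = a \<bullet> x \<or> a \<bullet> f x = - (a \<bullet> x)" using \<open>f a = a \<or> f a = - a\<close> inner[of a] by auto
    moreover have "b \<bullet> f x = b \<bullet> x \<or> b \<bullet> f x = - (b \<bullet> x)" using fb inner[of b] by auto
    ultimately show "\<bar>A (f x)\<bar> = \<bar>A x\<bar> \<and> \<bar>B (f x)\<bar> = \<bar>B x\<bar>" by (auto simp: A_def B_def)
  qed
  define I where "I = (\<Union>k\<in>{0..<p * q}. {x. of_int k < \<bar>A x\<bar> \<and> \<bar>A x\<bar> < of_int k + 1 \<and> of_int k < \<bar>B x\<bar> \<and> \<bar>B x\<bar> < of_int k + 1})"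
  have sq: "rot90 \<circ> rot90 \<in> P"
  proof -
    have "rot90 \<circ> rot90 = uminus" by (rule ext) (simp add: vec2_eq_iff)
    then show ?thesis using point_group_finite_orthogonal_group(2)[OF uv] by (simp add: P_def)
  qed
  have "has_index_two_cell (lat u v)"
  proof (rule index_two_cell_of_transversal[OF uv refl P_def, of rot90 I])
    show "orthogonal_transformation rot90" using orthogonal_rot[of 0 1] by (simp add: rot_0_1)
    show "rot90 \<circ> rot90 \<in> P" by (rule sq)
    show "rot90 \<notin> P"
    proof
      assume "rot90 \<in> P"
      then have "b = a \<or> b = - a" using Pa by (simp add: b_def)
      then show False using ab aa by auto
    qed
    show "\<exists>g\<in>P. rot90 \<circ> f = g \<circ> rot90" if "f \<in> P" for f
      using rotation_normalises_point_group(1)[OF uv P_def, of 0 1 f] sq that by (simp add: rot_0_1)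
    have cont: "continuous_on UNIV A" "continuous_on UNIV B"
      unfolding A_def B_def using c by (auto intro!: continuous_intros)
    show "open I"
      unfolding I_def using cont by (intro open_UN ballI open_Collect_conj open_Collect_less continuous_intros) auto
    show "bounded I"
    proof -
      have "norm x \<le> c * (of_int (p * q) + 1)" if "x \<in> I" for x
      proof -
        obtain k where k: "k < p * q" "\<bar>A x\<bar> < of_int k + 1" "\<bar>B x\<bar> < of_int k + 1" using \<open>x \<in> I\<close> by (auto simp: I_def)
        have "x = (a \<bullet> a) *\<^sub>R x" using aa by simp
        also have "\<dots> = (a \<bullet> x) *\<^sub>R a + (b \<bullet> x) *\<^sub>R b"
          by (simp add: b_def vec2_eq_iff inner_vec2 algebra_simps)
        also have "\<dots> = (c * A x / 2) *\<^sub>R a + (c * B x / 2) *\<^sub>R b" using c by (simp add: A_def B_def)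
        finally have "norm x \<le> norm ((c * A x / 2) *\<^sub>R a) + norm ((c * B x / 2) *\<^sub>R b)" by (metis norm_triangle_ineq)
        also have "\<dots> = c * ((\<bar>A x\<bar> + \<bar>B x\<bar>) / 2)" using c a by (simp add: b_def abs_mult algebra_simps)
        also have "\<dots> \<le> c * (of_int (p * q) + 1)"
        proof -
          have "(\<alpha> + \<beta>) / 2 \<le> m + 1" if "\<kappa> \<le> m" "\<alpha> < \<kappa> + 1" "\<beta> < \<kappa> + 1" for \<alpha> \<beta> \<kappa> m :: real
            using that by (simp add: field_simps)
          moreover have "real_of_int k \<le> of_int (p * q)" using k(1) by (simp only: of_int_le_iff)
          ultimately have "(\<bar>A x\<bar> + \<bar>B x\<bar>) / 2 \<le> of_int (p * q) + 1" using k(2,3) by blast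
          then show ?thesis using c by (intro mult_left_mono) auto
        qed
        finally show ?thesis .
      qed
      then show ?thesis by (auto simp: bounded_iff)
    qed
    show "f x \<in> I" if "f \<in> P" "x \<in> I" for f x using that(2) PAB[OF that(1), of x] by (simp add: I_def)
    show "rot90 x \<in> I" if "x \<in> I" for x using that by (auto simp: I_def rotAB)
    have floors: "(\<lfloor>B x\<rfloor> = \<lfloor>A x\<rfloor> \<or> \<lfloor>B x\<rfloor> = - 1 - \<lfloor>A x\<rfloor>) \<and> - (p * q) \<le> \<lfloor>A x\<rfloor> \<and> \<lfloor>A x\<rfloor> < p * q" if x: "x \<in> I" for x
    proof -
      obtain k where k: "0 \<le> k" "k < p * q" "of_int k < \<bar>A x\<bar>" "\<bar>A x\<bar> < of_int k + 1" "of_int k < \<bar>B x\<bar>" "\<bar>B x\<bar> < of_int k + 1"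
        using x by (auto simp: I_def)
      show ?thesis using abs_between_imp_floor[OF k(3,4)] abs_between_imp_floor[OF k(5,6)] k(1,2) by linarith
    qed
    show "x = y" if xy: "x \<in> I" "y \<in> I" "x - y \<in> lat u v" for x y
    proof -
      obtain i j :: int where ij: "x - y = of_int i *\<^sub>R u + of_int j *\<^sub>R v" using xy(3) by (auto simp: lat_def)
      then have x: "x = y + (of_int i *\<^sub>R u + of_int j *\<^sub>R v)" by (simp add: algebra_simps)
      have A: "\<lfloor>A x\<rfloor> = \<lfloor>A y\<rfloor> + 2 * p * i" unfolding x shift(1) by (rule floor_add_int[symmetric])
      have B: "\<lfloor>B x\<rfloor> = \<lfloor>B y\<rfloor> + 2 * q * j" unfolding x shift(2) by (rule floor_add_int[symmetric])
      have "i = 0 \<and> j = 0"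
        using folded_index_unique[OF pq(1) q0 pq(3), of "\<lfloor>B y\<rfloor>" "\<lfloor>A y\<rfloor>" j i] floors[OF xy(1)] floors[OF xy(2)]
        unfolding A B by blast
      then show ?thesis using ij by simp
    qed
    show "\<exists>x\<in>W. \<exists>\<gamma>\<in>lat u v. x + \<gamma> \<in> I" if W: "open W" "W \<noteq> {}" for W
    proof -
      \<comment> \<open>Off this null set neither coordinate is an integer, so floors can be
        translated back into the strict inequalities that define \<open>I\<close>.\<close>
      define N where "N = (\<Union>m\<in>\<int>. {x. a \<bullet> x = m * c / 2} \<union> {x. b \<bullet> x = m * c / 2})"
      have "a \<noteq> 0" "b \<noteq> 0" using aa ab by auto
      then have "negligible ({x. a \<bullet> x = m * c / 2} \<union> {x. b \<bullet> x = m * c / 2})" for m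
        by (intro negligible_Un negligible_hyperplane) auto
      moreover have "countable (\<int> :: real set)" unfolding Ints_def by (intro countable_image) auto
      ultimately have "negligible N" unfolding N_def by (intro negligible_countable_Union countable_image) auto
      then have "\<not> W \<subseteq> N" using open_not_negligible[OF W] negligible_subset by blast
      then obtain x where x: "x \<in> W" "x \<notin> N" by blast
      have nA: "A x \<notin> \<int>"
      proof
        assume "A x \<in> \<int>"
        moreover have "a \<bullet> x = A x * c / 2" using c by (simp add: A_def)
        ultimately show False using x(2) by (auto simp: N_def)
      qed
      have nB: "B x \<notin> \<int>"
      proof
        assume "B x \<in> \<int>"
        moreover have "b \<bullet> x = B x * c / 2" using c by (simp add: B_def)
        ultimately show False using x(2) by (auto simp: N_def)
      qed
      obtain i j where ij: "\<lfloor>B x\<rfloor> + 2 * q * j = \<lfloor>A x\<rfloor> + 2 * p * i \<or> \<lfloor>B x\<rfloor> + 2 * q * j = - 1 - (\<lfloor>A x\<rfloor> + 2 * p * i)"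
          "- (p * q) \<le> \<lfloor>A x\<rfloor> + 2 * p * i" "\<lfloor>A x\<rfloor> + 2 * p * i < p * q"
        using folded_index_exists[OF pq(1) q0 pq(3)] by blast
      define \<gamma> where "\<gamma> = of_int i *\<^sub>R u + of_int j *\<^sub>R v"
      have A: "\<lfloor>A (x + \<gamma>)\<rfloor> = \<lfloor>A x\<rfloor> + 2 * p * i" unfolding \<gamma>_def shift(1) by (rule floor_add_int[symmetric])
      have B: "\<lfloor>B (x + \<gamma>)\<rfloor> = \<lfloor>B x\<rfloor> + 2 * q * j" unfolding \<gamma>_def shift(2) by (rule floor_add_int[symmetric])
      have nA': "A (x + \<gamma>) \<notin> \<int>"
        using nA unfolding \<gamma>_def shift(1) by (metis Ints_diff Ints_of_int add_diff_cancel_right')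
      have nB': "B (x + \<gamma>) \<notin> \<int>"
        using nB unfolding \<gamma>_def shift(2) by (metis Ints_diff Ints_of_int add_diff_cancel_right')
      define K where "K = \<lfloor>A (x + \<gamma>)\<rfloor>"
      define k where "k = (if K \<ge> 0 then K else - 1 - K)"
      have k: "0 \<le> k" "k < p * q" using ij(2,3) unfolding A[symmetric] K_def[symmetric] by (auto simp: k_def)
      have fA: "\<lfloor>A (x + \<gamma>)\<rfloor> = k \<or> \<lfloor>A (x + \<gamma>)\<rfloor> = - 1 - k" by (auto simp: k_def K_def)
      have fB: "\<lfloor>B (x + \<gamma>)\<rfloor> = k \<or> \<lfloor>B (x + \<gamma>)\<rfloor> = - 1 - k" using ij(1) unfolding A[symmetric] B[symmetric] by (auto simp: k_def K_def)
      have "x + \<gamma> \<in> I"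
        unfolding I_def using k floor_imp_abs_between[OF fA k(1) nA'] floor_imp_abs_between[OF fB k(1) nB'] by auto
      moreover have "\<gamma> \<in> lat u v" unfolding lat_def \<gamma>_def by blast
      ultimately show ?thesis using x(1) by blast
    qed
  qed
  then show ?thesis by (simp add: u_def v_def b_def)
qed

text \<open>Equal sides go to \<open>square_case\<close>, because the quarter turn then already
  belongs to the point group. For distinct commensurable sides, the ratio in lowest terms supplies
  \<open>p\<close> and \<open>q\<close>.\<close>

lemma rectangular_case:
  assumes uv: "area u v \<noteq> 0" "u \<bullet> v = 0"
  shows "has_index_two_cell (lat u v)"
proof -
  have strict: "has_index_two_cell (lat u v)" if uv: "u \<noteq> 0" "u \<bullet> v = 0" "norm u < norm v"
    and r: "of_int i * norm u = of_int j * norm v" "i \<noteq> 0 \<or> j \<noteq> 0" for u v :: "real^2" and i j :: int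
  proof -
    have nz: "norm u > 0" "norm v > 0" using uv(1,3) by auto
    have "i \<noteq> 0" using r nz by auto
    then have "norm u / norm v = of_int j / of_int i" using r(1) nz by (simp add: field_simps)
    then have "norm u / norm v \<in> \<rat>" by simp
    then obtain m n :: nat where mn: "n \<noteq> 0" "\<bar>norm u / norm v\<bar> = of_nat m / of_nat n" "coprime m n"
      by (rule Rats_abs_nat_div_natE)
    define p where "p = int m"
    define q where "q = int n"
    define c where "c = norm v / of_int q"
    have q: "q > 0" using mn(1) by (simp add: q_def)
    have c: "c > 0" "norm v = of_int q * c" using nz q by (simp_all add: c_def)
    have "norm u / norm v = of_int p / of_int q" using mn(2) nz by (simp add: p_def q_def)
    then have nu: "norm u = of_int p * c" using nz q by (simp add: c_def field_simps)
    have p: "0 < p" "p < q" using uv(3) nz(1) c unfolding nu c(2) by (auto simp: zero_less_mult_iff)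
    have cop: "coprime p q" using mn(3) by (simp add: p_def q_def)
    define a where "a = (1 / norm u) *\<^sub>R u"
    define b where "b = (1 / norm v) *\<^sub>R v"
    have na: "norm a = 1" "norm b = 1" using nz by (simp_all add: a_def b_def)
    have "a \<bullet> b = 0" using uv(2) by (simp add: a_def b_def)
    then have b: "b = rot90 a \<or> b = - rot90 a" using orthogonal_vectors_rot90[of a b] na by force
    have u: "u = (of_int p * c) *\<^sub>R a" unfolding nu[symmetric] using nz by (simp add: a_def)
    have v: "v = (of_int q * c) *\<^sub>R b" unfolding c(2)[symmetric] using nz by (simp add: b_def)
    have "lat u v = lat ((of_int p * c) *\<^sub>R a) ((of_int q * c) *\<^sub>R rot90 a)"
      unfolding u v using b lat_minus by auto
    then show ?thesis using rational_rectangle_case[OF na(1) c(1) p cop] by simp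
  qed
  have nz: "u \<noteq> 0" "v \<noteq> 0" using uv(1) by (auto simp: area_nth)
  show ?thesis
  proof (cases "\<exists>i j :: int. of_int i * norm u = of_int j * norm v \<and> (i \<noteq> 0 \<or> j \<noteq> 0)")
    case False
    then show ?thesis using irrational_rectangle_case[OF uv] by blast
  next
    case True
    then obtain i j :: int where ij: "of_int i * norm u = of_int j * norm v" "i \<noteq> 0 \<or> j \<noteq> 0" by blast
    consider "norm u = norm v" | "norm u < norm v" | "norm v < norm u" by linarith
    then show ?thesis
    proof cases
      case 1
      then show ?thesis using square_case[OF uv] by blast
    next
      case 2
      then show ?thesis using strict[OF nz(1) uv(2) 2 ij] by blast
    next
      case 3
      have "v \<bullet> u = 0" using uv(2) by (simp add: inner_commute)
      then have "has_index_two_cell (lat v u)" using strict[OF nz(2) _ 3 ij(1)[symmetric]] ij(2) by blast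
      then show ?thesis by (metis lat_commute)
    qed
  qed
qed

theorem theorem1p1:
  fixes \<Gamma> :: "(real^2) set"
  assumes "is_lattice \<Gamma>"
    and "\<not> rhombic \<Gamma>"
  shows "\<exists>F. fundamental_cell \<Gamma> F \<and>
             subgroup (point_group \<Gamma>) (symmetry_group F) \<and>
             card (rcosets\<^bsub>symmetry_group F\<^esub> (point_group \<Gamma>)) = 2"
proof -
  have "has_index_two_cell \<Gamma>"
    using assms
  proof (cases rule: nonrhombic_lattice_cases)
    case (oblique u v)
    then show ?thesis using oblique_case by blast
  next
    case (rectangular u v)
    then show ?thesis using rectangular_case by blast
  next
    case (hexagonal u v)
    then show ?thesis using hexagonal_case by blast
  qed
  then show ?thesis by (simp add: has_index_two_cell_def)
qed

end
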